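(* Let $n\ge 2$, $1\le k\le n-1$, and let $R_t$ be the shifted Funk-Radon transform on $S^n$ associated with $k$-dimensional totally geodesic submanifolds. The set of all $t\in (0,\pi/2)$ for which $R_t$ is non-injective on $L^1_{even} (S^n)$ is everywhere dense in $(0,\pi/2)$, and so is the set of all $t\in(0,\pi/2)$ for which $R_t$ is injective on $L^1_{even}(S^n)$.
   Context: $S^n$ is the unit sphere in $\mathbb{R}^{n+1}$, $n\ge2$, with coordinate unit vectors $e_1,\dots,e_{n+1}$; $L^1_{even}(S^n)$ is the space of (classes of) integrable functions $f$ on $S^n$ with $f(-x)=f(x)$ a.e. $V_{n+1,n-k}$ is the Stiefel manifold of real $(n+1)\times(n-k)$ matrices $v$ with $v^Tv=I_{n-k}$, with its invariant probability measure. $\Xi$ is the set of all $k$-dimensional totally geodesic submanifolds $\xi$ of $S^n$; each has the form $\xi=S^n\cap v^\perp$ with $v\in V_{n+1,n-k}$, where $v^\perp$ is the $(k+1)$-dimensional linear subspace orthogonal to the columns of $v$. $\Xi$ carries its $O(n+1)$-invariant probability measure, and functions on $\Xi$ are identified with right $O(n-k)$-invariant functions on $V_{n+1,n-k}$. Shifted Funk-Radon transform: write $\mathbb{R}^{n+1}=\mathbb{R}^{k+1}\times\mathbb{R}^{n-k}$ with $\mathbb{R}^{k+1}=\mathrm{span}(e_1,\dots,e_{k+1})$, $\mathbb{R}^{n-k}=\mathrm{span}(e_{k+2},\dots,e_{n+1})$, let $S^k$, $S^{n-k-1}$ be the unit spheres in these subspaces with normalized (probability) surface measures $d_*\eta$,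 $d_*\zeta$ ($S^0=\{\pm1\}$ with mass $1/2$ at each point). Let $v_0=\begin{bmatrix}0\\ I_{n-k}\end{bmatrix}\in V_{n+1,n-k}$, and for $v\in V_{n+1,n-k}$ let $r_v\in O(n+1)$ be any map with $r_vv_0=v$. Then for $\xi=S^n\cap v^\perp$, $$(R_tf)(\xi)=\int_{S^{n-k-1}}d_*\zeta\int_{S^k}f\big(r_v(\eta\cos t+\zeta\sin t)\big)\,d_*\eta .$$ This is the average of $f$ over the points of $S^n$ at geodesic distance $t$ from $\xi$. *)

theory Defs
  imports "HOL-Probability.Probability"
begin

text \<open>
  The ambient space $\mathbb{R}^{n+1} = \mathbb{R}^{k+1} \times \mathbb{R}^{n-k}$ is
  \<open>real ^ ('p + 'q)\<close> with \<open>CARD('p) = k + 1\<close> and \<open>CARD('q) = n - k\<close>: the indices \<open>Inl _\<close>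
  stand for $1, \dots, k+1$ and the indices \<open>Inr _\<close> for $k+2, \dots, n+1$.
\<close>

definition emb_upper :: "real ^ 'p \<Rightarrow> real ^ ('p::finite + 'q::finite)" where
  "emb_upper \<eta> = (\<chi> i. case i of Inl a \<Rightarrow> \<eta> $ a | Inr _ \<Rightarrow> 0)"

definition emb_lower :: "real ^ 'q \<Rightarrow> real ^ ('p::finite + 'q::finite)" where
  "emb_lower \<zeta> = (\<chi> i. case i of Inl _ \<Rightarrow> 0 | Inr b \<Rightarrow> \<zeta> $ b)"

text \<open>
  Normalized surface measure on the unit sphere, as a cone measure: the measure of \<open>A\<close> is the
  fraction of the volume of the unit ball that is occupied by the cone over \<open>A\<close>. The function
  \<open>sgn\<close> is the radial projection \<open>x \<mapsto> x / norm x\<close>; the origin is removed because it has none.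
  In dimension one this gives mass $1/2$ to each of the two points.
\<close>

definition sphere_measure :: "'a::euclidean_space measure" where
  "sphere_measure =
     distr (uniform_measure (restrict_space lborel (- {0})) (cball 0 1 - {0}))
       (restrict_space borel (sphere 0 1)) sgn"

text \<open>
  Functions stand for their classes modulo equality almost everywhere; values off the unit
  sphere are irrelevant, since \<open>space sphere_measure = sphere 0 1\<close>.
\<close>

definition L1_even :: "('a::euclidean_space \<Rightarrow> real) set" where
  "L1_even = {f. integrable sphere_measure f \<and> (AE x in sphere_measure. f (- x) = f x)}"

definition stiefel :: "(real ^ 'q ^ 'm) set" where
  "stiefel = {v. transpose v ** v = mat 1}"

text \<open>Since $O(n+1)$ is compact and acts transitively, there is exactly one such \<open>\<mu>\<close>.\<close>

definition invariant_prob_on_stiefel :: "(real ^ 'q ^ 'm) measure \<Rightarrow> bool" where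
  "invariant_prob_on_stiefel \<mu> \<longleftrightarrow>
     prob_space \<mu> \<and> sets \<mu> = sets (restrict_space borel stiefel) \<and>
     (\<forall>U :: real ^ 'm ^ 'm. orthogonal_matrix U \<longrightarrow> distr \<mu> \<mu> (\<lambda>v. U ** v) = \<mu>)"

definition v0 :: "real ^ 'q ^ ('p::finite + 'q::finite)" where
  "v0 = (\<chi> i j. case i of Inl _ \<Rightarrow> 0 | Inr b \<Rightarrow> (if b = j then 1 else 0))"

text \<open>
  The choice of the rotation is immaterial, because two candidates differ by an orthogonal map
  fixing \<open>v0\<close>, which acts on the first factor only and preserves the measure on its sphere.
\<close>

definition frame_rotation ::
  "real ^ 'q ^ ('p::finite + 'q::finite) \<Rightarrow> real ^ ('p + 'q) ^ ('p + 'q)" where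
  "frame_rotation v = (SOME r. orthogonal_matrix r \<and> r ** v0 = v)"

text \<open>
  A function on the set of \<open>k\<close>-dimensional totally geodesic submanifolds is regarded as a right
  $O(n-k)$-invariant function on the Stiefel manifold: \<open>v\<close> represents the submanifold of all
  unit vectors orthogonal to the columns of \<open>v\<close>.
\<close>

definition shifted_funk_radon ::
  "real \<Rightarrow> (real ^ ('p::finite + 'q::finite) \<Rightarrow> real) \<Rightarrow> real ^ 'q ^ ('p + 'q) \<Rightarrow> real" where
  "shifted_funk_radon t f v =
     (\<integral>\<zeta>. (\<integral>\<eta>. f (frame_rotation v *v (cos t *\<^sub>R emb_upper \<eta> + sin t *\<^sub>R emb_lower \<zeta>))
        \<partial>(sphere_measure :: (real ^ 'p) measure)) \<partial>(sphere_measure :: (real ^ 'q) measure))"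

definition funk_radon_injective ::
  "(real ^ 'q ^ ('p::finite + 'q::finite)) measure \<Rightarrow> real \<Rightarrow> bool" where
  "funk_radon_injective \<mu> t \<longleftrightarrow>
     (\<forall>f \<in> L1_even. \<forall>g \<in> L1_even.
        (AE v in \<mu>. shifted_funk_radon t f v = shifted_funk_radon t g v) \<longrightarrow>
        (AE x in sphere_measure. f x = g x))"

end

theory Submission
  imports Defs
begin

text \<open>
Write \<open>d = n + 1\<close>, \<open>p = k + 1\<close>, \<open>q = n - k\<close>. The transform \<open>R\<^sub>t\<close> commutes with the
orthogonal group, so it acts on the spherical harmonics of each even degree \<open>2 j\<close> through one
scalar, the Jacobi function
\<open>\<phi>\<^sub>j(t) = \<Sum>\<^sub>l a\<^sub>l (cos t)\<^bsup>2 l\<^esup> (sin t)\<^bsup>2 (j - l)\<^esup>\<close>, and it is non-injective exactly when one of these scalars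
vanishes. The zeros of all \<open>\<phi>\<^sub>j\<close> form a countable dense subset of the interval, which gives both
halves of the theorem. The proof below reaches this conclusion without the theory of spherical
harmonics; the two halves use different families of test functions.

\<^bold>\<open>Non-injectivity.\<close> For orthonormal \<open>a, b\<close> the complex vector \<open>\<omega> = a + i b\<close> is null, and
\<open>f x = Re ((x \<bullet> \<omega>)\<^bsup>2 j\<^esup>)\<close> is an even harmonic polynomial. After a rotation,
\<open>\<omega>\<close> splits into parts \<open>\<alpha>\<close> and \<open>\<beta>\<close> in the two factors, with \<open>\<alpha> \<bullet> \<alpha> = - \<beta> \<bullet> \<beta>\<close>. The moments
\<open>\<integral> (\<eta> \<bullet> \<alpha>)\<^bsup>2 l\<^esup>\<close> are multiples of \<open>(\<alpha> \<bullet> \<alpha>)\<^bsup>l\<^esup>\<close>, hence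
\<open>R\<^sub>t f = Re ((\<alpha> \<bullet> \<alpha>)\<^bsup>j\<^esup>) \<phi>\<^sub>j(t)\<close> (\<open>integral_null_power\<close>), which is zero for every frame as soon as
\<open>\<phi>\<^sub>j(t) = 0\<close>. The recursion for the moments turns into the Jacobi differential equation for
\<open>\<phi>\<^sub>j\<close>; its eigenvalue grows like \<open>4 j\<^sup>2\<close>, so by a Sturm oscillation argument \<open>\<phi>\<^sub>j\<close> has a zero in
any prescribed subinterval of \<open>(0, pi / 2)\<close> once \<open>j\<close> is large (\<open>jacobi_zeros_dense\<close>).

\<^bold>\<open>Injectivity.\<close> If \<open>R\<^sub>t f = R\<^sub>t g\<close> almost everywhere, integrate both sides against the
\<open>2 j\<close>-th power of \<open>v\<^sub>c \<bullet> y\<close>, where \<open>v\<^sub>c\<close> is one column of the frame and \<open>y\<close> a unit vector. The adjoint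
of \<open>R\<^sub>t\<close> sends this power to an even polynomial of degree at most \<open>2 j\<close> in \<open>x \<bullet> y\<close>
(\<open>adjoint_on_zonal_power\<close>). Its coefficient at \<open>(x \<bullet> y)\<^bsup>2 j\<^esup>\<close> is a polynomial in \<open>sin t\<close> that does
not vanish at \<open>0\<close>. Outside a countable set of \<open>t\<close> all these coefficients are non-zero, and
induction on \<open>j\<close> shows that \<open>F = f - g\<close> is orthogonal to every power of \<open>x \<bullet> y\<close>; the odd powers
are handled by evenness. By Weierstrass approximation \<open>F\<close> is orthogonal to every continuous function
of the distance to any point \<open>y\<close> of the sphere, which forces \<open>F = 0\<close>
(\<open>sphere_function_zero_of_zonal_moments\<close>).

The formula for the adjoint rests on the joint law of a column of a random frame and a random point
at distance \<open>t\<close> from the corresponding subsphere. All laws are identified by one uniqueness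
principle in place of Haar measure: a probability measure that is invariant under
isometries acting transitively on its carrier is determined by these properties
(\<open>invariant_prob_space_unique\<close>).
\<close>

section \<open>Orthogonal maps with prescribed Gram matrix\<close>

definition reflection :: "'a::real_inner \<Rightarrow> 'a \<Rightarrow> 'a" where
  "reflection u x = x - (2 * (u \<bullet> x) / (u \<bullet> u)) *\<^sub>R u"

lemma orthogonal_reflection: "orthogonal_transformation (reflection u)"
proof -
  have "linear (reflection u)"
    by (rule linearI) (auto simp: reflection_def algebra_simps add_divide_distrib scaleR_add_left inner_add_right)
  moreover have "reflection u x \<bullet> reflection u y = x \<bullet> y" for x y
    by (cases "u = 0")
       (auto simp: reflection_def inner_diff_left inner_diff_right inner_commute field_simps)
  ultimately show ?thesis
    by (simp add: orthogonal_transformation_def)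
qed

lemma reflection_swap:
  assumes "a \<bullet> a = b \<bullet> b"
  shows "reflection (a - b) a = b"
proof (cases "a = b")
  case False
  have "(a - b) \<bullet> (a - b) = 2 * ((a - b) \<bullet> a)"
    using assms by (simp add: inner_diff_left inner_diff_right inner_commute)
  moreover have "(a - b) \<bullet> (a - b) \<noteq> 0" using False by simp
  ultimately have eq: "2 * ((a - b) \<bullet> a) / ((a - b) \<bullet> (a - b)) = 1" by (metis divide_self)
  show ?thesis unfolding reflection_def eq by simp
qed (simp add: reflection_def)

lemma reflection_fix: "u \<bullet> x = 0 \<Longrightarrow> reflection u x = x"
  by (simp add: reflection_def)

text \<open>
This is the source of all transitivity statements below: it moves pairs of unit vectors with a given
inner product, and orthonormal frames together with a normal vector. Having matched all
vectors of \<open>I\<close>, one composes with the reflection that swaps the image of the new vector with its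
target; equality of the Gram matrices says that this reflection fixes the vectors already matched.
\<close>

lemma orthogonal_transformation_of_gram:
  fixes a b :: "'i \<Rightarrow> 'a::euclidean_space"
  assumes "finite I" and "\<And>i j. i \<in> I \<Longrightarrow> j \<in> I \<Longrightarrow> a i \<bullet> a j = b i \<bullet> b j"
  obtains T where "orthogonal_transformation T" "\<And>i. i \<in> I \<Longrightarrow> T (a i) = b i"
proof -
  have "\<exists>T. orthogonal_transformation T \<and> (\<forall>i\<in>I. T (a i) = b i)"
    using assms
  proof (induction I rule: finite_induct)
    case empty
    show ?case by (rule exI[of _ "\<lambda>x. x"]) simp
  next
    case (insert i I)
    then obtain T where T: "orthogonal_transformation T" "\<And>j. j \<in> I \<Longrightarrow> T (a j) = b j"
      by blast
    define R where "R = reflection (T (a i) - b i)"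
    have "T (a i) \<bullet> T (a i) = b i \<bullet> b i"
      using T(1) insert.prems[of i i] by (simp add: orthogonal_transformation_def)
    then have Ri: "R (T (a i)) = b i"
      unfolding R_def by (rule reflection_swap)
    have Rj: "R (b j) = b j" if "j \<in> I" for j
      unfolding R_def
    proof (rule reflection_fix)
      have "T (a i) \<bullet> b j = a i \<bullet> a j"
        using T that by (metis orthogonal_transformation_def)
      then show "(T (a i) - b i) \<bullet> b j = 0"
        using insert.prems[of i j] that by (simp add: inner_diff_left)
    qed
    have "orthogonal_transformation (R \<circ> T)"
      using T(1) orthogonal_reflection unfolding R_def by (rule orthogonal_transformation_compose[rotated])
    then show ?case
      using Ri Rj T(2) by (metis comp_apply insert_iff)
  qed
  then show ?thesis using that by blast
qed

section \<open>Rotation invariance of Lebesgue measure\<close>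

lemma borel_measurable_linear:
  fixes f :: "'a::euclidean_space \<Rightarrow> 'b::euclidean_space"
  shows "linear f \<Longrightarrow> f \<in> borel_measurable borel"
  by (auto intro!: borel_measurable_continuous_onI linear_continuous_on simp: linear_conv_bounded_linear[symmetric])

text \<open>
Uniqueness of the translation invariant measure. Evaluating the double integral of
\<open>1\<^sub>A(x) 1\<^sub>B(y - x)\<close> in both orders, with \<open>B\<close> the unit ball, gives
\<open>\<rho> A * lborel B = lborel A * \<rho> (- B)\<close>, and \<open>- B = B\<close>.
\<close>

lemma translation_invariant_eq_lborel:
  fixes \<rho> :: "'a::euclidean_space measure"
  assumes sets: "sets \<rho> = sets borel" and "sigma_finite_measure \<rho>"
    and trans: "\<And>a. distr \<rho> borel (\<lambda>x. x + a) = \<rho>"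
    and ball: "emeasure \<rho> (ball 0 1) = emeasure lborel (ball (0::'a) 1)"
  shows "\<rho> = lborel"
proof (rule measure_eqI)
  interpret R: sigma_finite_measure \<rho> by fact
  interpret P: pair_sigma_finite \<rho> "lborel :: 'a measure" by standard
  note [measurable_cong] = sets
  fix A assume "A \<in> sets \<rho>"
  then have A[measurable]: "A \<in> sets borel" using sets by simp
  define B where "B = ball (0::'a) 1"
  have [measurable]: "B \<in> sets borel" by (simp add: B_def)
  have space: "space \<rho> = UNIV" using sets_eq_imp_space_eq[OF sets] by simp
  have tr: "emeasure \<rho> {x. x + a \<in> C} = emeasure \<rho> C" if "C \<in> sets borel" for C a
    using trans[of a] that emeasure_distr[of "\<lambda>x. x + a" \<rho> borel C]
    by (simp add: space vimage_def)
  have tr': "(\<integral>\<^sup>+y. g (y + a) \<partial>lborel) = (\<integral>\<^sup>+y. g y \<partial>lborel)"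
    if "g \<in> borel_measurable borel" for a :: 'a and g :: "'a \<Rightarrow> ennreal"
    using nn_integral_distr[of "(+) a" lborel borel g] that by (simp add: lborel_distr_plus add.commute)
  have tr: "(\<integral>\<^sup>+y. g (y + a) \<partial>\<rho>) = (\<integral>\<^sup>+y. g y \<partial>\<rho>)"
    if "g \<in> borel_measurable borel" for a :: 'a and g :: "'a \<Rightarrow> ennreal"
    using nn_integral_distr[of "\<lambda>x. x + a" \<rho> borel g] that by (simp add: trans)
  have sym: "indicator B (- x) = (indicator B x :: ennreal)" for x :: 'a
    by (simp add: B_def indicator_def)
  have m: "(\<lambda>y. indicator B (y - x) :: ennreal) \<in> borel_measurable borel" for x :: 'a by measurable
  have "emeasure \<rho> A * emeasure lborel B
      = (\<integral>\<^sup>+x. indicator A x * (\<integral>\<^sup>+y. indicator B y \<partial>lborel) \<partial>\<rho>)"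
    by (simp add: nn_integral_multc mult.commute)
  also have "\<dots> = (\<integral>\<^sup>+x. indicator A x * (\<integral>\<^sup>+y. indicator B (y + - x) \<partial>lborel) \<partial>\<rho>)"
    by (subst tr') (auto intro!: borel_measurable_indicator)
  also have "\<dots> = (\<integral>\<^sup>+x. (\<integral>\<^sup>+y. indicator A x * indicator B (y - x) \<partial>lborel) \<partial>\<rho>)"
    by (simp add: nn_integral_cmult m)
  also have "\<dots> = (\<integral>\<^sup>+y. (\<integral>\<^sup>+x. indicator A x * indicator B (y - x) \<partial>\<rho>) \<partial>lborel)"
    by (rule P.Fubini'[symmetric]) measurable
  also have "\<dots> = (\<integral>\<^sup>+y. (\<integral>\<^sup>+x. indicator A (x + y) * indicator B (y - (x + y)) \<partial>\<rho>) \<partial>lborel)"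
    by (subst tr) measurable
  also have "\<dots> = (\<integral>\<^sup>+y. (\<integral>\<^sup>+x. indicator A (y + x) * indicator B x \<partial>\<rho>) \<partial>lborel)"
    by (simp add: sym add.commute)
  also have "\<dots> = (\<integral>\<^sup>+x. (\<integral>\<^sup>+y. indicator A (y + x) * indicator B x \<partial>lborel) \<partial>\<rho>)"
    by (rule P.Fubini') measurable
  also have "\<dots> = (\<integral>\<^sup>+x. emeasure lborel A * indicator B x \<partial>\<rho>)"
    by (simp add: nn_integral_multc tr'[of "indicator A"])
  also have "\<dots> = emeasure lborel A * emeasure lborel B"
    using ball sets by (simp add: B_def nn_integral_cmult_indicator)
  finally have eq: "emeasure \<rho> A * emeasure lborel B = emeasure lborel A * emeasure lborel B" .
  have "emeasure lborel B \<noteq> 0"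
    using open_not_negligible[of B] by (auto simp: B_def negligible_iff_null_sets null_sets_def)
  moreover have "emeasure lborel B \<noteq> \<infinity>"
    using emeasure_lborel_ball_finite[of "0::'a" 1] by (simp add: B_def)
  ultimately show "emeasure \<rho> A = emeasure lborel A"
    using eq unfolding mult.commute[of _ "emeasure lborel B"] ennreal_mult_cancel_left
    by auto
qed (simp add: sets)

lemma lborel_orthogonal_transformation:
  fixes T :: "'a::euclidean_space \<Rightarrow> 'a"
  assumes T: "orthogonal_transformation T"
  shows "distr lborel borel T = lborel"
proof -
  obtain S where S: "orthogonal_transformation S" "\<And>x. T (S x) = x" "\<And>x. S (T x) = x"
    using orthogonal_transformation_inv[OF T] orthogonal_transformation_bij[OF T]
    by (metis bij_inv_eq_iff)
  have lin: "linear T" "linear S" using T S(1) by (auto simp: orthogonal_transformation_linear)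
  have [measurable]: "T \<in> borel_measurable borel" "S \<in> borel_measurable borel"
    using lin by (auto intro: borel_measurable_linear)
  show ?thesis
  proof (rule translation_invariant_eq_lborel)
    show "sigma_finite_measure (distr lborel borel T)"
      by (rule sigma_finite_measure_distr[of _ borel S])
         (simp_all add: distr_distr comp_def S lborel.sigma_finite_measure_axioms distr_id2)
    show "distr (distr lborel borel T) borel (\<lambda>x. x + a) = distr lborel borel T" for a
    proof -
      have "distr (distr lborel borel T) borel (\<lambda>x. x + a) = distr lborel borel (T \<circ> (+) (S a))"
        using lin by (simp add: distr_distr comp_def linear_add S add.commute)
      also have "\<dots> = distr (distr lborel borel ((+) (S a))) borel T"
        by (simp add: distr_distr)
      finally show ?thesis by (simp add: lborel_distr_plus)
    qed
    have "T -` ball 0 1 = ball 0 1"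
      using T by (auto simp: orthogonal_transformation_norm)
    then show "emeasure (distr lborel borel T) (ball 0 1) = emeasure lborel (ball (0::'a) 1)"
      by (simp add: emeasure_distr)
  qed simp
qed

section \<open>The uniform law on the sphere\<close>

text \<open>
The surface measure, transported to a Borel measure on the whole space. This makes it composable with
Borel functions and with laws of random vectors.
\<close>

definition unif_sphere :: "'a::euclidean_space measure" where
  "unif_sphere = distr sphere_measure borel (\<lambda>x. x)"

lemma sets_unif_sphere [simp, measurable_cong]: "sets unif_sphere = sets borel"
  by (simp add: unif_sphere_def)

lemma space_unif_sphere [simp]: "space unif_sphere = UNIV"
  by (simp add: unif_sphere_def)

lemma space_sphere_measure [simp]: "space sphere_measure = sphere 0 1"
  by (simp add: sphere_measure_def space_restrict_space)

lemma sets_sphere_measure: "sets sphere_measure = sets (restrict_space borel (sphere 0 1))"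
  by (simp add: sphere_measure_def)

lemma measurable_sphere_measure_ident: "(\<lambda>x. x) \<in> sphere_measure \<rightarrow>\<^sub>M borel"
  unfolding measurable_cong_sets[OF sets_sphere_measure refl]
  by (rule measurable_restrict_space1) simp

lemma sgn_measurable_punctured_ball:
  "sgn \<in> uniform_measure (restrict_space lborel (- {0})) (cball 0 1 - {0}) \<rightarrow>\<^sub>M
     restrict_space borel (sphere 0 (1::real) :: 'a::euclidean_space set)"
proof -
  have "sgn \<in> restrict_space lborel (- {0}) \<rightarrow>\<^sub>M restrict_space borel (sphere 0 (1::real) :: 'a set)"
    by (rule measurable_restrict_space2)
       (auto simp: space_restrict_space norm_sgn intro!: measurable_restrict_space1)
  then show ?thesis
    unfolding measurable_cong_sets[OF sets_uniform_measure refl] .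
qed

lemma emeasure_unif_sphere:
  assumes [measurable]: "A \<in> sets borel"
  shows "emeasure unif_sphere (A :: 'a::euclidean_space set) =
     emeasure lborel {x \<in> cball 0 1. x \<noteq> 0 \<and> sgn x \<in> A} / emeasure lborel (cball (0::'a) 1)"
proof -
  let ?L = "restrict_space lborel (- {0::'a})"
  let ?C = "{x \<in> cball 0 1. x \<noteq> 0 \<and> sgn x \<in> A}"
  note [measurable] = sgn_measurable_punctured_ball
  have C[measurable]: "?C \<in> sets borel" by measurable
  have "emeasure unif_sphere A = emeasure sphere_measure (A \<inter> sphere 0 1)"
    unfolding unif_sphere_def by (subst emeasure_distr) (auto simp: measurable_sphere_measure_ident intro!: arg_cong2[where f=emeasure])
  also have "\<dots> = emeasure (uniform_measure ?L (cball 0 1 - {0})) (sgn -` (A \<inter> sphere 0 1) \<inter> (- {0}))"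
    unfolding sphere_measure_def
    by (subst emeasure_distr) (auto simp: sets_restrict_space space_restrict_space intro!: arg_cong2[where f=emeasure])
  also have "sgn -` (A \<inter> sphere 0 1) \<inter> (- {0}) = sgn -` A \<inter> (- {0::'a})"
    by (auto simp: norm_sgn)
  also have "emeasure (uniform_measure ?L (cball 0 1 - {0})) \<dots> =
      emeasure ?L ((cball 0 1 - {0}) \<inter> (sgn -` A \<inter> (- {0}))) / emeasure ?L (cball 0 1 - {0})"
  proof (rule emeasure_uniform_measure)
    show "cball 0 1 - {0} \<in> sets ?L" by (auto simp: sets_restrict_space_iff)
    show "sgn -` A \<inter> - {0} \<in> sets ?L"
      using measurable_sets[OF borel_measurable_sgn assms] by (auto simp: sets_restrict_space_iff)
  qed
  also have "emeasure ?L ((cball 0 1 - {0}) \<inter> (sgn -` A \<inter> (- {0}))) = emeasure lborel ?C"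
    by (subst emeasure_restrict_space) (auto intro!: arg_cong2[where f=emeasure])
  also have "emeasure ?L (cball 0 1 - {0}) = emeasure lborel (cball (0::'a) 1)"
    by (subst emeasure_restrict_space) (auto intro!: emeasure_Diff_null_set)
  finally show ?thesis .
qed

lemma emeasure_lborel_cball_pos: "emeasure lborel (cball (0::'a::euclidean_space) 1) \<noteq> 0"
proof
  assume "emeasure lborel (cball (0::'a) 1) = 0"
  then have "emeasure lborel (ball (0::'a) 1) = 0"
    by (rule emeasure_eq_0[rotated]) (auto simp: ball_subset_cball)
  then show False
    using open_not_negligible[of "ball (0::'a) 1"]
    by (auto simp: negligible_iff_null_sets null_sets_def)
qed

lemma prob_space_unif_sphere: "prob_space (unif_sphere :: 'a::euclidean_space measure)"
proof
  have "emeasure lborel {x \<in> cball (0::'a) 1. x \<noteq> 0} = emeasure lborel (cball (0::'a) 1 - {0})"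
    by (rule arg_cong2[where f=emeasure]) auto
  also have "\<dots> = emeasure lborel (cball (0::'a) 1)"
    by (auto intro!: emeasure_Diff_null_set)
  finally show "emeasure unif_sphere (space (unif_sphere :: 'a measure)) = 1"
    using emeasure_lborel_cball_pos[where 'a='a] emeasure_lborel_cball_finite[of "0::'a" 1]
    by (simp add: emeasure_unif_sphere ennreal_divide_self)
qed

lemma AE_unif_sphere: "AE x in (unif_sphere :: 'a::euclidean_space measure). x \<in> sphere 0 1"
proof -
  have "AE x in (sphere_measure :: 'a measure). x \<in> sphere 0 1"
    using AE_space[of "sphere_measure :: 'a measure"] by simp
  then show ?thesis
    unfolding unif_sphere_def
    by (subst AE_distr_iff[OF measurable_sphere_measure_ident]) (simp_all add: borel_closed)
qed

lemma distr_unif_sphere: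
  fixes T :: "'a::euclidean_space \<Rightarrow> 'a"
  assumes T: "orthogonal_transformation T"
  shows "distr unif_sphere borel T = unif_sphere"
proof (rule measure_eqI)
  have lin: "linear T" using T by (rule orthogonal_transformation_linear)
  have [measurable]: "T \<in> borel_measurable borel"
    using lin by (rule borel_measurable_linear)
  fix A assume "A \<in> sets (distr unif_sphere borel T)"
  then have [measurable]: "A \<in> sets borel" by simp
  let ?C = "\<lambda>A. {x \<in> cball 0 1. x \<noteq> 0 \<and> sgn x \<in> A}"
  have sgnT: "sgn (T x) = T (sgn x)" for x
    using T lin by (simp add: sgn_div_norm orthogonal_transformation_norm linear_scale)
  have [simp]: "T x = 0 \<longleftrightarrow> x = 0" for x
    using T by (metis norm_eq_zero orthogonal_transformation_norm)
  have "emeasure lborel (?C (T -` A)) = emeasure lborel (T -` ?C A)"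
    by (rule arg_cong2[where f=emeasure]) (use T in \<open>auto simp: sgnT orthogonal_transformation_norm\<close>)
  also have "\<dots> = emeasure (distr lborel borel T) (?C A)"
    by (subst emeasure_distr) auto
  finally have *: "emeasure lborel (?C (T -` A)) = emeasure lborel (?C A)"
    by (simp add: lborel_orthogonal_transformation T)
  have "T -` A \<in> sets borel"
    using measurable_sets[of T borel borel A] by simp
  moreover have "T \<in> unif_sphere \<rightarrow>\<^sub>M borel"
    unfolding measurable_cong_sets[OF sets_unif_sphere refl] by measurable
  ultimately show "emeasure (distr unif_sphere borel T) A = emeasure unif_sphere A"
    using * by (simp add: emeasure_distr emeasure_unif_sphere)
qed simp

lemma AE_unif_sphere_hyperplane:
  fixes a :: "'a::euclidean_space"
  assumes "a \<noteq> 0"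
  shows "AE x in unif_sphere. a \<bullet> x \<noteq> 0"
proof -
  have "{x. a \<bullet> x = 0} \<in> null_sets lborel"
    using negligible_hyperplane[of a 0] assms by (simp add: negligible_iff_null_sets null_sets_completion_iff)
  then have "emeasure lborel {x \<in> cball 0 1. x \<noteq> 0 \<and> sgn x \<in> {x. a \<bullet> x = 0}} = 0"
    by (rule emeasure_eq_0[rotated 1, OF null_setsD1]) (auto simp: sgn_div_norm)
  then have "{x. a \<bullet> x = 0} \<in> null_sets unif_sphere"
    by (intro null_setsI) (auto simp: emeasure_unif_sphere)
  then show ?thesis
    by (auto dest: AE_not_in)
qed

text \<open>
The cone over a relatively open part of the sphere contains an open set.
\<close>

lemma unif_sphere_open_pos:
  fixes U :: "'a::euclidean_space set"
  assumes "open U" "y \<in> U" "norm y = 1"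
  shows "emeasure unif_sphere U \<noteq> 0"
proof
  have [measurable]: "U \<in> sets borel" using assms(1) by simp
  assume "emeasure unif_sphere U = 0"
  then have 0: "emeasure lborel {x \<in> cball 0 1. x \<noteq> 0 \<and> sgn x \<in> U} = 0"
    using emeasure_lborel_cball_finite[of "0::'a" 1]
    by (auto simp: emeasure_unif_sphere ennreal_divide_eq_0_iff)
  let ?V = "ball 0 1 \<inter> ((- {0}) \<inter> sgn -` U)"
  have "open ((- {0}) \<inter> sgn -` U)"
    by (rule continuous_open_preimage) (auto intro!: continuous_intros assms)
  then have "open ?V" by auto
  moreover have "y /\<^sub>R 2 \<in> ?V" using assms by (auto simp: sgn_div_norm)
  moreover have "emeasure lborel ?V = 0"
    by (rule emeasure_eq_0[OF _ 0]) auto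
  moreover have "?V \<in> null_sets lborel"
    using \<open>open ?V\<close> \<open>emeasure lborel ?V = 0\<close> by (intro null_setsI) (simp_all del: open_Int)
  ultimately show False
    using open_not_negligible[of ?V]
    by (metis negligible_iff_null_sets null_sets_completionI empty_iff)
qed

lemma integral_sphere_measure:
  fixes f :: "'a::euclidean_space \<Rightarrow> 'b::{banach,second_countable_topology}"
  assumes "f \<in> borel_measurable borel"
  shows "(\<integral>x. f x \<partial>sphere_measure) = (\<integral>x. f x \<partial>unif_sphere)"
  unfolding unif_sphere_def using assms by (subst integral_distr) (auto simp: measurable_sphere_measure_ident)

section \<open>Uniqueness of invariant probability measures\<close>

lemma integrable_bounded_borel:
  fixes f :: "'a::topological_space \<Rightarrow> 'b::{banach,second_countable_topology}"
  assumes "finite_measure M" "sets M = sets borel" "f \<in> borel_measurable borel"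
    and "\<And>x. norm (f x) \<le> B"
  shows "integrable M f"
proof -
  interpret finite_measure M by fact
  show ?thesis
    by (rule integrable_const_bound[of _ B])
       (use assms in \<open>auto simp: measurable_cong_sets[OF assms(2) refl]\<close>)
qed

text \<open>
The indicator of a closed set \<open>A\<close> is the pointwise limit of the Lipschitz functions
\<open>max 0 (1 - n * infdist x A)\<close>.
\<close>

lemma measure_eqI_lipschitz:
  fixes M N :: "'a::{euclidean_space} measure"
  assumes fin: "finite_measure M" "finite_measure N"
    and sets: "sets M = sets borel" "sets N = sets borel"
    and eq: "\<And>h L. 0 \<le> L \<Longrightarrow> (\<And>x y. \<bar>h x - h y\<bar> \<le> L * dist x y) \<Longrightarrow> (\<And>x. \<bar>h x\<bar> \<le> (1::real)) \<Longrightarrow>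
      h \<in> borel_measurable borel \<Longrightarrow> (\<integral>x. h x \<partial>M) = (\<integral>x. h x \<partial>N)"
  shows "M = N"
proof -
  interpret M: finite_measure M by fact
  interpret N: finite_measure N by fact
  have closed_eq: "emeasure M A = emeasure N A" if "closed A" for A
  proof (cases "A = {}")
    case False
    define h where "h n x = max 0 (1 - real n * infdist x A)" for n x
    have h_meas[measurable]: "h n \<in> borel_measurable borel" for n
      unfolding h_def by (intro borel_measurable_continuous_onI continuous_intros continuous_on_infdist)
    have h_bd: "\<bar>h n x\<bar> \<le> 1" for n x
      by (auto simp: h_def infdist_nonneg)
    have "\<bar>real n * infdist x A - real n * infdist y A\<bar> \<le> real n * dist x y" for n x y
      using mult_left_mono[OF infdist_triangle_abs[of x A y], of "real n"]
      by (simp add: abs_mult right_diff_distrib[symmetric])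
    then have h_lip: "\<bar>h n x - h n y\<bar> \<le> real n * dist x y" for n x y
      unfolding h_def by (smt (verit))
    have h_lim: "(\<lambda>n. h n x) \<longlonglongrightarrow> indicator A x" for x
    proof (cases "x \<in> A")
      case True
      then show ?thesis by (simp add: h_def)
    next
      case False
      then have pos: "infdist x A > 0"
        using \<open>closed A\<close> \<open>A \<noteq> {}\<close> by (intro infdist_pos_not_in_closed)
      have "eventually (\<lambda>n. h n x = 0) sequentially"
      proof -
        obtain n0 where n0: "1 / infdist x A < real n0" using reals_Archimedean2 by blast
        have "h n x = 0" if "n \<ge> n0" for n
        proof -
          have "1 / infdist x A < real n" using n0 that by simp
          then have "1 < real n * infdist x A" using pos by (simp add: field_simps)
          then show ?thesis by (simp add: h_def)
        qed
        then show ?thesis by (auto simp: eventually_sequentially)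
      qed
      then show ?thesis using False by (simp add: tendsto_eventually)
    qed
    have lim: "(\<lambda>n. \<integral>x. h n x \<partial>K) \<longlonglongrightarrow> measure K A" if "finite_measure K" "sets K = sets borel" for K
    proof -
      interpret finite_measure K by fact
      note [measurable_cong] = that(2)
      have "A \<in> sets K" using that \<open>closed A\<close> by simp
      have "(\<lambda>n. \<integral>x. h n x \<partial>K) \<longlonglongrightarrow> (\<integral>x. indicator A x \<partial>K)"
        by (rule integral_dominated_convergence[where w="\<lambda>_. 1"])
           (use h_lim h_bd \<open>A \<in> sets K\<close> in \<open>auto\<close>)
      then show ?thesis using \<open>A \<in> sets K\<close> sets.sets_into_space by (simp add: Int_absorb2)
    qed
    have "(\<integral>x. h n x \<partial>M) = (\<integral>x. h n x \<partial>N)" for n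
      by (rule eq[of "real n"]) (use h_lip h_bd in auto)
    then have "measure M A = measure N A"
      using lim[OF fin(1) sets(1)] lim[OF fin(2) sets(2)] by (simp add: LIMSEQ_unique)
    then show ?thesis by (simp add: M.emeasure_eq_measure N.emeasure_eq_measure)
  qed simp
  show ?thesis
  proof (rule measure_eqI_generator_eq[of "Collect closed" UNIV _ _ "\<lambda>_. UNIV"])
    show "Int_stable (Collect closed :: 'a set set)" by (auto simp: Int_stable_def)
    show "sets M = sigma_sets UNIV (Collect closed)" "sets N = sigma_sets UNIV (Collect closed)"
      using sets by (simp_all add: borel_eq_closed)
  qed (use closed_eq in auto)
qed

text \<open>
A variant of Christensen's argument for uniformly distributed measures. Let \<open>\<rho>\<close> be a measure on \<open>Z\<close>
that looks the same around every point of \<open>Z\<close> when tested with the kernel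
\<open>k\<^sub>e(x, y) = max 0 (e - dist x y)\<close>. Then convolution with \<open>k\<^sub>e / c e\<close> with respect to \<open>\<rho>\<close> approximates
a Lipschitz function \<open>h\<close> up to \<open>L * e\<close> on \<open>Z\<close>. By Fubini the integral of the convolution
with respect to \<open>M\<close> depends only on the kernel integrals of \<open>M\<close>, so equal kernel integrals give equal
integrals of \<open>h\<close>.
\<close>

lemma measure_eqI_uniform_kernel:
  fixes \<rho> M N :: "'a::euclidean_space measure"
  assumes fin: "finite_measure \<rho>" "finite_measure M" "finite_measure N"
    and sets: "sets \<rho> = sets borel" "sets M = sets borel" "sets N = sets borel"
    and Z: "AE x in \<rho>. x \<in> Z" "AE x in M. x \<in> Z" "AE x in N. x \<in> Z"
    and unif: "\<And>y e. y \<in> Z \<Longrightarrow> 0 < e \<Longrightarrow> (\<integral>x. max 0 (e - dist x y) \<partial>\<rho>) = c e"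
    and pos: "\<And>e. 0 < e \<Longrightarrow> 0 < c e"
    and eq: "\<And>y e. y \<in> Z \<Longrightarrow> 0 < e \<Longrightarrow>
      (\<integral>x. max 0 (e - dist x y) \<partial>M) = (\<integral>x. max 0 (e - dist x y) \<partial>N)"
  shows "M = N"
proof (rule measure_eqI_lipschitz)
  fix h :: "'a \<Rightarrow> real" and L
  assume L: "0 \<le> L" and lip: "\<And>x y. \<bar>h x - h y\<bar> \<le> L * dist x y" and bd: "\<And>x. \<bar>h x\<bar> \<le> 1"
    and h[measurable]: "h \<in> borel_measurable borel"
  interpret R: finite_measure \<rho> by fact
  note [measurable_cong] = sets
  let ?m = "measure M (space M) + measure N (space N)"
  define H where "H e x = (\<integral>y. h y * max 0 (e - dist x y) \<partial>\<rho>)" for e x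
  have k_int: "integrable K (\<lambda>x. max 0 (e - dist x y))"
    if "finite_measure K" "sets K = sets borel" "0 < e" for K e and y :: 'a
    by (rule integrable_bounded_borel[of _ _ e]) (use that in auto)
  have hk_int: "integrable \<rho> (\<lambda>y. h y * max 0 (e - dist x y))" if "0 < e" for e x
  proof (rule integrable_bounded_borel[of _ _ e])
    show "norm (h y * max 0 (e - dist x y)) \<le> e" for y
      using mult_mono[OF bd[of y], of "\<bar>max 0 (e - dist x y)\<bar>" e] that by (auto simp: abs_mult)
  qed (use sets fin in auto)
  have H_meas[measurable]: "H e \<in> borel_measurable borel" for e
    unfolding H_def by (rule R.borel_measurable_lebesgue_integral) measurable
  have H_bd: "norm (H e x) \<le> e * measure \<rho> (space \<rho>)" if "0 < e" for e x
  proof -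
    have "norm (H e x) \<le> (\<integral>y. e \<partial>\<rho>)"
      unfolding H_def
    proof (rule Bochner_Integration.integral_norm_bound_integral[OF hk_int[OF that]])
      show "norm (h y * max 0 (e - dist x y)) \<le> e" for y
        using mult_mono[OF bd[of y], of "\<bar>max 0 (e - dist x y)\<bar>" e] that by (auto simp: abs_mult)
    qed simp
    then show ?thesis by (simp add: mult.commute)
  qed
  have approx: "\<bar>c e * h x - H e x\<bar> \<le> L * e * c e" if "x \<in> Z" "0 < e" for x e
  proof -
    have k: "(\<integral>y. max 0 (e - dist x y) \<partial>\<rho>) = c e"
      using unif[OF that] by (simp add: dist_commute)
    have ki: "integrable \<rho> (\<lambda>y. max 0 (e - dist x y))"
      using k_int[OF fin(1) sets(1) that(2), of x] by (simp add: dist_commute)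
    have "c e * h x - H e x = (\<integral>y. h x * max 0 (e - dist x y) - h y * max 0 (e - dist x y) \<partial>\<rho>)"
      unfolding H_def using hk_int[OF that(2)] ki k by (subst Bochner_Integration.integral_diff) auto
    also have "norm \<dots> \<le> (\<integral>y. L * e * max 0 (e - dist x y) \<partial>\<rho>)"
    proof (rule Bochner_Integration.integral_norm_bound_integral)
      fix y
      have "\<bar>h x - h y\<bar> * max 0 (e - dist x y) \<le> L * e * max 0 (e - dist x y)"
      proof (cases "dist x y < e")
        case True
        have "\<bar>h x - h y\<bar> \<le> L * dist x y" by (rule lip)
        also have "\<dots> \<le> L * e" using True L by (intro mult_left_mono) auto
        finally show ?thesis by (intro mult_right_mono) auto
      qed auto
      then show "norm (h x * max 0 (e - dist x y) - h y * max 0 (e - dist x y)) \<le> L * e * max 0 (e - dist x y)"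
        by (simp add: left_diff_distrib[symmetric] abs_mult)
    qed (use hk_int[OF that(2)] ki in auto)
    also have "\<dots> = L * e * c e" using k by simp
    finally show ?thesis by simp
  qed
  have diff: "\<bar>c e * (\<integral>x. h x \<partial>K) - (\<integral>y. h y * (\<integral>x. max 0 (e - dist x y) \<partial>K) \<partial>\<rho>)\<bar>
      \<le> L * e * c e * measure K (space K)"
    if K: "finite_measure K" "sets K = sets borel" "AE x in K. x \<in> Z" and e: "0 < e" for K e
  proof -
    interpret K: finite_measure K by fact
    interpret P: pair_sigma_finite K \<rho> by standard
    note [measurable_cong] = K(2)
    have hi: "integrable K h"
      by (rule integrable_bounded_borel[of _ _ 1]) (use K bd in auto)
    have Hi: "integrable K (H e)"
      by (rule integrable_bounded_borel[OF K(1,2) _ H_bd[OF e]]) simp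
    have "(\<integral>y. h y * (\<integral>x. max 0 (e - dist x y) \<partial>K) \<partial>\<rho>) = (\<integral>y. (\<integral>x. h y * max 0 (e - dist x y) \<partial>K) \<partial>\<rho>)"
      by simp
    also have "\<dots> = (\<integral>x. H e x \<partial>K)"
      unfolding H_def
    proof (rule P.Fubini_integral)
      interpret KR: finite_measure "K \<Otimes>\<^sub>M \<rho>"
        by (rule finite_measure_pair_measure) fact+
      show "integrable (K \<Otimes>\<^sub>M \<rho>) (\<lambda>(x, y). h y * max 0 (e - dist x y))"
      proof (rule KR.integrable_const_bound[of _ e])
        show "AE z in K \<Otimes>\<^sub>M \<rho>. norm (case z of (x, y) \<Rightarrow> h y * max 0 (e - dist x y)) \<le> e"
        proof (rule AE_I2, clarsimp)
          fix x y
          show "\<bar>h y * max 0 (e - dist x y)\<bar> \<le> e"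
            using mult_mono[OF bd[of y], of "\<bar>max 0 (e - dist x y)\<bar>" e] e by (auto simp: abs_mult)
        qed
      qed measurable
    qed
    finally have "c e * (\<integral>x. h x \<partial>K) - (\<integral>y. h y * (\<integral>x. max 0 (e - dist x y) \<partial>K) \<partial>\<rho>) =
        (\<integral>x. c e * h x - H e x \<partial>K)"
      using hi Hi by simp
    also have "norm \<dots> \<le> (\<integral>x. norm (c e * h x - H e x) \<partial>K)"
      by (rule integral_norm_bound)
    also have "\<dots> \<le> (\<integral>x. L * e * c e \<partial>K)"
      by (rule integral_mono_AE) (use K(3) approx e hi Hi in auto)
    also have "\<dots> = L * e * c e * measure K (space K)" by simp
    finally show ?thesis by simp
  qed
  have small: "\<bar>(\<integral>x. h x \<partial>M) - (\<integral>x. h x \<partial>N)\<bar> \<le> L * ?m * e" if e: "0 < e" for e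
  proof -
    have [measurable]: "(\<lambda>y. \<integral>x. max 0 (e - dist x y) \<partial>K) \<in> borel_measurable borel"
      if "finite_measure K" "sets K = sets borel" for K :: "'a measure"
    proof -
      interpret finite_measure K by fact
      note [measurable_cong] = that(2)
      show ?thesis by (rule borel_measurable_lebesgue_integral) measurable
    qed
    have "(\<integral>y. h y * (\<integral>x. max 0 (e - dist x y) \<partial>M) \<partial>\<rho>) = (\<integral>y. h y * (\<integral>x. max 0 (e - dist x y) \<partial>N) \<partial>\<rho>)"
      by (rule Bochner_Integration.integral_cong_AE) (use Z(1) eq e fin sets in auto)
    then have "\<bar>c e * (\<integral>x. h x \<partial>M) - c e * (\<integral>x. h x \<partial>N)\<bar> \<le> L * e * c e * ?m"
      using diff[OF fin(2) sets(2) Z(2) e] diff[OF fin(3) sets(3) Z(3) e]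
      by (simp add: distrib_left)
    also have "L * e * c e * ?m = c e * (L * ?m * e)" by (simp only: mult_ac)
    also have "\<bar>c e * (\<integral>x. h x \<partial>M) - c e * (\<integral>x. h x \<partial>N)\<bar> = c e * \<bar>(\<integral>x. h x \<partial>M) - (\<integral>x. h x \<partial>N)\<bar>"
      using pos[OF e] by (simp add: right_diff_distrib[symmetric] abs_mult)
    finally show ?thesis using pos[OF e] by simp
  qed
  have "((\<lambda>e. L * ?m * e) \<longlongrightarrow> L * ?m * 0) (at_right 0)"
    by (intro tendsto_intros)
  then have "\<bar>(\<integral>x. h x \<partial>M) - (\<integral>x. h x \<partial>N)\<bar> \<le> L * ?m * 0"
    by (rule tendsto_lowerbound) (auto simp: eventually_at_right_less small intro!: eventually_at_rightI[of 0 1])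
  then show "(\<integral>x. h x \<partial>M) = (\<integral>x. h x \<partial>N)" by simp
qed (use fin sets in auto)

text \<open>
Isometric transitivity makes the kernel integrals of \<open>M\<close> and of \<open>N\<close> independent of the centre.
Integrating the kernel with respect to the product of both measures shows that the two constants
coincide. They are positive, since otherwise countably many null balls would cover the carrier.
\<close>

lemma invariant_prob_space_unique:
  fixes M N :: "'a::euclidean_space measure"
  assumes prob: "prob_space M" "prob_space N"
    and sets: "sets M = sets borel" "sets N = sets borel"
    and Z: "AE x in M. x \<in> Z" "AE x in N. x \<in> Z"
    and trans: "\<And>x y. x \<in> Z \<Longrightarrow> y \<in> Z \<Longrightarrow>
      \<exists>T. T \<in> borel_measurable borel \<and> (\<forall>u v. dist (T u) (T v) = dist u v) \<and> T x = y \<and>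
        distr M borel T = M \<and> distr N borel T = N"
  shows "M = N"
proof -
  interpret M: prob_space M by fact
  interpret N: prob_space N by fact
  interpret P: pair_sigma_finite M N by standard
  interpret MN: prob_space "M \<Otimes>\<^sub>M N" by (rule prob_space_pair) fact+
  note [measurable_cong] = sets
  have const: "(\<integral>x. max 0 (e - dist x y) \<partial>K) = (\<integral>x. max 0 (e - dist x z) \<partial>K)"
    if yz: "y \<in> Z" "z \<in> Z" and K: "K = M \<or> K = N" for y z e K
  proof -
    obtain T where T[measurable]: "T \<in> borel_measurable borel"
      and iso: "\<And>u v. dist (T u) (T v) = dist u v" "T y = z"
      and inv: "distr M borel T = M" "distr N borel T = N"
      using trans[OF yz] by blast
    have sK[measurable_cong]: "sets K = sets borel" and inv: "distr K borel T = K"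
      using K sets inv by auto
    have "(\<integral>x. max 0 (e - dist x z) \<partial>K) = (\<integral>x. max 0 (e - dist x z) \<partial>(distr K borel T))"
      by (simp add: inv)
    also have "\<dots> = (\<integral>x. max 0 (e - dist (T x) (T y)) \<partial>K)"
      by (subst integral_distr) (use iso in auto)
    finally show ?thesis unfolding iso(1) by simp
  qed
  have "Z \<noteq> {}" using Z(1) by auto
  then obtain z where z: "z \<in> Z" by blast
  define c where "c e = (\<integral>x. max 0 (e - dist x z) \<partial>M)" for e
  have cM: "(\<integral>x. max 0 (e - dist x y) \<partial>M) = c e" if "y \<in> Z" for y e
    unfolding c_def using const[OF that z] by blast
  have cN: "(\<integral>x. max 0 (e - dist x y) \<partial>N) = c e" if y: "y \<in> Z" and e: "0 < e" for y e
  proof -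
    have "integrable (M \<Otimes>\<^sub>M N) (\<lambda>(x, y). max 0 (e - dist x y))"
      by (rule MN.integrable_const_bound[of _ e]) (use e in auto)
    then have "(\<integral>y. (\<integral>x. max 0 (e - dist x y) \<partial>M) \<partial>N) = (\<integral>x. (\<integral>y. max 0 (e - dist x y) \<partial>N) \<partial>M)"
      by (rule P.Fubini_integral)
    moreover have "(\<integral>y. (\<integral>x. max 0 (e - dist x y) \<partial>M) \<partial>N) = (\<integral>y. c e \<partial>N)"
      by (rule Bochner_Integration.integral_cong_AE) (use Z cM in auto)
    moreover have "(\<integral>x. (\<integral>y. max 0 (e - dist x y) \<partial>N) \<partial>M) = (\<integral>x. (\<integral>x. max 0 (e - dist x y) \<partial>N) \<partial>M)"
      by (rule Bochner_Integration.integral_cong_AE)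
         (use Z const[of _ y N e] y in \<open>auto simp: dist_commute\<close>)
    ultimately show ?thesis by (simp add: M.prob_space N.prob_space)
  qed
  have pos: "0 < c e" if e: "0 < e" for e
  proof (rule ccontr)
    assume "\<not> 0 < c e"
    moreover have "0 \<le> c e" unfolding c_def by simp
    ultimately have c0: "c e = 0" by simp
    have ball: "AE x in M. x \<notin> ball y e" if "y \<in> Z" for y
    proof -
      have "integrable M (\<lambda>x. max 0 (e - dist x y))"
        by (rule M.integrable_const_bound[of _ e]) (use e in auto)
      then have "AE x in M. max 0 (e - dist x y) = 0"
        using cM[OF that, of e] c0 integral_nonneg_eq_0_iff_AE[of M "\<lambda>x. max 0 (e - dist x y)"] by auto
      then show ?thesis by eventually_elim (auto simp: dist_commute max_def split: if_splits)
    qed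
    obtain \<F> where F: "\<F> \<subseteq> (\<lambda>y. ball y e) ` Z" "countable \<F>" "\<Union>\<F> = (\<Union>y\<in>Z. ball y e)"
      using Lindelof[of "(\<lambda>y. ball y e) ` Z"] by auto
    have "AE x in M. \<forall>B\<in>\<F>. x \<notin> B"
      by (subst AE_ball_countable[OF F(2)]) (use F(1) ball in auto)
    then have "AE x in M. False"
      using Z(1)
    proof eventually_elim
      case (elim x)
      then have "x \<in> \<Union>\<F>" unfolding F(3) using e elim by (intro UN_I[of x]) auto
      then show ?case using elim by auto
    qed
    then show False by simp
  qed
  show ?thesis
    by (rule measure_eqI_uniform_kernel[of M M N Z c])
       (use cM cN pos Z sets M.finite_measure_axioms N.finite_measure_axioms in auto)
qed

section \<open>Moments of the uniform law\<close>

lemma integrable_unif_sphere: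
  fixes f :: "'a::euclidean_space \<Rightarrow> 'b::{banach,second_countable_topology}"
  assumes "f \<in> borel_measurable borel" "\<And>x. norm x = 1 \<Longrightarrow> norm (f x) \<le> B"
  shows "integrable unif_sphere f"
proof -
  interpret prob_space "unif_sphere :: 'a measure" by (rule prob_space_unif_sphere)
  have "AE x in unif_sphere. norm (f x) \<le> B"
    using AE_unif_sphere by eventually_elim (use assms(2) in auto)
  then show ?thesis
    by (rule integrable_const_bound)
       (use assms(1) in \<open>simp add: measurable_cong_sets[OF sets_unif_sphere refl]\<close>)
qed

lemma orthogonal_transformation_borel_measurable:
  fixes T :: "'a::euclidean_space \<Rightarrow> 'a"
  shows "orthogonal_transformation T \<Longrightarrow> T \<in> borel_measurable borel"
  by (rule borel_measurable_linear) (rule orthogonal_transformation_linear)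

lemma integral_unif_sphere_transform:
  fixes f :: "'a::euclidean_space \<Rightarrow> 'b::{banach,second_countable_topology}" and T :: "'a \<Rightarrow> 'a"
  assumes T: "orthogonal_transformation T" and f: "f \<in> borel_measurable borel"
  shows "(\<integral>x. f (T x) \<partial>unif_sphere) = (\<integral>x. f x \<partial>unif_sphere)"
proof -
  have "(\<integral>x. f x \<partial>unif_sphere) = (\<integral>x. f x \<partial>(distr unif_sphere borel T))"
    unfolding distr_unif_sphere[OF T] ..
  also have "\<dots> = (\<integral>x. f (T x) \<partial>unif_sphere)"
    using f orthogonal_transformation_borel_measurable[OF T]
    by (intro integral_distr) (simp_all add: measurable_cong_sets[OF sets_unif_sphere refl])
  finally show ?thesis ..
qed

lemma abs_inner_sphere_le: "norm x = 1 \<Longrightarrow> \<bar>x \<bullet> y\<bar> \<le> norm y"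
  using Cauchy_Schwarz_ineq2[of x y] by simp

definition axial_moment :: "'a::euclidean_space itself \<Rightarrow> nat \<Rightarrow> real" where
  "axial_moment _ m = (\<integral>x. (x \<bullet> (SOME b. b \<in> Basis)) ^ m \<partial>(unif_sphere :: 'a measure))"

lemma integral_inner_power:
  fixes y :: "'a::euclidean_space"
  shows "(\<integral>x. (x \<bullet> y) ^ m \<partial>unif_sphere) = axial_moment TYPE('a) m * norm y ^ m"
proof -
  define b where "b = (SOME b. b \<in> (Basis :: 'a set))"
  have "b \<in> Basis" unfolding b_def by (rule someI_ex) (use nonempty_Basis in blast)
  then have b: "b \<bullet> b = 1" by (simp add: inner_same_Basis)
  obtain T where T: "orthogonal_transformation T" "T (norm y *\<^sub>R b) = y"
    using orthogonal_transformation_of_gram[of "{()}" "\<lambda>_. norm y *\<^sub>R b" "\<lambda>_. y"] b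
    by (auto simp: power2_norm_eq_inner[symmetric] power2_eq_square)
  have "T x \<bullet> y = norm y * (x \<bullet> b)" for x
  proof -
    have "T x \<bullet> T (norm y *\<^sub>R b) = x \<bullet> (norm y *\<^sub>R b)"
      using T(1) by (simp only: orthogonal_transformation_def)
    then show ?thesis by (simp add: T(2))
  qed
  then have "(\<integral>x. (x \<bullet> y) ^ m \<partial>unif_sphere) = (\<integral>x. norm y ^ m * (x \<bullet> b) ^ m \<partial>unif_sphere)"
    using integral_unif_sphere_transform[OF T(1), of "\<lambda>x. (x \<bullet> y) ^ m"] by (simp add: power_mult_distrib)
  then show ?thesis by (simp add: axial_moment_def b_def mult.commute)
qed

lemma orthogonal_transformation_uminus: "orthogonal_transformation (\<lambda>x::'a::euclidean_space. - x)"
  by (simp add: orthogonal_transformation_neg)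

lemma axial_moment_odd:
  assumes "odd m"
  shows "axial_moment TYPE('a::euclidean_space) m = 0"
proof -
  define b where "b = (SOME b. b \<in> (Basis :: 'a set))"
  have "(\<integral>x. (- x \<bullet> b) ^ m \<partial>unif_sphere) = (\<integral>x. (x \<bullet> b) ^ m \<partial>unif_sphere)"
    by (rule integral_unif_sphere_transform[OF orthogonal_transformation_uminus]) simp
  then show ?thesis using assms by (simp add: axial_moment_def b_def[symmetric])
qed

definition mixed_moment :: "'a::euclidean_space \<Rightarrow> 'a \<Rightarrow> nat \<Rightarrow> nat \<Rightarrow> real" where
  "mixed_moment a b k l = (\<integral>x. (x \<bullet> a) ^ k * (x \<bullet> b) ^ l \<partial>unif_sphere)"

lemma integrable_mixed: "integrable unif_sphere (\<lambda>x::'a::euclidean_space. (x \<bullet> a) ^ k * (x \<bullet> b) ^ l)"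
proof (rule integrable_unif_sphere)
  fix x :: 'a assume x: "norm x = 1"
  show "norm ((x \<bullet> a) ^ k * (x \<bullet> b) ^ l) \<le> norm a ^ k * norm b ^ l"
    unfolding norm_mult norm_power real_norm_def abs_mult power_abs
    by (intro mult_mono power_mono abs_inner_sphere_le x) auto
qed simp

text \<open>
Both sides are polynomials in \<open>s\<close> that agree for real \<open>s\<close>, where they equal the moment
of order \<open>2 * j\<close> in direction \<open>a + s b\<close>. Stating this as an identity of complex polynomials allows two uses:
evaluation at the imaginary unit, and comparison of coefficients.
\<close>

lemma mixed_moment_poly:
  fixes a b :: "'a::euclidean_space"
  shows "(\<Sum>i\<le>2*j. monom (of_real (real (2*j choose i) * mixed_moment a b (2*j-i) i)) i) =
     smult (of_real (axial_moment TYPE('a) (2*j))) ([:of_real (a \<bullet> a), of_real (2 * (a \<bullet> b)), of_real (b \<bullet> b):] ^ j :: complex poly)"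
    (is "?P = ?Q")
proof (rule ccontr)
  assume "?P \<noteq> ?Q"
  then have "finite {z. poly (?P - ?Q) z = 0}" by (intro poly_roots_finite) simp
  moreover have "poly ?P (of_real s) = poly ?Q (of_real s)" for s
  proof -
    have "poly ?P (of_real s) = of_real (\<Sum>i\<le>2*j. real (2*j choose i) * mixed_moment a b (2*j-i) i * s ^ i)"
      by (simp add: poly_sum poly_monom)
    also have "(\<Sum>i\<le>2*j. real (2*j choose i) * mixed_moment a b (2*j-i) i * s ^ i) =
        (\<integral>x. (\<Sum>i\<le>2*j. real (2*j choose i) * s ^ i * ((x \<bullet> a) ^ (2*j-i) * (x \<bullet> b) ^ i)) \<partial>unif_sphere)"
    proof -
      have "(\<Sum>i\<le>2*j. real (2*j choose i) * mixed_moment a b (2*j-i) i * s ^ i) =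
          (\<Sum>i\<le>2*j. real (2*j choose i) * s ^ i * mixed_moment a b (2*j-i) i)"
        by (simp only: mult_ac)
      then show ?thesis
        unfolding mixed_moment_def by (simp add: integrable_mixed)
    qed
    also have "\<dots> = (\<integral>x. (x \<bullet> (a + s *\<^sub>R b)) ^ (2*j) \<partial>unif_sphere)"
    proof (rule Bochner_Integration.integral_cong[OF refl])
      fix x :: 'a
      have "(x \<bullet> (a + s *\<^sub>R b)) ^ (2*j) = (s * (x \<bullet> b) + x \<bullet> a) ^ (2*j)"
        by (simp add: inner_add_right add.commute)
      also have "\<dots> = (\<Sum>i\<le>2*j. real (2*j choose i) * (s * (x \<bullet> b)) ^ i * (x \<bullet> a) ^ (2*j-i))"
        by (rule binomial_ring)
      finally show "(\<Sum>i\<le>2*j. real (2*j choose i) * s ^ i * ((x \<bullet> a) ^ (2*j-i) * (x \<bullet> b) ^ i)) =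
          (x \<bullet> (a + s *\<^sub>R b)) ^ (2*j)"
        by (simp add: power_mult_distrib mult_ac)
    qed
    also have "\<dots> = axial_moment TYPE('a) (2*j) * ((a + s *\<^sub>R b) \<bullet> (a + s *\<^sub>R b)) ^ j"
      unfolding integral_inner_power by (simp add: power_mult power2_norm_eq_inner)
    also have "(a + s *\<^sub>R b) \<bullet> (a + s *\<^sub>R b) = a \<bullet> a + s * (2 * (a \<bullet> b) + s * (b \<bullet> b))"
      by (simp add: inner_add_left inner_add_right inner_commute algebra_simps)
    finally show ?thesis by simp
  qed
  then have "range of_real \<subseteq> {z. poly (?P - ?Q) z = 0}" by auto
  moreover have "infinite (range (of_real :: real \<Rightarrow> complex))"
    using finite_imageD[of of_real "UNIV :: real set"] inj_of_real infinite_UNIV_char_0 by blast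
  ultimately show False using finite_subset by blast
qed

text \<open>
The factor on the right is the complex bilinear square of \<open>a + i b\<close>; it vanishes for null vectors.
\<close>

lemma integral_complex_inner_power:
  fixes a b :: "'a::euclidean_space"
  shows "(\<integral>x. (of_real (x \<bullet> a) + \<i> * of_real (x \<bullet> b)) ^ m \<partial>unif_sphere) =
    of_real (axial_moment TYPE('a) m) * (of_real (a \<bullet> a - b \<bullet> b) + 2 * \<i> * of_real (a \<bullet> b)) ^ (m div 2)"
proof -
  have expand: "(of_real (x \<bullet> a) + \<i> * of_real (x \<bullet> b)) ^ m =
      (\<Sum>i\<le>m. of_nat (m choose i) * \<i> ^ i * of_real ((x \<bullet> a) ^ (m-i) * (x \<bullet> b) ^ i))" for x
    using binomial_ring[of "\<i> * of_real (x \<bullet> b)" "of_real (x \<bullet> a)" m]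
    by (simp add: add.commute power_mult_distrib mult_ac)
  have int: "(\<integral>x. (of_real (x \<bullet> a) + \<i> * of_real (x \<bullet> b)) ^ m \<partial>unif_sphere) =
      (\<Sum>i\<le>m. of_nat (m choose i) * \<i> ^ i * of_real (mixed_moment a b (m-i) i))"
    unfolding expand mixed_moment_def
    by (subst Bochner_Integration.integral_sum)
       (auto intro!: integrable_mult_right integrable_of_real integrable_mixed simp del: of_real_mult of_real_power)
  show ?thesis
  proof (cases "even m")
    case True
    then obtain j where j: "m = 2 * j" by blast
    have "(\<Sum>i\<le>m. of_nat (m choose i) * \<i> ^ i * of_real (mixed_moment a b (m-i) i)) =
        poly (\<Sum>i\<le>2*j. monom (of_real (real (2*j choose i) * mixed_moment a b (2*j-i) i)) i) \<i>"
      by (simp add: poly_sum poly_monom j mult_ac)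
    then show ?thesis
      unfolding int mixed_moment_poly by (simp add: j algebra_simps)
  next
    case False
    have "mixed_moment a b (m-i) i = 0" if "i \<le> m" for i
    proof -
      have "(\<integral>x. (- x \<bullet> a) ^ (m-i) * (- x \<bullet> b) ^ i \<partial>unif_sphere) = mixed_moment a b (m-i) i"
        unfolding mixed_moment_def
        by (rule integral_unif_sphere_transform[OF orthogonal_transformation_uminus]) simp
      moreover have "(- x \<bullet> a) ^ (m-i) * (- x \<bullet> b) ^ i = - ((x \<bullet> a) ^ (m-i) * (x \<bullet> b) ^ i)" for x
      proof -
        have "(- x \<bullet> a) ^ (m-i) * (- x \<bullet> b) ^ i = (-1) ^ (m-i) * (-1) ^ i * ((x \<bullet> a) ^ (m-i) * (x \<bullet> b) ^ i)"
          by (simp only: inner_minus_left power_minus[of "_ \<bullet> _"] mult_ac)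
        also have "(-1) ^ (m-i) * (-1) ^ i = (-1 :: real) ^ m"
          using that by (simp add: power_add[symmetric])
        finally show ?thesis using False by simp
      qed
      ultimately show ?thesis by (simp add: mixed_moment_def)
    qed
    then show ?thesis unfolding int using axial_moment_odd[OF False, where 'a='a] by simp
  qed
qed

lemma coeff_quadratic_power_2: "coeff ([:1, 0, 1:] ^ j :: 'b::comm_ring_1 poly) 2 = of_nat j"
proof -
  have 0: "coeff ([:1, 0, 1:] ^ j :: 'b poly) 0 = 1" for j
    by (induction j) (auto simp: coeff_mult)
  show ?thesis
    by (induction j) (auto simp: numeral_2_eq_2 0 coeff_pCons)
qed

text \<open>
In \<open>1 = \<Sum>\<^sub>b (x \<bullet> b)\<^sup>2\<close>, multiplied by \<open>(x \<bullet> a)\<^bsup>2 l\<^esup>\<close> and integrated, the term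
\<open>b = a\<close> is the next moment. The mixed terms are multiples of it, by comparing the coefficients of the
square in \<open>mixed_moment_poly\<close> for orthonormal \<open>a, b\<close>.
\<close>

lemma axial_moment_Suc:
  "(2 * l + DIM('a)) * axial_moment TYPE('a::euclidean_space) (2 * Suc l) =
     (2 * l + 1) * axial_moment TYPE('a) (2 * l)"
proof -
  define A where "A = axial_moment TYPE('a) (2 * Suc l)"
  obtain a :: 'a where a: "a \<in> Basis" using nonempty_Basis by blast
  have mix: "(2 * l + 1) * mixed_moment a b (2 * l) 2 = A" if "b \<in> Basis" "b \<noteq> a" for b
  proof -
    have ab: "a \<bullet> a = 1" "b \<bullet> b = 1" "a \<bullet> b = 0"
      using a that by (auto simp: inner_Basis)
    have "coeff (\<Sum>i\<le>2*Suc l. monom (complex_of_real (real (2*Suc l choose i) * mixed_moment a b (2*Suc l-i) i)) i) 2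
       = of_real (real (2*Suc l choose 2) * mixed_moment a b (2*Suc l-2) 2)"
      unfolding coeff_sum coeff_monom by (subst sum.delta) auto
    also have "2 * Suc l - 2 = 2 * l" by simp
    also have "of_real (real (2*Suc l choose 2) * mixed_moment a b (2*l) 2) =
        (of_real (real (Suc l) * ((2 * l + 1) * mixed_moment a b (2 * l) 2)) :: complex)"
      by (simp add: choose_two algebra_simps)
    finally have "of_real (real (Suc l) * ((2 * l + 1) * mixed_moment a b (2 * l) 2)) = (of_real (A * real (Suc l)) :: complex)"
      unfolding mixed_moment_poly ab by (auto simp del: power_Suc mult_Suc_right simp: coeff_quadratic_power_2 A_def)
    then have "real (Suc l) * ((2 * l + 1) * mixed_moment a b (2 * l) 2) = real (Suc l) * A"
      by (simp only: of_real_eq_iff mult.commute)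
    then show ?thesis by simp
  qed
  have "axial_moment TYPE('a) (2 * l) = (\<integral>x. (x \<bullet> a) ^ (2 * l) * (\<Sum>b\<in>Basis. (x \<bullet> b)\<^sup>2) \<partial>unif_sphere)"
  proof -
    have "(\<integral>x. (x \<bullet> a) ^ (2 * l) * (\<Sum>b\<in>Basis. (x \<bullet> b)\<^sup>2) \<partial>unif_sphere) = (\<integral>x. (x \<bullet> a) ^ (2 * l) \<partial>unif_sphere)"
      by (rule integral_cong_AE)
         (use AE_unif_sphere in \<open>auto simp: euclidean_inner[of x x for x, symmetric] power2_eq_square norm_eq_1 elim!: eventually_mono\<close>)
    then show ?thesis using integral_inner_power[of a "2 * l"] a by simp
  qed
  also have "\<dots> = (\<Sum>b\<in>Basis. mixed_moment a b (2 * l) 2)"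
    unfolding mixed_moment_def sum_distrib_left
    by (subst Bochner_Integration.integral_sum) (simp_all add: integrable_mixed)
  also have "\<dots> = mixed_moment a a (2 * l) 2 + (\<Sum>b\<in>Basis - {a}. mixed_moment a b (2 * l) 2)"
    using a by (simp add: sum.remove)
  also have "mixed_moment a a (2 * l) 2 = A"
    unfolding mixed_moment_def A_def
    using integral_inner_power[of a "2 * Suc l"] a by (simp add: power_add[symmetric])
  also have "(\<Sum>b\<in>Basis - {a}. mixed_moment a b (2 * l) 2) = (\<Sum>b\<in>Basis - {a}. A / (2 * l + 1))"
    by (rule sum.cong) (use mix in \<open>auto simp: field_simps\<close>)
  also have "\<dots> = (DIM('a) - 1) * A / (2 * l + 1)"
    using a by (simp add: card_Diff_singleton)
  finally show ?thesis
    unfolding A_def[symmetric] using DIM_positive[where 'a='a]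
    by (simp add: field_simps of_nat_diff Suc_leI)
qed

section \<open>Oscillation of Jacobi functions\<close>

text \<open>
The derivative is kept in logarithmic form, which avoids exponents \<open>n - 1\<close> and case distinctions
at \<open>n = 0\<close>.
\<close>

lemma DERIV_power_divide:
  fixes f :: "real \<Rightarrow> real"
  assumes "(f has_real_derivative f') (at t)" "f t \<noteq> 0"
  shows "((\<lambda>t. f t ^ n) has_real_derivative n * f t ^ n * (f' / f t)) (at t)"
proof -
  have "((\<lambda>t. f t ^ n) has_real_derivative n * (f' * f t ^ (n - 1))) (at t)"
    by (rule derivative_eq_intros assms refl)+ simp
  moreover have "n * (f' * f t ^ (n - 1)) = n * f t ^ n * (f' / f t)"
    using assms(2) by (cases n) auto
  ultimately show ?thesis by simp
qed

text \<open>
Here \<open>q - 1\<close> and \<open>p - 1\<close> are the multiplicities in the radial part of the spherical Laplacian, whose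
density is \<open>(cos t)\<^bsup>p - 1\<^esup> (sin t)\<^bsup>q - 1\<^esup>\<close>. Together with the eigenvalue term, the operator maps each monomial
\<open>(cos t)\<^bsup>2 l\<^esup> (sin t)\<^bsup>2 (j - l)\<^esup>\<close> to a combination of the two neighbouring ones of degree
\<open>2 j - 2\<close>, and the recursion for the coefficients makes these contributions cancel in pairs.
\<close>

lemma jacobi_ode:
  fixes a :: "nat \<Rightarrow> real" and p q :: real and j :: nat
  defines "u \<equiv> \<lambda>t. \<Sum>l\<le>j. a l * (cos t ^ (2 * l) * sin t ^ (2 * (j - l)))"
  assumes rec: "\<And>l. l < j \<Longrightarrow> a (Suc l) * (2 * real (Suc l) * (2 * real l + p)) =
     - (a l * (2 * real (j - l) * (2 * real (j - l) + q - 2)))"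
  shows "\<exists>du ddu. \<forall>t. cos t \<noteq> 0 \<longrightarrow> sin t \<noteq> 0 \<longrightarrow>
       (u has_real_derivative du t) (at t) \<and> (du has_real_derivative ddu t) (at t) \<and>
       ddu t + ((q - 1) * (cos t / sin t) - (p - 1) * (sin t / cos t)) * du t
         + 2 * real j * (2 * real j + p + q - 2) * u t = 0"
proof -
  define f where "f l t = cos t ^ (2 * l) * sin t ^ (2 * (j - l))" for l and t :: real
  define L where "L l t = 2 * (j - l) * (cos t / sin t) - 2 * l * (sin t / cos t)" for l and t :: real
  define dL where "dL l t = - (2 * (j - l) / sin t ^ 2) - 2 * l / cos t ^ 2" for l and t :: real
  define w where "w t = (q - 1) * (cos t / sin t) - (p - 1) * (sin t / cos t)" for t
  define E where "E = 2 * real j * (2 * real j + p + q - 2)"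
  have df: "(f l has_real_derivative f l t * L l t) (at t)" if "cos t \<noteq> 0" "sin t \<noteq> 0" for l t
    unfolding f_def L_def
    by (rule DERIV_cong[OF DERIV_mult[OF DERIV_power_divide[OF DERIV_cos] DERIV_power_divide[OF DERIV_sin]]])
       (use that in \<open>auto simp: field_simps\<close>)
  have dL: "(L l has_real_derivative dL l t) (at t)" if "cos t \<noteq> 0" "sin t \<noteq> 0" for l t
  proof -
    have one: "- sin t * sin t - cos t * cos t = - 1" "cos t * cos t - sin t * - sin t = 1"
      using sin_cos_squared_add3[of t] by (simp_all add: algebra_simps)
    have 1: "((\<lambda>t. cos t / sin t) has_real_derivative - (1 / sin t ^ 2)) (at t)"
      using DERIV_divide[OF DERIV_cos DERIV_sin that(2)] unfolding one by (simp add: power2_eq_square)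
    have 2: "((\<lambda>t. sin t / cos t) has_real_derivative 1 / cos t ^ 2) (at t)"
      using DERIV_divide[OF DERIV_sin DERIV_cos that(1)] unfolding one by (simp add: power2_eq_square)
    show ?thesis
      unfolding L_def dL_def
      by (rule DERIV_cong[OF DERIV_diff[OF DERIV_cmult[OF 1] DERIV_cmult[OF 2]]]) simp
  qed
  have ddf: "((\<lambda>t. f l t * L l t) has_real_derivative f l t * (L l t ^ 2 + dL l t)) (at t)"
    if "cos t \<noteq> 0" "sin t \<noteq> 0" for l t
    by (rule DERIV_cong[OF DERIV_mult[OF df dL]]) (use that in \<open>auto simp: algebra_simps power2_eq_square\<close>)
  \<comment> \<open>The monomial \<open>f l\<close> has logarithmic derivative \<open>L l\<close>, so this is the operator applied to \<open>f l\<close>, divided by \<open>f l\<close>.\<close>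
  have quad: "L l t ^ 2 + dL l t + w t * L l t + E =
      2 * l * (2 * l + p - 2) / cos t ^ 2 + 2 * (j - l) * (2 * (j - l) + q - 2) / sin t ^ 2"
    if t: "cos t \<noteq> 0" "sin t \<noteq> 0" and "l \<le> j" for l t
  proof -
    define c s where "c = cos t" and "s = sin t"
    define A B where "A = 2 * real l" and "B = 2 * real (j - l)"
    have cs: "c \<noteq> 0" "s \<noteq> 0" using t by (auto simp: c_def s_def)
    have one: "s ^ 2 = 1 - c ^ 2" unfolding c_def s_def by (simp add: sin_squared_eq)
    have j: "2 * real j = A + B" using that by (simp add: A_def B_def)
    have "s ^ 2 * c ^ 2 * ((B * (c / s) - A * (s / c)) ^ 2 + (- (B / s ^ 2) - A / c ^ 2)
         + ((q - 1) * (c / s) - (p - 1) * (s / c)) * (B * (c / s) - A * (s / c))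
         + (A + B) * (A + B + p + q - 2))
       = (B * c ^ 2 - A * s ^ 2) ^ 2 - B * c ^ 2 - A * s ^ 2
         + ((q - 1) * c ^ 2 - (p - 1) * s ^ 2) * (B * c ^ 2 - A * s ^ 2)
         + s ^ 2 * c ^ 2 * (A + B) * (A + B + p + q - 2)"
      using cs by (simp add: field_simps power2_eq_square)
    also have "\<dots> = s ^ 2 * (A * (A + p - 2)) + c ^ 2 * (B * (B + q - 2))"
      unfolding one by algebra
    also have "\<dots> = s ^ 2 * c ^ 2 * (A * (A + p - 2) / c ^ 2 + B * (B + q - 2) / s ^ 2)"
      using cs by (simp add: field_simps)
    finally have "(B * (c / s) - A * (s / c)) ^ 2 + (- (B / s ^ 2) - A / c ^ 2)
         + ((q - 1) * (c / s) - (p - 1) * (s / c)) * (B * (c / s) - A * (s / c))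
         + (A + B) * (A + B + p + q - 2) = A * (A + p - 2) / c ^ 2 + B * (B + q - 2) / s ^ 2"
      using cs by simp
    then show ?thesis
      unfolding L_def dL_def w_def E_def c_def[symmetric] s_def[symmetric] j[symmetric]
      by (simp add: A_def B_def)
  qed
  define du where "du t = (\<Sum>l\<le>j. a l * (f l t * L l t))" for t
  define ddu where "ddu t = (\<Sum>l\<le>j. a l * (f l t * (L l t ^ 2 + dL l t)))" for t
  have ufold: "u = (\<lambda>t. \<Sum>l\<le>j. a l * f l t)" by (simp add: u_def f_def)
  show ?thesis
  proof (rule exI[of _ du], rule exI[of _ ddu], intro allI impI conjI)
    fix t :: real assume t: "cos t \<noteq> 0" "sin t \<noteq> 0"
    show "(u has_real_derivative du t) (at t)"
      unfolding ufold du_def by (intro DERIV_sum DERIV_cmult df t)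
    show "(du has_real_derivative ddu t) (at t)"
      unfolding du_def ddu_def by (intro DERIV_sum DERIV_cmult ddf t)
    define X where "X l = a l * f l t * (2 * l * (2 * l + p - 2) / cos t ^ 2)" for l
    define Y where "Y l = a l * f l t * (2 * (j - l) * (2 * (j - l) + q - 2) / sin t ^ 2)" for l
    have "ddu t + w t * du t + E * u t =
        (\<Sum>l\<le>j. a l * f l t * (L l t ^ 2 + dL l t + w t * L l t + E))"
      unfolding ddu_def du_def ufold by (simp add: sum_distrib_left sum.distrib[symmetric] algebra_simps)
    also have "\<dots> = (\<Sum>l\<le>j. X l + Y l)"
      by (rule sum.cong[OF refl]) (simp add: quad[OF t] X_def Y_def distrib_left)
    also have "\<dots> = X 0 + (\<Sum>l<j. X (Suc l)) + ((\<Sum>l<j. Y l) + Y j)"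
      unfolding sum.distrib sum.atMost_shift[of X] by (simp add: lessThan_Suc_atMost[symmetric])
    also have "\<dots> = (\<Sum>l<j. X (Suc l) + Y l)"
      by (simp add: X_def Y_def sum.distrib)
    also have "\<dots> = (\<Sum>l<j. 0)"
    proof (rule sum.cong[OF refl])
      fix l assume "l \<in> {..<j}"
      then have l: "l < j" by simp
      obtain i where i: "j = Suc (l + i)" using less_imp_Suc_add[OF l] by blast
      define G where "G = cos t ^ (2 * l) * sin t ^ (2 * i)"
      have "f (Suc l) t = G * cos t ^ 2" "f l t = G * sin t ^ 2"
        by (simp_all add: f_def G_def i power_add power2_eq_square)
      then have "X (Suc l) = G * (a (Suc l) * (2 * Suc l * (2 * l + p)))"
        "Y l = G * (a l * (2 * (j - l) * (2 * (j - l) + q - 2)))"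
        using t by (simp_all add: X_def Y_def field_simps)
      then show "X (Suc l) + Y l = 0" using rec[OF l] by simp
    qed
    finally show "ddu t + ((q - 1) * (cos t / sin t) - (p - 1) * (sin t / cos t)) * du t
         + 2 * real j * (2 * real j + p + q - 2) * u t = 0"
      by (simp add: w_def E_def)
  qed
qed

text \<open>
If \<open>u\<close> had no zero, \<open>r = u' / u\<close> would satisfy the Riccati equation \<open>r' = - E - w r - r\<^sup>2\<close>. With
\<open>c\<^sup>2 = 2 (E - B\<^sup>2 / 2)\<close> the angle \<open>arctan (r / c)\<close> then decreases at least at the rate \<open>c / 2\<close>,
and the lower bound on \<open>E\<close> makes the total decrease at least \<open>pi\<close>, more than the
arctangent can vary.
\<close>

lemma sturm_oscillation:
  fixes u du ddu w :: "real \<Rightarrow> real"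
  assumes ab: "\<alpha> < \<beta>"
    and u: "\<And>t. t \<in> {\<alpha>..\<beta>} \<Longrightarrow> (u has_real_derivative du t) (at t)"
    and du: "\<And>t. t \<in> {\<alpha>..\<beta>} \<Longrightarrow> (du has_real_derivative ddu t) (at t)"
    and ode: "\<And>t. t \<in> {\<alpha>..\<beta>} \<Longrightarrow> ddu t + w t * du t + E * u t = 0"
    and w: "\<And>t. t \<in> {\<alpha>..\<beta>} \<Longrightarrow> \<bar>w t\<bar> \<le> B"
    and E: "B\<^sup>2 / 2 + 2 * (pi / (\<beta> - \<alpha>))\<^sup>2 \<le> E"
  shows "\<exists>t\<in>{\<alpha>..\<beta>}. u t = 0"
proof (rule ccontr)
  assume "\<not> ?thesis"
  then have nz: "u t \<noteq> 0" if "t \<in> {\<alpha>..\<beta>}" for t using that by blast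
  define N where "N = E - B\<^sup>2 / 2"
  define c where "c = sqrt (2 * N)"
  have N: "2 * (pi / (\<beta> - \<alpha>))\<^sup>2 \<le> N" using E by (simp add: N_def)
  have "(2 * (pi / (\<beta> - \<alpha>)))\<^sup>2 \<le> 2 * N" using N unfolding power_mult_distrib by simp
  then have c_ge: "2 * (pi / (\<beta> - \<alpha>)) \<le> c" unfolding c_def by (rule real_le_rsqrt)
  have "0 < 2 * (pi / (\<beta> - \<alpha>))" using ab by simp
  then have c: "0 < c" using c_ge by linarith
  then have c2: "c\<^sup>2 = 2 * N" unfolding c_def by (simp add: less_imp_le)
  define r where "r t = du t / u t" for t
  define \<theta> where "\<theta> t = arctan (r t / c)" for t
  define d\<theta> where "d\<theta> t = inverse (1 + (r t / c)\<^sup>2) * ((ddu t / u t - (r t)\<^sup>2) / c)" for t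
  have d: "(\<theta> has_real_derivative d\<theta> t) (at t)" if "t \<in> {\<alpha>..\<beta>}" for t
  proof -
    have "(r has_real_derivative ddu t / u t - (r t)\<^sup>2) (at t)"
      unfolding r_def
      by (rule DERIV_cong[OF DERIV_divide[OF du u]])
         (use that nz in \<open>auto simp: field_simps power2_eq_square\<close>)
    then show ?thesis
      unfolding \<theta>_def d\<theta>_def
      by (intro DERIV_chain2[OF DERIV_arctan] DERIV_cdivide)
  qed
  have slope: "d\<theta> t \<le> - (c / 2)" if t: "t \<in> {\<alpha>..\<beta>}" for t
  proof -
    have "ddu t = - (w t * du t + E * u t)" using ode[OF t] by linarith
    then have eq: "ddu t / u t = - (w t * r t) - E"
      using nz[OF t] by (simp add: r_def field_simps)
    have "- (w t * r t) \<le> \<bar>w t\<bar> * \<bar>r t\<bar>" by (metis abs_ge_minus_self abs_mult)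
    also have "\<dots> \<le> ((w t)\<^sup>2 + (r t)\<^sup>2) / 2"
      using sum_squares_bound[of "\<bar>w t\<bar>" "\<bar>r t\<bar>"] by simp
    also have "(w t)\<^sup>2 \<le> B\<^sup>2" using power_mono[OF w[OF t], of 2] by simp
    finally have "ddu t / u t - (r t)\<^sup>2 \<le> - (N + (r t)\<^sup>2 / 2)"
      unfolding eq N_def by (simp add: field_simps)
    also have "N + (r t)\<^sup>2 / 2 = (c\<^sup>2 + (r t)\<^sup>2) / 2" by (simp add: c2)
    finally have "(ddu t / u t - (r t)\<^sup>2) / c \<le> - ((c\<^sup>2 + (r t)\<^sup>2) / 2) / c"
      using c by (intro divide_right_mono) auto
    then have "d\<theta> t \<le> inverse (1 + (r t / c)\<^sup>2) * (- ((c\<^sup>2 + (r t)\<^sup>2) / 2) / c)"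
      unfolding d\<theta>_def by (intro mult_left_mono) (auto simp: add_nonneg_nonneg)
    also have "1 + (r t / c)\<^sup>2 = (c\<^sup>2 + (r t)\<^sup>2) / c\<^sup>2"
      using c by (simp add: power_divide add_divide_distrib)
    also have "inverse ((c\<^sup>2 + (r t)\<^sup>2) / c\<^sup>2) * (- ((c\<^sup>2 + (r t)\<^sup>2) / 2) / c) = - (c / 2)"
    proof -
      have "c\<^sup>2 + (r t)\<^sup>2 > 0" using c by (simp add: add_pos_nonneg)
      moreover have "inverse (K / c\<^sup>2) * (- (K / 2) / c) = - (c / 2)" if "0 < K" for K
        using c that by (simp add: field_simps power2_eq_square)
      ultimately show ?thesis by blast
    qed
    finally show ?thesis .
  qed
  obtain z where z: "\<alpha> < z" "z < \<beta>" "\<theta> \<beta> - \<theta> \<alpha> = (\<beta> - \<alpha>) * d\<theta> z"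
    using MVT2[OF ab, of \<theta> d\<theta>] d by auto
  have "\<theta> \<beta> - \<theta> \<alpha> \<le> (\<beta> - \<alpha>) * - (c / 2)"
    unfolding z(3) using ab z slope[of z] by (intro mult_left_mono) auto
  also have "\<dots> \<le> (\<beta> - \<alpha>) * - (pi / (\<beta> - \<alpha>))"
  proof (intro mult_left_mono)
    show "- (c / 2) \<le> - (pi / (\<beta> - \<alpha>))" using c_ge by linarith
  qed (use ab in simp)
  also have "\<dots> = - pi" using ab by simp
  finally show False
    using arctan_bounded[of "r \<beta> / c"] arctan_bounded[of "r \<alpha> / c"] by (auto simp: \<theta>_def)
qed

text \<open>
On a compact interval inside \<open>(0, pi / 2)\<close> the drift \<open>w\<close> is bounded independently of \<open>j\<close>, while the eigenvalue
\<open>2 j (2 j + p + q - 2)\<close> is unbounded.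
\<close>

lemma jacobi_zeros_dense:
  fixes a :: "nat \<Rightarrow> nat \<Rightarrow> real" and p q :: real
  assumes pq: "2 \<le> p + q" and int: "0 < \<alpha>" "\<alpha> < \<beta>" "\<beta> < pi / 2"
    and rec: "\<And>j l. l < j \<Longrightarrow> a j (Suc l) * (2 * real (Suc l) * (2 * real l + p)) =
     - (a j l * (2 * real (j - l) * (2 * real (j - l) + q - 2)))"
  shows "\<exists>j\<ge>1. \<exists>t\<in>{\<alpha>..\<beta>}. (\<Sum>l\<le>j. a j l * (cos t ^ (2 * l) * sin t ^ (2 * (j - l)))) = 0"
proof -
  have pos: "0 < cos t" "0 < sin t" if "t \<in> {\<alpha>..\<beta>}" for t
    using that int by (auto intro!: cos_gt_zero_pi sin_gt_zero)
  define w where "w t = (q - 1) * (cos t / sin t) - (p - 1) * (sin t / cos t)" for t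
  have "continuous_on {\<alpha>..\<beta>} w"
    unfolding w_def by (intro continuous_intros) (use pos in force)+
  then have "bounded (w ` {\<alpha>..\<beta>})"
    by (intro compact_imp_bounded compact_continuous_image) auto
  then obtain B where "\<forall>y\<in>w ` {\<alpha>..\<beta>}. norm y \<le> B"
    unfolding bounded_iff by blast
  then have B: "\<And>t. t \<in> {\<alpha>..\<beta>} \<Longrightarrow> \<bar>w t\<bar> \<le> B" by simp
  obtain j :: nat where j: "B\<^sup>2 / 2 + 2 * (pi / (\<beta> - \<alpha>))\<^sup>2 + 1 < j"
    using reals_Archimedean2 by blast
  have "0 \<le> B\<^sup>2 / 2 + 2 * (pi / (\<beta> - \<alpha>))\<^sup>2" by simp
  then have j1: "1 < real j" using j by linarith
  have "real j * 1 \<le> (2 * real j) * (2 * real j + p + q - 2)"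
    using j1 pq by (intro mult_mono) auto
  then have E: "B\<^sup>2 / 2 + 2 * (pi / (\<beta> - \<alpha>))\<^sup>2 \<le> (2 * real j) * (2 * real j + p + q - 2)"
    using j by simp
  define u where "u t = (\<Sum>l\<le>j. a j l * (cos t ^ (2 * l) * sin t ^ (2 * (j - l))))" for t
  have u_eq: "u = (\<lambda>t. \<Sum>l\<le>j. a j l * (cos t ^ (2 * l) * sin t ^ (2 * (j - l))))"
    by (simp add: u_def fun_eq_iff)
  obtain du ddu where *: "\<forall>t. cos t \<noteq> 0 \<longrightarrow> sin t \<noteq> 0 \<longrightarrow>
       (u has_real_derivative du t) (at t) \<and> (du has_real_derivative ddu t) (at t) \<and>
       ddu t + w t * du t + 2 * real j * (2 * real j + p + q - 2) * u t = 0"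
    using jacobi_ode[of j "a j" p q, OF rec] unfolding u_eq w_def by auto
  have "\<exists>t\<in>{\<alpha>..\<beta>}. u t = 0"
    by (rule sturm_oscillation[OF int(2), of u du ddu w "(2 * real j) * (2 * real j + p + q - 2)" B])
       (use B E in \<open>simp_all add: * pos less_imp_neq[symmetric] del: atLeastAtMost_iff\<close>)
  then show ?thesis using j1 by (intro exI[of _ j]) (auto simp: u_def)
qed

section \<open>Non-injectivity at the zeros of the Jacobi functions\<close>

definition upper :: "real ^ ('p::finite + 'q::finite) \<Rightarrow> real ^ 'p" where
  "upper x = (\<chi> i. x $ Inl i)"

definition lower :: "real ^ ('p::finite + 'q::finite) \<Rightarrow> real ^ 'q" where
  "lower x = (\<chi> i. x $ Inr i)"

lemma sum_UNIV_Plus: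
  fixes g :: "'p::finite + 'q::finite \<Rightarrow> 'c::comm_monoid_add"
  shows "(\<Sum>i\<in>UNIV. g i) = (\<Sum>i\<in>UNIV. g (Inl i)) + (\<Sum>i\<in>UNIV. g (Inr i))"
  using sum.Plus[of "UNIV :: 'p set" "UNIV :: 'q set" g] by simp

lemma inner_upper_lower: "x \<bullet> y = upper x \<bullet> upper y + lower x \<bullet> lower y"
  by (simp add: inner_vec_def sum_UNIV_Plus upper_def lower_def)

lemma upper_emb [simp]: "upper (emb_upper \<eta>) = \<eta>" "upper (emb_lower \<zeta>) = 0"
  and lower_emb [simp]: "lower (emb_upper \<eta>) = 0" "lower (emb_lower \<zeta>) = \<zeta>"
  by (simp_all add: upper_def lower_def emb_upper_def emb_lower_def vec_eq_iff)

lemma column_matrix_mult: "column j (A ** B) = A *v column j (B :: real^'k^'m)"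
  by (simp add: column_def matrix_matrix_mult_def matrix_vector_mult_def vec_eq_iff)

lemma column_v0: "column b v0 = axis (Inr b) 1"
  by (auto simp: column_def v0_def axis_def vec_eq_iff split: sum.splits)

lemma stiefel_iff: "v \<in> stiefel \<longleftrightarrow> (\<forall>i j. column i v \<bullet> column j v = (if i = j then 1 else 0))"
  by (auto simp: stiefel_def matrix_mult_transpose_dot_column mat_def vec_eq_iff)

lemma orthogonal_matrix_transformation:
  fixes U :: "real^'m^'m"
  shows "orthogonal_matrix U \<Longrightarrow> orthogonal_transformation ((*v) U)"
  by (simp add: orthogonal_transformation_matrix matrix_vector_mul_linear)

text \<open>
Every orthonormal frame is the image of the standard frame under an orthogonal map, so the choice has a
witness.
\<close>

lemma frame_rotation:
  fixes v :: "real ^ 'q ^ ('p::finite + 'q::finite)"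
  assumes "v \<in> stiefel"
  shows "orthogonal_matrix (frame_rotation v) \<and> frame_rotation v ** v0 = v"
  unfolding frame_rotation_def
proof (rule someI_ex)
  have gram: "axis (Inr i) 1 \<bullet> (axis (Inr j) 1 :: real ^ ('p + 'q)) = column i v \<bullet> column j v" for i j
    using assms by (simp add: stiefel_iff inner_axis_axis)
  obtain T :: "real ^ ('p + 'q) \<Rightarrow> real ^ ('p + 'q)"
    where T: "orthogonal_transformation T" "\<And>b. T (axis (Inr b) 1) = column b v"
    by (rule orthogonal_transformation_of_gram[of UNIV "\<lambda>b. axis (Inr b) 1" "\<lambda>b. column b v"])
       (use gram in simp_all)
  have T_lin: "linear T" and "orthogonal_matrix (matrix T)"
    using T(1) by (auto simp: orthogonal_transformation_matrix)
  moreover have "matrix T ** v0 = v"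
  proof -
    have "column b (matrix T ** v0) = column b v" for b
      using T(2) T_lin by (simp add: column_matrix_mult column_v0 matrix_works linear_matrix_vector_mul_eq)
    then show ?thesis by (simp add: vec_eq_iff column_def)
  qed
  ultimately show "\<exists>r. orthogonal_matrix r \<and> r ** v0 = v" by blast
qed

lemma integrable_sphere_measure_iff:
  fixes f :: "'a::euclidean_space \<Rightarrow> 'b::{banach,second_countable_topology}"
  assumes "f \<in> borel_measurable borel"
  shows "integrable sphere_measure f \<longleftrightarrow> integrable unif_sphere f"
  unfolding unif_sphere_def using assms
  by (subst integrable_distr_eq) (auto simp: measurable_sphere_measure_ident)

lemma AE_sphere_measure_iff:
  assumes "{x. P x} \<in> sets borel"
  shows "(AE x in sphere_measure. P (x :: 'a::euclidean_space)) \<longleftrightarrow> (AE x in unif_sphere. P x)"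
  unfolding unif_sphere_def using assms
  by (subst AE_distr_iff) (auto simp: measurable_sphere_measure_ident)

text \<open>
Up to a factor that depends only on \<open>j\<close>, these are the coefficients of the Jacobi polynomial with parameters
\<open>(q / 2 - 1, p / 2 - 1)\<close> at \<open>cos (2 t)\<close>, written in powers of \<open>cos t\<close> and \<open>sin t\<close>.
\<close>

definition jacobi_coeff :: "'p::finite itself \<Rightarrow> 'q::finite itself \<Rightarrow> nat \<Rightarrow> nat \<Rightarrow> real" where
  "jacobi_coeff _ _ j l = (-1) ^ (j - l) * real (2 * j choose (2 * l)) *
     axial_moment TYPE(real^'p) (2 * l) * axial_moment TYPE(real^'q) (2 * (j - l))"

lemma jacobi_coeff_Suc:
  assumes "l < j"
  shows "jacobi_coeff TYPE('p::finite) TYPE('q::finite) j (Suc l) * (2 * real (Suc l) * (2 * real l + real CARD('p))) =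
     - (jacobi_coeff TYPE('p) TYPE('q) j l * (2 * real (j - l) * (2 * real (j - l) + real CARD('q) - 2)))"
proof -
  obtain i where i: "j = Suc (l + i)" using less_imp_Suc_add[OF assms] by blast
  let ?p = "axial_moment TYPE(real^'p)" and ?q = "axial_moment TYPE(real^'q)"
  have p: "(2 * l + real CARD('p)) * ?p (2 * Suc l) = (2 * l + 1) * ?p (2 * l)"
    using axial_moment_Suc[of l, where 'a="real^'p"] by simp
  have q: "(2 * i + real CARD('q)) * ?q (2 * Suc i) = (2 * i + 1) * ?q (2 * i)"
    using axial_moment_Suc[of i, where 'a="real^'q"] by simp
  have step: "(n choose Suc k) * Suc k = (n choose k) * (n - k)" for n k :: nat
    using binomial_absorption[of k n] binomial_absorb_comp[of n k] by (simp only: mult.commute)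
  have i': "2 * j - Suc (2 * l) = 2 * i + 1" "2 * j - 2 * l = 2 * Suc i" "2 * Suc l = Suc (Suc (2 * l))"
    by (simp_all add: i)
  have "(2 * j choose (2 * Suc l)) * (2 * Suc l) * (2 * l + 1) =
      (2 * j choose Suc (2 * l)) * (2 * l + 1) * (2 * i + 1)"
    using step[of "2 * j" "Suc (2 * l)"] unfolding i' by (simp only: mult_ac)
  also have "(2 * j choose Suc (2 * l)) * (2 * l + 1) = (2 * j choose (2 * l)) * (2 * Suc i)"
    using step[of "2 * j" "2 * l"] unfolding i' by (simp only: Suc_eq_plus1)
  finally have "real ((2 * j choose (2 * Suc l)) * (2 * Suc l) * (2 * l + 1)) =
      real ((2 * j choose (2 * l)) * (2 * Suc i) * (2 * i + 1))"
    by (simp only:)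
  then have b: "real (2 * j choose (2 * Suc l)) * (2 * real (Suc l)) * (2 * real l + 1) =
      real (2 * j choose (2 * l)) * (2 * real (Suc i)) * (2 * real i + 1)"
    by (simp only: of_nat_mult of_nat_add of_nat_numeral of_nat_1)
  have "jacobi_coeff TYPE('p) TYPE('q) j (Suc l) * (2 * real (Suc l) * (2 * real l + real CARD('p))) =
      (-1) ^ i * real (2 * j choose (2 * Suc l)) * (2 * real (Suc l)) * ?q (2 * i) * ((2 * l + real CARD('p)) * ?p (2 * Suc l))"
    by (simp add: jacobi_coeff_def i)
  also have "\<dots> = (-1) ^ i * (real (2 * j choose (2 * Suc l)) * (2 * real (Suc l)) * (2 * real l + 1)) * ?q (2 * i) * ?p (2 * l)"
    unfolding p by simp
  also have "\<dots> = (-1) ^ i * real (2 * j choose (2 * l)) * (2 * real (Suc i)) * ?p (2 * l) * ((2 * i + 1) * ?q (2 * i))"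
    unfolding b by simp
  also have "\<dots> = (-1) ^ i * real (2 * j choose (2 * l)) * (2 * real (Suc i)) * ?p (2 * l) * ((2 * i + real CARD('q)) * ?q (2 * Suc i))"
    unfolding q ..
  also have "\<dots> = - (jacobi_coeff TYPE('p) TYPE('q) j l * (2 * real (j - l) * (2 * real (j - l) + real CARD('q) - 2)))"
    by (simp add: jacobi_coeff_def i Suc_diff_le)
  finally show ?thesis .
qed

lemma sum_even_only:
  fixes g :: "nat \<Rightarrow> 'c::comm_monoid_add"
  assumes "\<And>i. odd i \<Longrightarrow> g i = 0"
  shows "(\<Sum>i\<le>2*j. g i) = (\<Sum>l\<le>j. g (2 * l))"
  by (induction j) (simp_all add: assms add.assoc)

lemma integrable_complex_inner_power:
  "integrable unif_sphere (\<lambda>x::'a::euclidean_space. (of_real (x \<bullet> a) + \<i> * of_real (x \<bullet> b)) ^ m)"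
proof (rule integrable_unif_sphere)
  fix x :: 'a assume x: "norm x = 1"
  have "norm (of_real (x \<bullet> a) + \<i> * of_real (x \<bullet> b)) \<le> norm a + norm b"
    using norm_triangle_ineq[of "of_real (x \<bullet> a)" "\<i> * of_real (x \<bullet> b) :: complex"]
      abs_inner_sphere_le[OF x, of a] abs_inner_sphere_le[OF x, of b]
    by (simp add: norm_mult)
  then show "norm ((of_real (x \<bullet> a) + \<i> * of_real (x \<bullet> b)) ^ m) \<le> (norm a + norm b) ^ m"
    by (simp add: norm_power power_mono)
qed simp

text \<open>
The hypotheses on \<open>a, b\<close> say that \<open>a + i b\<close> is null, hence the bilinear squares \<open>A\<close> and \<open>B\<close> of its
two parts satisfy \<open>B = - A\<close>. Odd moments vanish, and in the binomial expansion the remaining terms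
\<open>A\<^bsup>l\<^esup> B\<^bsup>j - l\<^esup>\<close> all become multiples of \<open>A\<^bsup>j\<^esup>\<close>.
\<close>

lemma integral_null_power:
  fixes a b :: "real ^ ('p::finite + 'q::finite)" and s t :: real
  assumes ab: "a \<bullet> a = b \<bullet> b" "a \<bullet> b = 0"
  defines "Z \<equiv> \<lambda>\<eta> \<zeta>. of_real ((s *\<^sub>R emb_upper \<eta> + t *\<^sub>R emb_lower \<zeta>) \<bullet> a)
      + \<i> * of_real ((s *\<^sub>R emb_upper \<eta> + t *\<^sub>R emb_lower \<zeta>) \<bullet> b)"
  shows "(\<integral>\<zeta>. (\<integral>\<eta>. Z \<eta> \<zeta> ^ (2 * j) \<partial>(unif_sphere :: (real^'p) measure)) \<partial>(unif_sphere :: (real^'q) measure)) =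
     (of_real (upper a \<bullet> upper a - upper b \<bullet> upper b) + 2 * \<i> * of_real (upper a \<bullet> upper b)) ^ j *
     of_real (\<Sum>l\<le>j. jacobi_coeff TYPE('p) TYPE('q) j l * (s ^ (2 * l) * t ^ (2 * (j - l))))"
    and "integrable (unif_sphere :: (real^'p) measure) (\<lambda>\<eta>. Z \<eta> \<zeta> ^ (2 * j))"
    and "integrable (unif_sphere :: (real^'q) measure) (\<lambda>\<zeta>. \<integral>\<eta>. Z \<eta> \<zeta> ^ (2 * j) \<partial>(unif_sphere :: (real^'p) measure))"
proof -
  let ?p = "axial_moment TYPE(real^'p)" and ?q = "axial_moment TYPE(real^'q)"
  define P :: "real^'p \<Rightarrow> complex" where "P \<eta> = of_real (\<eta> \<bullet> upper a) + \<i> * of_real (\<eta> \<bullet> upper b)" for \<eta>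
  define Q :: "real^'q \<Rightarrow> complex" where "Q \<zeta> = of_real (\<zeta> \<bullet> lower a) + \<i> * of_real (\<zeta> \<bullet> lower b)" for \<zeta>
  define A :: complex where "A = of_real (upper a \<bullet> upper a - upper b \<bullet> upper b) + 2 * \<i> * of_real (upper a \<bullet> upper b)"
  define B :: complex where "B = of_real (lower a \<bullet> lower a - lower b \<bullet> lower b) + 2 * \<i> * of_real (lower a \<bullet> lower b)"
  have BA: "B = - A"
    using ab unfolding inner_upper_lower[of a] inner_upper_lower[of b b]
    by (simp add: A_def B_def complex_eq_iff)
  have Z: "Z \<eta> \<zeta> = of_real s * P \<eta> + of_real t * Q \<zeta>" for \<eta> \<zeta>
    by (simp add: Z_def P_def Q_def inner_add_left inner_upper_lower[of "emb_upper _"]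
        inner_upper_lower[of "emb_lower _"] algebra_simps)
  define c :: "nat \<Rightarrow> complex" where "c i = of_nat (2 * j choose i) * of_real s ^ i * of_real t ^ (2 * j - i)" for i
  have expand: "Z \<eta> \<zeta> ^ (2 * j) = (\<Sum>i\<le>2*j. c i * Q \<zeta> ^ (2 * j - i) * P \<eta> ^ i)" for \<eta> \<zeta>
    unfolding Z binomial_ring c_def by (simp add: power_mult_distrib mult_ac)
  have Pint: "integrable unif_sphere (\<lambda>\<eta>. P \<eta> ^ i)" for i
    unfolding P_def by (rule integrable_complex_inner_power)
  have Qint: "integrable unif_sphere (\<lambda>\<zeta>. Q \<zeta> ^ i)" for i
    unfolding Q_def by (rule integrable_complex_inner_power)
  have P: "(\<integral>\<eta>. P \<eta> ^ i \<partial>unif_sphere) = of_real (?p i) * A ^ (i div 2)" for i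
    unfolding P_def A_def by (rule integral_complex_inner_power)
  have Q: "(\<integral>\<zeta>. Q \<zeta> ^ i \<partial>unif_sphere) = of_real (?q i) * B ^ (i div 2)" for i
    unfolding Q_def B_def by (rule integral_complex_inner_power)
  show "integrable unif_sphere (\<lambda>\<eta>. Z \<eta> \<zeta> ^ (2 * j))"
    unfolding expand by (intro Bochner_Integration.integrable_sum integrable_mult_right Pint)
  have inner: "(\<integral>\<eta>. Z \<eta> \<zeta> ^ (2 * j) \<partial>unif_sphere) =
      (\<Sum>i\<le>2*j. c i * (of_real (?p i) * A ^ (i div 2)) * Q \<zeta> ^ (2 * j - i))" for \<zeta>
    unfolding expand
    by (subst Bochner_Integration.integral_sum)
       (auto intro!: integrable_mult_right Pint sum.cong simp: P)
  show "integrable unif_sphere (\<lambda>\<zeta>. \<integral>\<eta>. Z \<eta> \<zeta> ^ (2 * j) \<partial>unif_sphere)"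
    unfolding inner by (intro Bochner_Integration.integrable_sum integrable_mult_right Qint)
  have "(\<integral>\<zeta>. (\<integral>\<eta>. Z \<eta> \<zeta> ^ (2 * j) \<partial>unif_sphere) \<partial>unif_sphere) =
      (\<Sum>i\<le>2*j. c i * (of_real (?p i) * A ^ (i div 2)) * (of_real (?q (2 * j - i)) * B ^ ((2 * j - i) div 2)))"
    unfolding inner
    by (subst Bochner_Integration.integral_sum)
       (auto intro!: integrable_mult_right Qint sum.cong simp: Q)
  also have "\<dots> = (\<Sum>l\<le>j. c (2*l) * (of_real (?p (2*l)) * A ^ (2*l div 2)) * (of_real (?q (2 * j - 2*l)) * B ^ ((2 * j - 2*l) div 2)))"
    by (rule sum_even_only) (simp add: axial_moment_odd)
  also have "\<dots> = (\<Sum>l\<le>j. A ^ j * of_real (jacobi_coeff TYPE('p) TYPE('q) j l * (s ^ (2 * l) * t ^ (2 * (j - l)))))"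
  proof (rule sum.cong[OF refl])
    fix l assume "l \<in> {..j}"
    then have "A ^ j = A ^ l * A ^ (j - l)" by (simp add: power_add[symmetric])
    moreover have "B ^ (j - l) = (-1) ^ (j - l) * A ^ (j - l)"
      unfolding BA by (rule power_minus)
    moreover have "2 * j - 2 * l = 2 * (j - l)" by simp
    ultimately show "c (2*l) * (of_real (?p (2*l)) * A ^ (2*l div 2)) * (of_real (?q (2 * j - 2*l)) * B ^ ((2 * j - 2*l) div 2)) =
        A ^ j * of_real (jacobi_coeff TYPE('p) TYPE('q) j l * (s ^ (2 * l) * t ^ (2 * (j - l))))"
      by (simp add: c_def jacobi_coeff_def mult_ac)
  qed
  finally show "(\<integral>\<zeta>. (\<integral>\<eta>. Z \<eta> \<zeta> ^ (2 * j) \<partial>unif_sphere) \<partial>unif_sphere) =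
     (of_real (upper a \<bullet> upper a - upper b \<bullet> upper b) + 2 * \<i> * of_real (upper a \<bullet> upper b)) ^ j *
     of_real (\<Sum>l\<le>j. jacobi_coeff TYPE('p) TYPE('q) j l * (s ^ (2 * l) * t ^ (2 * (j - l))))"
    by (simp add: sum_distrib_left A_def)
qed

text \<open>
The witness is the real part of a power of a null linear form. Its transform vanishes for every
frame, because a rotation maps null vectors to null vectors.
\<close>

lemma noninjective_at_jacobi_zero:
  fixes \<mu> :: "(real ^ 'q ^ ('p::finite + 'q::finite)) measure"
  assumes \<mu>: "invariant_prob_on_stiefel \<mu>"
    and zero: "(\<Sum>l\<le>j. jacobi_coeff TYPE('p) TYPE('q) j l * (cos t ^ (2 * l) * sin t ^ (2 * (j - l)))) = 0"
  shows "\<not> funk_radon_injective \<mu> t"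
proof
  assume inj: "funk_radon_injective \<mu> t"
  obtain i1 :: 'p and i2 :: 'q where True by blast
  define a b :: "real ^ ('p + 'q)" where "a = axis (Inl i1) 1" and "b = axis (Inr i2) 1"
  have ab: "a \<bullet> a = 1" "b \<bullet> b = 1" "a \<bullet> b = 0"
    by (simp_all add: a_def b_def inner_axis_axis inner_real_def)
  define F where "F a b x = (of_real (x \<bullet> a) + \<i> * of_real (x \<bullet> b)) ^ (2 * j)" for a b x :: "real ^ ('p + 'q)"
  define f where "f x = Re (F a b x)" for x
  have f_meas: "f \<in> borel_measurable borel" unfolding f_def F_def by measurable
  have "integrable unif_sphere f"
    unfolding f_def F_def by (intro integrable_Re integrable_complex_inner_power)
  then have f_int: "integrable sphere_measure f" by (simp add: integrable_sphere_measure_iff f_meas)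
  have "F a b (- x) = F a b x" for x
  proof -
    have "of_real (- x \<bullet> a) + \<i> * of_real (- x \<bullet> b) = - (of_real (x \<bullet> a) + \<i> * of_real (x \<bullet> b))"
      by simp
    then have "F a b (- x) = (- (of_real (x \<bullet> a) + \<i> * of_real (x \<bullet> b))) ^ (2 * j)"
      unfolding F_def by (simp only:)
    then show ?thesis by (simp only: F_def power_mult power2_minus)
  qed
  then have "f \<in> L1_even" using f_int by (simp add: L1_even_def f_def)
  moreover have "(\<lambda>x. 0) \<in> (L1_even :: (real ^ ('p + 'q) \<Rightarrow> real) set)" by (simp add: L1_even_def)
  moreover have "AE v in \<mu>. shifted_funk_radon t f v = shifted_funk_radon t (\<lambda>x. 0) v"
  proof (rule AE_I2)
    fix v assume "v \<in> space \<mu>"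
    moreover have "space \<mu> = stiefel"
      using \<mu> sets_eq_imp_space_eq[of \<mu> "restrict_space borel stiefel"]
      by (simp add: invariant_prob_on_stiefel_def space_restrict_space)
    ultimately have r: "orthogonal_transformation ((*v) (frame_rotation v))"
      using frame_rotation[of v] by (simp add: orthogonal_matrix_transformation)
    then obtain S where S: "orthogonal_transformation S" "\<And>x. frame_rotation v *v (S x) = x"
      using orthogonal_transformation_inv orthogonal_transformation_surj surj_f_inv_f by metis
    have rS: "(frame_rotation v *v x) \<bullet> y = x \<bullet> S y" for x y
      using r S(2)[of y] by (metis orthogonal_transformation_def)
    define G where "G \<eta> \<zeta> = F (S a) (S b) (cos t *\<^sub>R emb_upper \<eta> + sin t *\<^sub>R emb_lower \<zeta>)" for \<eta> :: "real^'p" and \<zeta> :: "real^'q"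
    have Sab: "S a \<bullet> S a = S b \<bullet> S b" "S a \<bullet> S b = 0"
      using S(1) ab by (simp_all add: orthogonal_transformation_def)
    note null = integral_null_power[OF Sab, where j=j and s="cos t" and t="sin t"]
    have G1: "integrable unif_sphere (\<lambda>\<eta>. G \<eta> \<zeta>)" for \<zeta>
      unfolding G_def F_def by (rule null(2))
    have G2: "integrable unif_sphere (\<lambda>\<zeta>. \<integral>\<eta>. G \<eta> \<zeta> \<partial>unif_sphere)"
      unfolding G_def F_def by (rule null(3))
    have G0: "(\<integral>\<zeta>. (\<integral>\<eta>. G \<eta> \<zeta> \<partial>unif_sphere) \<partial>unif_sphere) = 0"
      unfolding G_def F_def null(1) zero by simp
    have "shifted_funk_radon t f v = (\<integral>\<zeta>. (\<integral>\<eta>. Re (G \<eta> \<zeta>) \<partial>sphere_measure) \<partial>sphere_measure)"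
      by (simp add: shifted_funk_radon_def f_def F_def rS G_def)
    also have "\<dots> = (\<integral>\<zeta>. Re (\<integral>\<eta>. G \<eta> \<zeta> \<partial>unif_sphere) \<partial>sphere_measure)"
      using G1 by (subst integral_sphere_measure) (auto dest: borel_measurable_integrable simp: measurable_cong_sets[OF sets_unif_sphere refl])
    also have "\<dots> = (\<integral>\<zeta>. Re (\<integral>\<eta>. G \<eta> \<zeta> \<partial>unif_sphere) \<partial>unif_sphere)"
      using borel_measurable_integrable[OF G2] by (subst integral_sphere_measure) (auto simp: measurable_cong_sets[OF sets_unif_sphere refl])
    also have "\<dots> = 0" using G2 G0 by simp
    finally show "shifted_funk_radon t f v = shifted_funk_radon t (\<lambda>x. 0) v"
      by (simp add: shifted_funk_radon_def)
  qed
  ultimately have "AE x in sphere_measure. f x = 0"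
    using inj unfolding funk_radon_injective_def by blast
  then have "AE x in unif_sphere. f x = 0"
    using f_meas by (subst (asm) AE_sphere_measure_iff) auto
  then have "AE x in unif_sphere. x \<notin> {x. f x > 1/2}"
    by eventually_elim simp
  moreover have op: "open {x. f x > 1/2}"
    unfolding f_def F_def by (intro open_Collect_less continuous_intros)
  ultimately have "emeasure unif_sphere {x. f x > 1/2} = 0"
    by (subst (asm) AE_iff_null_sets[symmetric]) auto
  moreover have "f a = 1" by (simp add: f_def F_def ab)
  moreover have "norm a = 1" using ab by (simp add: norm_eq_1)
  ultimately show False using unif_sphere_open_pos[OF op, of a] by simp
qed

lemma noninjective_dense:
  fixes \<mu> :: "(real ^ 'q ^ ('p::finite + 'q::finite)) measure"
  assumes \<mu>: "invariant_prob_on_stiefel \<mu>"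
  shows "{0<..<pi / 2} \<subseteq> closure {t \<in> {0<..<pi / 2}. \<not> funk_radon_injective \<mu> t}"
proof
  fix t0 :: real assume t0: "t0 \<in> {0<..<pi / 2}"
  show "t0 \<in> closure {t \<in> {0<..<pi / 2}. \<not> funk_radon_injective \<mu> t}"
    unfolding closure_approachable
  proof (intro allI impI)
    fix e :: real assume e: "0 < e"
    define \<beta> where "\<beta> = min (t0 + e / 2) ((t0 + pi / 2) / 2)"
    have \<beta>: "t0 < \<beta>" "\<beta> < pi / 2" "\<beta> < t0 + e" using t0 e by (auto simp: \<beta>_def min_def)
    have "2 \<le> real CARD('p) + real CARD('q)"
      using zero_less_card_finite[where 'a='p] zero_less_card_finite[where 'a='q] by linarith
    then have "\<exists>j\<ge>1. \<exists>t\<in>{t0..\<beta>}. (\<Sum>l\<le>j. jacobi_coeff TYPE('p) TYPE('q) j l * (cos t ^ (2 * l) * sin t ^ (2 * (j - l)))) = 0"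
      by (rule jacobi_zeros_dense) (use t0 \<beta> in \<open>simp_all only: jacobi_coeff_Suc greaterThanLessThan_iff\<close>)
    then obtain j t where jt: "t \<in> {t0..\<beta>}"
      "(\<Sum>l\<le>j. jacobi_coeff TYPE('p) TYPE('q) j l * (cos t ^ (2 * l) * sin t ^ (2 * (j - l)))) = 0"
      by blast
    then show "\<exists>t\<in>{t \<in> {0<..<pi / 2}. \<not> funk_radon_injective \<mu> t}. dist t t0 < e"
      using noninjective_at_jacobi_zero[OF \<mu> jt(2)] t0 \<beta> by (intro bexI[of _ t]) (auto simp: dist_real_def)
  qed
qed

section \<open>Directions orthogonal to a frame\<close>

text \<open>
One Gram--Schmidt step: the direction of the part of \<open>z\<close> orthogonal to the family. When \<open>z\<close> lies in the
span, the value is \<open>0\<close> because \<open>sgn 0 = 0\<close>; this happens on a null set. For a random \<open>z\<close> this produces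
a random point of the subsphere orthogonal to a frame, by a formula that is Borel in the frame and in \<open>z\<close>,
whereas a rotation picked by choice need not depend measurably on the frame.
\<close>

definition residual :: "('i::finite \<Rightarrow> 'a::euclidean_space) \<Rightarrow> 'a \<Rightarrow> 'a" where
  "residual B z = sgn (z - (\<Sum>i\<in>UNIV. (B i \<bullet> z) *\<^sub>R B i))"

definition orthonormal_family :: "('i::finite \<Rightarrow> 'a::euclidean_space) \<Rightarrow> bool" where
  "orthonormal_family B \<longleftrightarrow> (\<forall>i j. B i \<bullet> B j = (if i = j then 1 else 0))"

lemma sgn_orthogonal_transformation:
  "orthogonal_transformation T \<Longrightarrow> sgn (T x) = T (sgn x)"
  by (simp add: sgn_div_norm orthogonal_transformation_norm orthogonal_transformation_scaleR)

lemma residual_transform: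
  assumes T: "orthogonal_transformation T"
  shows "residual (\<lambda>i. T (B i)) (T z) = T (residual B z)"
proof -
  have lin: "linear T" using T by (rule orthogonal_transformation_linear)
  have "T z - (\<Sum>i\<in>UNIV. (T (B i) \<bullet> T z) *\<^sub>R T (B i)) = T (z - (\<Sum>i\<in>UNIV. (B i \<bullet> z) *\<^sub>R B i))"
    using T by (simp add: linear_diff[OF lin] linear_sum[OF lin] linear_scale[OF lin] orthogonal_transformation_def)
  then show ?thesis by (simp add: residual_def sgn_orthogonal_transformation[OF T])
qed

lemma inner_residual_family:
  assumes "orthonormal_family B"
  shows "B j \<bullet> residual B z = 0"
  using assms
  by (simp add: residual_def sgn_div_norm inner_diff_right inner_sum_right orthonormal_family_def
      if_distrib[of "\<lambda>c. _ * c"] cong: if_cong)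

lemma inner_residual:
  assumes "\<And>i. B i \<bullet> y = 0"
  shows "y \<bullet> residual B z = (y \<bullet> z) / norm (z - (\<Sum>i\<in>UNIV. (B i \<bullet> z) *\<^sub>R B i))"
  using assms
  by (simp add: residual_def sgn_div_norm inner_diff_right inner_sum_right inner_commute[of y] divide_inverse_commute)

lemma norm_residual_le: "norm (residual B z) \<le> 1"
  by (simp add: residual_def norm_sgn)

lemma AE_residual:
  assumes y: "\<And>i. B i \<bullet> y = 0" "y \<noteq> 0"
  shows "AE z in unif_sphere. norm (residual B z) = 1 \<and> (y \<bullet> residual B z \<noteq> 0)"
  using AE_unif_sphere_hyperplane[OF y(2)]
proof eventually_elim
  case (elim z)
  have "y \<bullet> (z - (\<Sum>i\<in>UNIV. (B i \<bullet> z) *\<^sub>R B i)) = y \<bullet> z"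
    using y(1) by (simp add: inner_diff_right inner_sum_right inner_commute[of y])
  then have "z - (\<Sum>i\<in>UNIV. (B i \<bullet> z) *\<^sub>R B i) \<noteq> 0" using elim by auto
  then show ?case using elim inner_residual[of B y z, OF y(1)] by (simp add: residual_def norm_sgn)
qed

lemma residual_measurable:
  fixes B :: "'i::finite \<Rightarrow> 'b \<Rightarrow> 'a::euclidean_space"
  assumes [measurable]: "\<And>i. B i \<in> borel_measurable M" "f \<in> borel_measurable M"
  shows "(\<lambda>p. residual (\<lambda>i. B i p) (f p)) \<in> borel_measurable M"
  unfolding residual_def by measurable

lemma orthogonal_transformation_of_pair:
  fixes x y x' y' :: "'a::euclidean_space"
  assumes "x \<bullet> x = x' \<bullet> x'" "y \<bullet> y = y' \<bullet> y'" "x \<bullet> y = x' \<bullet> y'"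
  obtains T where "orthogonal_transformation T" "T x = x'" "T y = y'"
proof -
  have gram: "(if i then x else y) \<bullet> (if j then x else y) = (if i then x' else y') \<bullet> (if j then x' else y')"
    for i j :: bool
    using assms by (simp add: inner_commute)
  obtain T where T: "orthogonal_transformation T" "\<And>i. T (if i then x else y) = (if i then x' else y')"
    by (rule orthogonal_transformation_of_gram[of UNIV "\<lambda>b. if b then x else y" "\<lambda>b. if b then x' else y'"])
       (use gram in simp_all)
  show ?thesis using that[OF T(1)] T(2)[of True] T(2)[of False] by simp
qed

abbreviation perp :: "'a::euclidean_space \<Rightarrow> 'a \<Rightarrow> 'a" where
  "perp x \<equiv> residual (\<lambda>_::unit. x)"

text \<open>
The even moments of a coordinate of the uniform law on the unit sphere of a hyperplane. By invariance
any orthonormal pair could be used in place of the chosen one.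
\<close>

definition perp_moment :: "'a::euclidean_space itself \<Rightarrow> nat \<Rightarrow> real" where
  "perp_moment _ h = (let e = (SOME b. b \<in> (Basis :: 'a set)); e' = (SOME b. b \<in> Basis - {e})
     in \<integral>w. (perp e w \<bullet> e') ^ (2 * h) \<partial>unif_sphere)"

text \<open>
A unit vector \<open>y\<close> is \<open>s x\<close> plus \<open>sqrt (1 - s\<^sup>2)\<close> times a unit vector orthogonal to \<open>x\<close>, where \<open>s = x \<bullet> y\<close>,
and \<open>perp x w\<close> sees only the second part. Moments for two orthonormal pairs agree because an orthogonal
map takes one pair to the other.
\<close>

lemma
  assumes dim: "2 \<le> DIM('a::euclidean_space)"
  shows perp_moment_nonzero: "perp_moment TYPE('a) h \<noteq> 0"
    and integral_perp_even: "\<And>x y :: 'a. norm x = 1 \<Longrightarrow> norm y = 1 \<Longrightarrow>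
      (\<integral>w. (perp x w \<bullet> y) ^ (2 * h) \<partial>unif_sphere) = perp_moment TYPE('a) h * (1 - (x \<bullet> y)\<^sup>2) ^ h"
    and integral_perp_odd: "\<And>x y :: 'a. norm x = 1 \<Longrightarrow> norm y = 1 \<Longrightarrow> odd i \<Longrightarrow>
      (\<integral>w. (perp x w \<bullet> y) ^ i \<partial>unif_sphere) = 0"
proof -
  have perp_meas[measurable]: "perp x \<in> borel_measurable borel" for x :: 'a
    using residual_measurable[of "\<lambda>(_::unit) _. x" borel "\<lambda>w. w", OF measurable_const measurable_ident_sets]
    by simp
  define M where "M i x y = (\<integral>w. (perp x w \<bullet> y) ^ i \<partial>unif_sphere)" for i and x y :: 'a
  have M_inv: "M i x y = M i x' y'"
    if eqs: "x \<bullet> x = x' \<bullet> x'" "y \<bullet> y = y' \<bullet> y'" "x \<bullet> y = x' \<bullet> y'" for i x y x' y'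
  proof -
    obtain T where T: "orthogonal_transformation T" "T x = x'" "T y = y'"
      using orthogonal_transformation_of_pair[OF eqs] .
    have "M i x' y' = (\<integral>w. (perp (T x) (T w) \<bullet> T y) ^ i \<partial>unif_sphere)"
      unfolding M_def T(2,3)
      by (rule integral_unif_sphere_transform[OF T(1), symmetric]) measurable
    also have "\<dots> = M i x y"
      using T(1) unfolding M_def residual_transform[OF T(1)] by (simp add: orthogonal_transformation_def)
    finally show ?thesis ..
  qed
  have M_odd: "M i x y = 0" if "x \<bullet> y = 0" "odd i" for i x y
  proof -
    have "M i x y = M i x (- y)" by (rule M_inv) (use that in auto)
    also have "\<dots> = - M i x y" using that(2) by (simp add: M_def)
    finally show ?thesis by simp
  qed
  define e where "e = (SOME b. b \<in> (Basis :: 'a set))"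
  define e' where "e' = (SOME b. b \<in> Basis - {e})"
  have e: "e \<in> Basis" unfolding e_def by (rule someI_ex) (use nonempty_Basis in blast)
  have "\<not> (Basis :: 'a set) \<subseteq> {e}"
  proof
    assume "(Basis :: 'a set) \<subseteq> {e}"
    then have "DIM('a) \<le> card {e}" by (intro card_mono) auto
    then show False using dim by simp
  qed
  then have "\<exists>b. b \<in> Basis - {e}" by blast
  then have "e' \<in> Basis - {e}" unfolding e'_def by (rule someI_ex)
  then have e': "e' \<in> Basis" "e' \<noteq> e" by auto
  have ee: "e \<bullet> e = 1" "e' \<bullet> e' = 1" "e \<bullet> e' = 0" using e e' by (auto simp: inner_Basis)
  have decomp: "M i x y = sqrt (1 - (x \<bullet> y)\<^sup>2) ^ i * M i e e'" if x: "norm x = 1" and y: "norm y = 1" for i x y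
  proof -
    let ?s = "x \<bullet> y"
    have xx: "x \<bullet> x = 1" and yy: "y \<bullet> y = 1" using x y by (simp_all add: norm_eq_1)
    have "\<bar>?s\<bar> \<le> 1" using Cauchy_Schwarz_ineq2[of x y] x y by simp
    then have s1: "0 \<le> 1 - ?s\<^sup>2" by (simp add: abs_square_le_1)
    obtain y' where y': "y' \<bullet> y' = 1" "x \<bullet> y' = 0" "y = ?s *\<^sub>R x + sqrt (1 - ?s\<^sup>2) *\<^sub>R y'"
    proof (cases "1 - ?s\<^sup>2 = 0")
      case True
      have "(y - ?s *\<^sub>R x) \<bullet> (y - ?s *\<^sub>R x) = 1 - ?s\<^sup>2"
        using xx yy by (simp add: inner_diff_left inner_diff_right inner_commute power2_eq_square)
      then have "y = ?s *\<^sub>R x" using True by simp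
      moreover obtain T where T: "orthogonal_transformation T" "T e = x"
        using orthogonal_transformation_of_gram[of "{()}" "\<lambda>_. e" "\<lambda>_. x"] xx ee by auto
      moreover have "T e' \<bullet> T e' = 1" "T e \<bullet> T e' = 0"
        using T(1) ee by (simp_all add: orthogonal_transformation_def)
      ultimately show ?thesis using that[of "T e'"] True by simp
    next
      case False
      define r where "r = sqrt (1 - ?s\<^sup>2)"
      have r: "r \<noteq> 0" "r\<^sup>2 = 1 - ?s\<^sup>2" using False s1 by (auto simp: r_def)
      define d where "d = y - ?s *\<^sub>R x"
      have dd: "d \<bullet> d = r\<^sup>2" "x \<bullet> d = 0"
        using xx yy r(2) by (simp_all add: d_def inner_diff_left inner_diff_right inner_commute power2_eq_square)
      show ?thesis
      proof (rule that[of "d /\<^sub>R r"])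
        show "(d /\<^sub>R r) \<bullet> (d /\<^sub>R r) = 1" "x \<bullet> (d /\<^sub>R r) = 0"
          using r(1) by (simp_all add: dd power2_eq_square field_simps)
        show "y = ?s *\<^sub>R x + sqrt (1 - ?s\<^sup>2) *\<^sub>R (d /\<^sub>R r)"
          unfolding r_def[symmetric] using r(1) by (simp add: d_def)
      qed
    qed
    have "perp x w \<bullet> y = sqrt (1 - ?s\<^sup>2) * (perp x w \<bullet> y')" for w
    proof -
      have "x \<bullet> perp x w = 0"
        using inner_residual_family[of "\<lambda>_::unit. x" "()" w] xx by (simp add: orthonormal_family_def)
      then show ?thesis by (subst y'(3)) (simp add: inner_add_right inner_commute)
    qed
    then have "M i x y = sqrt (1 - ?s\<^sup>2) ^ i * M i x y'"
      by (simp add: M_def power_mult_distrib)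
    also have "M i x y' = M i e e'" by (rule M_inv) (use xx y' ee in auto)
    finally show ?thesis .
  qed
  have nz: "M (2 * h) e e' \<noteq> 0" for h
  proof
    assume 0: "M (2 * h) e e' = 0"
    have int: "integrable unif_sphere (\<lambda>w. (perp e w \<bullet> e') ^ (2 * h))"
    proof (rule integrable_unif_sphere)
      fix w
      have "\<bar>perp e w \<bullet> e'\<bar> \<le> 1"
        using Cauchy_Schwarz_ineq2[of "perp e w" e'] norm_residual_le[of "\<lambda>_::unit. e" w] ee(2)
        by (simp add: norm_eq_1[symmetric])
      then show "norm ((perp e w \<bullet> e') ^ (2 * h)) \<le> 1" by (simp add: power_abs power_le_one)
    qed simp
    have "AE w in unif_sphere. (perp e w \<bullet> e') ^ (2 * h) = 0"
      using integral_nonneg_eq_0_iff_AE[OF int] 0 by (simp add: M_def power_mult)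
    moreover have "AE w in unif_sphere. e' \<bullet> perp e w \<noteq> 0"
    proof -
      have "e' \<noteq> 0" using ee(2) by auto
      then show ?thesis using AE_residual[of "\<lambda>_::unit. e" e'] ee(3) by auto
    qed
    ultimately have "AE w in (unif_sphere :: 'a measure). False"
      by eventually_elim (simp add: inner_commute)
    then show False
      using prob_space.AE_False[OF prob_space_unif_sphere] by blast
  qed
  have pm: "perp_moment TYPE('a) h = M (2 * h) e e'" for h
    unfolding perp_moment_def Let_def M_def e'_def e_def ..
  show "perp_moment TYPE('a) h \<noteq> 0" unfolding pm by (rule nz)
  fix x y :: 'a assume xy: "norm x = 1" "norm y = 1"
  show "(\<integral>w. (perp x w \<bullet> y) ^ (2 * h) \<partial>unif_sphere) = perp_moment TYPE('a) h * (1 - (x \<bullet> y)\<^sup>2) ^ h"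
  proof -
    have "\<bar>x \<bullet> y\<bar> \<le> 1" using Cauchy_Schwarz_ineq2[of x y] xy by simp
    then have "0 \<le> 1 - (x \<bullet> y)\<^sup>2" by (simp add: abs_square_le_1)
    then show ?thesis using decomp[OF xy, of "2 * h"] by (simp add: pm M_def power_mult)
  qed
  show "(\<integral>w. (perp x w \<bullet> y) ^ i \<partial>unif_sphere) = 0" if "odd i"
    using decomp[OF xy, of i] M_odd[OF ee(3) that] by (simp add: M_def)
qed

section \<open>Random points at a given distance from a subsphere\<close>

lemma column_measurable [measurable]: "column b \<in> borel_measurable (borel :: (real^'q^'m) measure)"
  by (rule borel_measurable_linear, rule linearI) (simp_all add: column_def vec_eq_iff)

lemma emb_measurable [measurable]:
  "(emb_upper :: real^'p \<Rightarrow> real^('p::finite + 'q::finite)) \<in> borel_measurable borel"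
  "(emb_lower :: real^'q \<Rightarrow> real^('p::finite + 'q::finite)) \<in> borel_measurable borel"
  by (rule borel_measurable_linear, rule linearI;
      auto simp: emb_upper_def emb_lower_def vec_eq_iff split: sum.splits)+

lemma matrix_vector_mult_measurable [measurable]:
  fixes A :: "real^'n^'m"
  shows "(*v) A \<in> borel_measurable borel"
  by (rule borel_measurable_linear) (rule matrix_vector_mul_linear)

lemma matrix_mult_measurable:
  fixes U :: "real^'m^'m"
  shows "(**) U \<in> borel_measurable (borel :: (real^'q^'m) measure)"
  by (rule borel_measurable_linear, rule linearI)
     (simp_all add: matrix_matrix_mult_def vec_eq_iff distrib_left sum.distrib sum_distrib_left mult_ac)

lemma stiefel_borel [measurable]: "(stiefel :: (real^'q^'m) set) \<in> sets borel"
proof -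
  have "{v \<in> space borel. \<forall>i j. column i v \<bullet> column j (v :: real^'q^'m) = (if i = j then 1 else 0)} \<in> sets borel"
    by measurable
  then show ?thesis unfolding stiefel_iff[symmetric] by simp
qed

text \<open>
The point at distance \<open>t\<close> from the subsphere orthogonal to \<open>v\<close>, above the foot point determined by \<open>z\<close>
and in the normal direction \<open>v *v \<zeta>\<close>.
\<close>

definition frame_point :: "real \<Rightarrow> real^'q^'m \<Rightarrow> real^'q \<Rightarrow> real^'m \<Rightarrow> real^'m" where
  "frame_point t v \<zeta> z = cos t *\<^sub>R residual (\<lambda>b. column b v) z + sin t *\<^sub>R (v *v \<zeta>)"

lemma frame_point_measurable [measurable (raw)]:
  assumes [measurable]: "v \<in> borel_measurable M" "\<zeta> \<in> borel_measurable M" "z \<in> borel_measurable M"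
  shows "(\<lambda>p. frame_point t (v p) (\<zeta> p) (z p)) \<in> borel_measurable M"
proof -
  have [measurable]: "(\<lambda>p. residual (\<lambda>b. column b (v p)) (z p)) \<in> borel_measurable M"
    by (rule residual_measurable) measurable
  have eq: "v p *v \<zeta> p = (\<Sum>b\<in>UNIV. (\<zeta> p \<bullet> axis b 1) *\<^sub>R column b (v p))" for p
    by (simp add: matrix_mult_sum scalar_mult_eq_scaleR inner_axis)
  show ?thesis
    unfolding frame_point_def eq by measurable
qed

lemma frame_point_transform:
  fixes U :: "real^'m^'m"
  assumes "orthogonal_matrix U"
  shows "frame_point t (U ** v) \<zeta> (U *v z) = U *v frame_point t v \<zeta> z"
  unfolding frame_point_def column_matrix_mult
    residual_transform[OF orthogonal_matrix_transformation[OF assms]]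
  by (simp add: matrix_vector_mul_assoc matrix_vector_right_distrib matrix_vector_mult_scaleR)

lemma stiefel_orthonormal: "v \<in> stiefel \<Longrightarrow> orthonormal_family (\<lambda>b. column b v)"
  by (simp add: stiefel_iff orthonormal_family_def)

lemma stiefel_mult_inner:
  assumes "v \<in> stiefel"
  shows "(v *v \<zeta>) \<bullet> (v *v \<zeta>') = \<zeta> \<bullet> \<zeta>'" "column c v \<bullet> (v *v \<zeta>) = \<zeta> $ c"
proof -
  have c: "column c v \<bullet> (v *v \<zeta>) = \<zeta> $ c" for c \<zeta>
    using assms by (simp add: matrix_mult_sum scalar_mult_eq_scaleR inner_sum_right stiefel_iff
        if_distrib[of "\<lambda>c. _ * c"] cong: if_cong)
  show "column c v \<bullet> (v *v \<zeta>) = \<zeta> $ c" by (rule c)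
  have "(v *v \<zeta>) \<bullet> (v *v \<zeta>') = (\<Sum>b\<in>UNIV. \<zeta> $ b * (column b v \<bullet> (v *v \<zeta>')))"
    by (subst matrix_mult_sum) (simp add: scalar_mult_eq_scaleR inner_sum_left)
  also have "\<dots> = \<zeta> \<bullet> \<zeta>'" unfolding c by (simp add: inner_vec_def)
  finally show "(v *v \<zeta>) \<bullet> (v *v \<zeta>') = \<zeta> \<bullet> \<zeta>'" .
qed

lemma frame_rotation_columns:
  fixes v :: "real ^ 'q ^ ('p::finite + 'q::finite)"
  assumes "v \<in> stiefel"
  shows "column b v = frame_rotation v *v axis (Inr b) 1"
    and "frame_rotation v *v emb_lower \<zeta> = v *v \<zeta>"
proof -
  have r: "frame_rotation v ** v0 = v" using frame_rotation[OF assms] by simp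
  show "column b v = frame_rotation v *v axis (Inr b) 1"
    by (subst r[symmetric]) (simp add: column_matrix_mult column_v0)
  have "(emb_lower \<zeta> :: real^('p + 'q)) = v0 *v \<zeta>"
    by (auto simp: emb_lower_def v0_def vec_eq_iff matrix_vector_mult_def if_distrib[of "\<lambda>c. c * _"]
        split: sum.splits cong: if_cong)
  then show "frame_rotation v *v emb_lower \<zeta> = v *v \<zeta>"
    by (simp add: matrix_vector_mul_assoc r)
qed

lemma frame_has_normal:
  fixes v :: "real ^ 'q ^ ('p::finite + 'q::finite)"
  assumes "v \<in> stiefel"
  obtains y where "y \<noteq> 0" "\<And>b. column b v \<bullet> y = 0"
proof -
  obtain i :: 'p where True by blast
  have r: "orthogonal_transformation ((*v) (frame_rotation v))"
    using frame_rotation[OF assms] by (simp add: orthogonal_matrix_transformation)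
  define y where "y = frame_rotation v *v axis (Inl i) 1"
  have "norm y = 1" using r by (simp add: y_def orthogonal_transformation_norm)
  then have "y \<noteq> 0" by auto
  moreover have "column b v \<bullet> y = 0" for b
    using r by (simp add: y_def frame_rotation_columns(1)[OF assms] orthogonal_transformation_def inner_axis_axis)
  ultimately show ?thesis by (rule that)
qed

lemma distr_distr_equivariant:
  assumes f: "f \<in> M \<rightarrow>\<^sub>M N" and T: "T \<in> N \<rightarrow>\<^sub>M N" and S: "S \<in> M \<rightarrow>\<^sub>M M" "distr M M S = M"
    and eq: "\<And>x. x \<in> space M \<Longrightarrow> T (f x) = f (S x)"
  shows "distr (distr M N f) N T = distr M N f"
proof -
  have "distr (distr M N f) N T = distr M N (\<lambda>x. f (S x))"
    unfolding distr_distr[OF T f] by (rule distr_cong) (auto simp: eq)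
  also have "\<dots> = distr (distr M M S) N f"
    by (simp add: distr_distr[OF f S(1)] comp_def)
  finally show ?thesis by (simp add: S(2))
qed

lemma distr_pair_invariant:
  assumes "sigma_finite_measure B"
    and "S \<in> A \<rightarrow>\<^sub>M A" "distr A A S = A" "T \<in> B \<rightarrow>\<^sub>M B" "distr B B T = B"
  shows "distr (A \<Otimes>\<^sub>M B) (A \<Otimes>\<^sub>M B) (\<lambda>(a, b). (S a, T b)) = A \<Otimes>\<^sub>M B"
  using pair_measure_distr[of S A A T B B] assms by simp

lemma unif_sphere_invariant:
  fixes T :: "'a::euclidean_space \<Rightarrow> 'a"
  assumes "orthogonal_transformation T"
  shows "T \<in> unif_sphere \<rightarrow>\<^sub>M unif_sphere" "distr unif_sphere unif_sphere T = unif_sphere"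
proof -
  show "T \<in> unif_sphere \<rightarrow>\<^sub>M unif_sphere"
    using orthogonal_transformation_borel_measurable[OF assms]
    by (simp add: measurable_cong_sets[OF sets_unif_sphere sets_unif_sphere])
  have "distr unif_sphere unif_sphere T = distr unif_sphere borel T"
    by (rule distr_cong) auto
  then show "distr unif_sphere unif_sphere T = unif_sphere"
    by (simp add: distr_unif_sphere[OF assms])
qed

lemma dist_orthogonal_transformation:
  fixes T :: "'a::euclidean_space \<Rightarrow> 'a"
  assumes "orthogonal_transformation T"
  shows "dist (T u) (T w) = dist u w"
  unfolding dist_norm linear_diff[OF orthogonal_transformation_linear[OF assms], symmetric]
  by (rule orthogonal_transformation_norm[OF assms])

lemma borel_unif_sphere: "borel_measurable unif_sphere = borel_measurable borel"
  by (rule measurable_cong_sets) simp_all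

text \<open>
Both sides are laws on the unit sphere of the orthogonal complement of the columns of \<open>v\<close>, and they are
invariant under all orthogonal maps fixing these columns. Such maps act transitively there. This
replaces the rotation chosen in the definition of the transform by a measurable construction.
\<close>

lemma residual_law:
  fixes v :: "real ^ 'q ^ ('p::finite + 'q::finite)"
  assumes v: "v \<in> stiefel"
  shows "distr unif_sphere borel (\<lambda>\<eta>. frame_rotation v *v emb_upper \<eta>) =
    distr unif_sphere borel (residual (\<lambda>b. column b v))"
proof -
  define r where "r = (*v) (frame_rotation v)"
  define B where "B b = column b v" for b
  define E where "E = (emb_upper :: real^'p \<Rightarrow> real^('p + 'q))"
  have r: "orthogonal_transformation r"
    unfolding r_def using frame_rotation[OF v] by (simp add: orthogonal_matrix_transformation)
  have B: "B b = r (axis (Inr b) 1)" for b by (simp add: B_def r_def frame_rotation_columns(1)[OF v])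
  have orth: "orthonormal_family B" unfolding B_def[abs_def] by (rule stiefel_orthonormal[OF v])
  have r_inner: "r x \<bullet> r y = x \<bullet> y" for x y using r by (simp add: orthogonal_transformation_def)
  have E_inner: "E x \<bullet> E y = x \<bullet> y" for x y by (simp add: E_def inner_upper_lower)
  have E_axis: "axis (Inr b) 1 \<bullet> E x = 0" for x b
    by (simp add: E_def emb_upper_def inner_axis')
  have [measurable]: "r \<in> borel_measurable borel" "E \<in> borel_measurable borel"
    unfolding r_def E_def by measurable
  have [measurable]: "residual B \<in> borel_measurable borel"
    using residual_measurable[of "\<lambda>b _. B b" borel "\<lambda>z. z", OF measurable_const measurable_ident_sets] by simp
  let ?M = "distr unif_sphere borel (\<lambda>\<eta>. r (E \<eta>))" and ?N = "distr unif_sphere borel (residual B)"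
  define Z where "Z = {x. norm x = 1 \<and> (\<forall>b. B b \<bullet> x = 0)}"
  have Z_borel[measurable]: "Z \<in> sets borel"
  proof -
    have "{x \<in> space borel. norm x = 1 \<and> (\<forall>b. B b \<bullet> x = 0)} \<in> sets borel" by measurable
    then show ?thesis by (simp add: Z_def)
  qed
  have rE_Z: "r (E \<eta>) \<in> Z" if "norm \<eta> = 1" for \<eta>
    using that by (auto simp: Z_def B r_inner E_axis E_inner norm_eq_1)
  have Z_rE: "\<exists>\<eta>. norm \<eta> = 1 \<and> r (E \<eta>) = x" if "x \<in> Z" for x
  proof -
    obtain w where w: "x = r w" using orthogonal_transformation_surj[OF r] by blast
    have "lower w = 0"
    proof -
      have "lower w $ b = 0" for b
        using that by (simp add: Z_def w B r_inner inner_axis' lower_def)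
      then show ?thesis by (simp add: vec_eq_iff)
    qed
    then have "w = E (upper w)"
      by (auto simp: E_def emb_upper_def upper_def lower_def vec_eq_iff split: sum.splits)
    moreover have "norm w = 1" using that by (simp add: Z_def w orthogonal_transformation_norm[OF r])
    ultimately show ?thesis using w by (metis E_inner norm_eq_sqrt_inner)
  qed
  have "?M = ?N"
  proof (rule invariant_prob_space_unique[of ?M ?N Z])
    show "prob_space ?M" "prob_space ?N"
      by (auto intro!: prob_space.prob_space_distr prob_space_unif_sphere simp: borel_unif_sphere)
    show "AE x in ?M. x \<in> Z"
      by (subst AE_distr_iff) (use AE_unif_sphere rE_Z in \<open>auto simp: borel_unif_sphere elim!: eventually_mono\<close>)
    show "AE x in ?N. x \<in> Z"
    proof -
      obtain y where "y \<noteq> 0" "\<And>b. B b \<bullet> y = 0" using frame_has_normal[OF v] unfolding B_def by blast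
      then have "AE z in unif_sphere. residual B z \<in> Z"
        using AE_residual[of B y] inner_residual_family[OF orth]
        by (auto simp: Z_def elim!: eventually_mono)
      then show ?thesis by (subst AE_distr_iff) (auto simp: borel_unif_sphere)
    qed
    fix x y assume xy: "x \<in> Z" "y \<in> Z"
    obtain \<xi> \<theta> where "norm \<xi> = 1" "r (E \<xi>) = x" "norm \<theta> = 1" "r (E \<theta>) = y"
      using Z_rE[OF xy(1)] Z_rE[OF xy(2)] by blast
    \<comment> \<open>The index \<open>None\<close> carries the vector that moves, the indices \<open>Some b\<close> the columns that stay fixed.\<close>
    have gram: "case_option x B i \<bullet> case_option x B j = case_option y B i \<bullet> case_option y B j" for i j
      using xy by (auto simp: Z_def inner_commute norm_eq_1 split: option.splits)
    obtain T where T: "orthogonal_transformation T" "\<And>i. T (case_option x B i) = case_option y B i"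
      by (rule orthogonal_transformation_of_gram[of UNIV "case_option x B" "case_option y B"])
         (use gram in simp_all)
    have Txy: "T x = y" and TB: "T (B b) = B b" for b
      using T(2)[of None] T(2)[of "Some b"] by simp_all
    have T_inner: "T u \<bullet> T w = u \<bullet> w" for u w using T(1) by (simp add: orthogonal_transformation_def)
    have T_meas[measurable]: "T \<in> borel_measurable borel"
      by (rule orthogonal_transformation_borel_measurable[OF T(1)])
    have iso: "dist (T u) (T w) = dist u w" for u w
      by (rule dist_orthogonal_transformation[OF T(1)])
    have "distr ?N borel T = ?N"
    proof (rule distr_distr_equivariant)
      show "T (residual B z) = residual B (T z)" for z
        using residual_transform[OF T(1), of B z] by (simp add: TB)
    qed (use unif_sphere_invariant[OF T(1)] in \<open>auto simp: borel_unif_sphere\<close>)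
    moreover have "distr ?M borel T = ?M"
    proof -
      obtain s where s: "orthogonal_transformation s" "\<And>u. r (s u) = u" "\<And>u. s (r u) = u"
        using orthogonal_transformation_inv[OF r] orthogonal_transformation_bij[OF r]
        by (metis bij_inv_eq_iff)
      define A where "A \<eta> = upper (s (T (r (E \<eta>))))" for \<eta>
      have EA: "E (A \<eta>) = s (T (r (E \<eta>)))" for \<eta>
      proof -
        have "lower (s (T (r (E \<eta>)))) $ b = 0" for b
        proof -
          have "axis (Inr b) 1 \<bullet> s (T (r (E \<eta>))) = B b \<bullet> T (r (E \<eta>))"
            using s(2) by (metis B r_inner)
          also have "\<dots> = T (B b) \<bullet> T (r (E \<eta>))" by (simp add: TB)
          also have "\<dots> = 0" unfolding T_inner B r_inner by (rule E_axis)
          finally show ?thesis by (simp add: inner_axis' lower_def)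
        qed
        then show ?thesis
          by (auto simp: A_def E_def emb_upper_def upper_def lower_def vec_eq_iff split: sum.splits)
      qed
      have "linear E" by (rule linearI) (auto simp: E_def emb_upper_def vec_eq_iff split: sum.splits)
      moreover have "linear upper" by (rule linearI) (auto simp: upper_def vec_eq_iff)
      moreover have "linear T" "linear r" "linear s"
        using T(1) r s(1) by (simp_all add: orthogonal_transformation_linear)
      ultimately have "linear (upper \<circ> (s \<circ> (T \<circ> (r \<circ> E))))"
        by (intro linear_compose)
      then have "linear A" by (simp add: A_def[abs_def] comp_def)
      moreover have "A u \<bullet> A w = u \<bullet> w" for u w
      proof -
        have "A u \<bullet> A w = s (T (r (E u))) \<bullet> s (T (r (E w)))" by (metis EA E_inner)
        also have "\<dots> = u \<bullet> w" using s(1) by (simp add: orthogonal_transformation_def T_inner r_inner E_inner)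
        finally show ?thesis .
      qed
      ultimately have A: "orthogonal_transformation A" by (simp add: orthogonal_transformation_def)
      show ?thesis
      proof (rule distr_distr_equivariant)
        show "T (r (E \<eta>)) = r (E (A \<eta>))" for \<eta> by (simp add: EA s(2))
      qed (use unif_sphere_invariant[OF A] in \<open>auto simp: borel_unif_sphere\<close>)
    qed
    ultimately show "\<exists>T. T \<in> borel_measurable borel \<and> (\<forall>u w. dist (T u) (T w) = dist u w) \<and> T x = y \<and>
        distr ?M borel T = ?M \<and> distr ?N borel T = ?N"
      using T_meas iso Txy by blast
  qed auto
  then show ?thesis by (simp add: r_def E_def B_def[abs_def])
qed

section \<open>The law of a column and a point of a random frame\<close>

lemma two_le_dim: "2 \<le> DIM(real ^ ('p::finite + 'q::finite))"
proof -
  have "0 < CARD('p)" "0 < CARD('q)" by simp_all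
  then have "2 \<le> CARD('p) + CARD('q)" by linarith
  then show ?thesis by simp
qed

text \<open>
The invariant measure on frames, regarded as a Borel measure on all matrices.
\<close>

locale frame_measure = prob_space \<nu> for \<nu> :: "(real ^ 'q ^ ('p::finite + 'q::finite)) measure" +
  assumes sets_frame [measurable_cong]: "sets \<nu> = sets borel"
    and AE_stiefel: "AE v in \<nu>. v \<in> stiefel"
    and invariant: "orthogonal_matrix U \<Longrightarrow> distr \<nu> \<nu> ((**) U) = \<nu>"
begin

sublocale sphere: prob_space "unif_sphere :: (real ^ ('p + 'q)) measure"
  by (rule prob_space_unif_sphere)

sublocale fibre: prob_space "unif_sphere :: (real ^ 'q) measure"
  by (rule prob_space_unif_sphere)

lemma left_mult_measurable: "(**) (U :: real ^ ('p + 'q) ^ ('p + 'q)) \<in> \<nu> \<rightarrow>\<^sub>M \<nu>"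
  unfolding measurable_cong_sets[OF sets_frame sets_frame] by (rule matrix_mult_measurable)

lemma frame_point_position:
  fixes v :: "real ^ 'q ^ ('p + 'q)"
  assumes v: "v \<in> stiefel" and \<zeta>: "norm \<zeta> = 1" and z: "norm (residual (\<lambda>b. column b v) z) = 1"
  shows "norm (frame_point t v \<zeta> z) = 1" "column c v \<bullet> frame_point t v \<zeta> z = sin t * \<zeta> $ c"
proof -
  let ?r = "residual (\<lambda>b. column b v) z"
  have c: "column c v \<bullet> ?r = 0" for c
    by (rule inner_residual_family[OF stiefel_orthonormal[OF v]])
  have 0: "(v *v \<zeta>) \<bullet> ?r = 0"
    by (simp add: matrix_mult_sum scalar_mult_eq_scaleR inner_sum_left c)
  then have orth': "?r \<bullet> (v *v \<zeta>) = 0" by (simp only: inner_commute)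
  have r: "?r \<bullet> ?r = 1" and "\<zeta> \<bullet> \<zeta> = 1" using z \<zeta> by (simp_all add: norm_eq_1)
  then have "frame_point t v \<zeta> z \<bullet> frame_point t v \<zeta> z = cos t * cos t + sin t * sin t"
    using 0 orth' unfolding frame_point_def
    by (simp add: inner_add_left inner_add_right stiefel_mult_inner(1)[OF v])
  then show "norm (frame_point t v \<zeta> z) = 1" by (simp add: norm_eq_1)
  show "column c v \<bullet> frame_point t v \<zeta> z = sin t * \<zeta> $ c"
    unfolding frame_point_def by (simp add: inner_add_right c stiefel_mult_inner(2)[OF v])
qed

lemma AE_residual_frame:
  fixes v :: "real ^ 'q ^ ('p + 'q)"
  assumes "v \<in> stiefel"
  shows "AE z in unif_sphere. norm (residual (\<lambda>b. column b v) z) = 1"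
proof -
  obtain y where "y \<noteq> 0" "\<And>b. column b v \<bullet> y = 0" using frame_has_normal[OF assms] by blast
  then show ?thesis using AE_residual[of "\<lambda>b. column b v" y] by (auto elim!: eventually_mono)
qed

lemma frame_point_law:
  "distr (((unif_sphere :: (real^'q) measure) \<Otimes>\<^sub>M \<nu>) \<Otimes>\<^sub>M unif_sphere) borel
      (\<lambda>p. frame_point t (snd (fst p)) (fst (fst p)) (snd p)) = unif_sphere"
proof -
  let ?A = "(unif_sphere :: (real^'q) measure) \<Otimes>\<^sub>M \<nu>"
  let ?P = "?A \<Otimes>\<^sub>M (unif_sphere :: (real ^ ('p + 'q)) measure)"
  let ?X = "\<lambda>p. frame_point t (snd (fst p)) (fst (fst p)) (snd p) :: real ^ ('p + 'q)"
  interpret A: pair_prob_space "unif_sphere :: (real ^ 'q) measure" \<nu> by standard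
  interpret B: pair_prob_space ?A "unif_sphere :: (real ^ ('p + 'q)) measure" by standard
  have X[measurable]: "?X \<in> borel_measurable ?P" by measurable
  have [measurable]: "sphere 0 1 \<in> sets (borel :: (real ^ ('p + 'q)) measure)"
    by (simp add: borel_closed)
  show ?thesis
  proof (rule invariant_prob_space_unique[of _ _ "sphere 0 1"])
    show "prob_space (distr ?P borel ?X)"
      by (rule B.prob_space_distr) measurable
    show "AE x in distr ?P borel ?X. x \<in> sphere 0 1"
    proof (subst AE_distr_iff)
      have "AE a in ?A. norm (fst a) = 1 \<and> snd a \<in> stiefel"
      proof (rule A.AE_pair_measure)
        show "AE \<zeta> in unif_sphere. AE v in \<nu>. norm (fst (\<zeta>, v)) = 1 \<and> snd (\<zeta>, v) \<in> stiefel"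
          using AE_unif_sphere
        proof eventually_elim
          case (elim \<zeta>)
          from AE_stiefel show ?case by eventually_elim (use elim in simp)
        qed
      qed measurable
      then have "AE a in ?A. AE z in unif_sphere. ?X (a, z) \<in> sphere 0 1"
      proof eventually_elim
        case (elim a)
        then show ?case
          using AE_residual_frame[of "snd a"] frame_point_position(1)[of "snd a" "fst a" _ t]
          by (auto simp: case_prod_beta elim!: eventually_mono)
      qed
      then show "AE p in ?P. ?X p \<in> sphere 0 1"
        by (intro B.AE_pair_measure) measurable
    qed measurable
    fix x y :: "real ^ ('p + 'q)" assume xy: "x \<in> sphere 0 1" "y \<in> sphere 0 1"
    then have "norm x = norm y" by simp
    then obtain T where T: "orthogonal_transformation T" "T x = y"
      using orthogonal_transformation_exists by blast
    define U where "U = matrix T"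
    have TU: "T = (*v) U" and U: "orthogonal_matrix U"
      using T(1) by (auto simp: U_def orthogonal_transformation_matrix matrix_vector_mul_linear)
    have "distr (distr ?P borel ?X) borel T = distr ?P borel ?X"
    proof (rule distr_distr_equivariant[OF X])
      let ?S = "\<lambda>(a, z). ((\<lambda>(\<zeta>, v). (\<zeta>, U ** v)) a, T z)"
      note T_inv = unif_sphere_invariant[OF T(1)]
      show "T \<in> borel_measurable borel" by (rule orthogonal_transformation_borel_measurable[OF T(1)])
      have m: "(\<lambda>(\<zeta>, v). (\<zeta>, U ** v)) \<in> ?A \<rightarrow>\<^sub>M ?A"
        using left_mult_measurable[of U] by measurable
      show "?S \<in> ?P \<rightarrow>\<^sub>M ?P"
        using m T_inv(1) by measurable
      have inv: "distr ?A ?A (\<lambda>(\<zeta>, v). (\<zeta>, U ** v)) = ?A"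
        using distr_pair_invariant[OF sigma_finite_measure_axioms, of "\<lambda>\<zeta>. \<zeta>" unif_sphere "(**) U"]
          invariant[OF U] left_mult_measurable[of U] by (simp add: distr_id2)
      show "distr ?P ?P ?S = ?P"
        by (rule distr_pair_invariant[OF sphere.sigma_finite_measure_axioms m inv T_inv])
      show "T (?X p) = ?X (?S p)" if "p \<in> space ?P" for p
        by (simp add: case_prod_beta TU frame_point_transform[OF U])
    qed
    then show "\<exists>T. T \<in> borel_measurable borel \<and> (\<forall>u w. dist (T u) (T w) = dist u w) \<and> T x = y \<and>
        distr (distr ?P borel ?X) borel T = distr ?P borel ?X \<and> distr unif_sphere borel T = unif_sphere"
      using T distr_unif_sphere[OF T(1)] orthogonal_transformation_borel_measurable[OF T(1)]
        dist_orthogonal_transformation[OF T(1)] by blast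
  qed (simp_all only: sets_distr sets_unif_sphere AE_unif_sphere prob_space_unif_sphere)
qed

text \<open>
The disintegration behind the adjoint formula. For a fixed normal coordinate vector \<open>\<zeta>\<close> the inner product of the column
\<open>c\<close> with the point is the constant \<open>\<tau> = sin t * \<zeta> $ c\<close>. Hence both sides are orthogonally invariant
laws on pairs of unit vectors with inner product \<open>\<tau>\<close>, a single orbit. On the right-hand side the point is
uniform and the column is, given the point \<open>x\<close>, uniformly distributed over the admissible directions.
\<close>

lemma column_frame_point_law:
  fixes t :: real and \<zeta> :: "real ^ 'q" and c :: 'q
  assumes \<zeta>: "norm \<zeta> = 1"
  defines "\<tau> \<equiv> sin t * \<zeta> $ c"
  shows "distr (\<nu> \<Otimes>\<^sub>M unif_sphere) borel (\<lambda>(v, z). (column c v, frame_point t v \<zeta> z)) =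
    distr (unif_sphere \<Otimes>\<^sub>M unif_sphere) borel (\<lambda>(x, w). (\<tau> *\<^sub>R x + sqrt (1 - \<tau>\<^sup>2) *\<^sub>R perp x w, x))"
proof -
  let ?P = "\<nu> \<Otimes>\<^sub>M (unif_sphere :: (real ^ ('p + 'q)) measure)"
  let ?Q = "unif_sphere \<Otimes>\<^sub>M (unif_sphere :: (real ^ ('p + 'q)) measure)"
  let ?X = "\<lambda>(v, z). (column c v, frame_point t v \<zeta> z) :: (real ^ ('p + 'q)) \<times> (real ^ ('p + 'q))"
  let ?Y = "\<lambda>(x, w). (\<tau> *\<^sub>R x + sqrt (1 - \<tau>\<^sup>2) *\<^sub>R perp x w, x) :: (real ^ ('p + 'q)) \<times> (real ^ ('p + 'q))"
  define Z where "Z = {p :: (real ^ ('p + 'q)) \<times> (real ^ ('p + 'q)). norm (fst p) = 1 \<and> norm (snd p) = 1 \<and> fst p \<bullet> snd p = \<tau>}"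
  interpret P: pair_prob_space \<nu> "unif_sphere :: (real ^ ('p + 'q)) measure" by standard
  interpret Q: pair_prob_space "unif_sphere :: (real ^ ('p + 'q)) measure" "unif_sphere :: (real ^ ('p + 'q)) measure"
    by standard
  have "closed Z" unfolding Z_def by (intro closed_Collect_conj closed_Collect_eq continuous_intros)
  then have [measurable]: "Z \<in> sets borel" by simp
  have X[measurable]: "?X \<in> borel_measurable ?P" unfolding case_prod_beta by measurable
  have [measurable]: "(\<lambda>p. perp (fst p) (snd p)) \<in> borel_measurable ?Q"
    by (rule residual_measurable) measurable
  have Y[measurable]: "?Y \<in> borel_measurable ?Q"
    unfolding case_prod_beta by measurable
  have \<tau>: "\<tau>\<^sup>2 \<le> 1"
  proof -
    have "\<bar>\<zeta> $ c\<bar> \<le> 1" using component_le_norm_cart[of \<zeta> c] \<zeta> by simp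
    then have "\<bar>\<tau>\<bar> \<le> 1" unfolding \<tau>_def abs_mult by (intro mult_le_one) auto
    then show ?thesis by (simp add: abs_square_le_1)
  qed
  show ?thesis
  proof (rule invariant_prob_space_unique[of _ _ Z])
    show "prob_space (distr ?P borel ?X)" by (rule P.prob_space_distr) measurable
    show "prob_space (distr ?Q borel ?Y)" by (rule Q.prob_space_distr) measurable
    show "AE p in distr ?P borel ?X. p \<in> Z"
    proof (subst AE_distr_iff)
      have "AE v in \<nu>. AE z in unif_sphere. ?X (v, z) \<in> Z"
        using AE_stiefel
      proof eventually_elim
        case (elim v)
        have "norm (column c v) = 1" using elim by (simp add: stiefel_iff norm_eq_1)
        then show ?case
          using AE_residual_frame[OF elim] frame_point_position[OF elim \<zeta>]
          by (auto simp: Z_def \<tau>_def elim!: eventually_mono)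
      qed
      then show "AE p in ?P. ?X p \<in> Z" by (intro P.AE_pair_measure) measurable
    qed measurable
    show "AE p in distr ?Q borel ?Y. p \<in> Z"
    proof (subst AE_distr_iff)
      have "AE x in unif_sphere. AE w in unif_sphere. ?Y (x, w) \<in> Z"
        using AE_unif_sphere
      proof eventually_elim
        case (elim x)
        then have xx: "x \<bullet> x = 1" by (simp add: norm_eq_1)
        obtain y where y: "x \<bullet> y = 0" "y \<noteq> 0"
        proof (rule orthogonal_to_vector_exists[of x])
          show "2 \<le> DIM(real ^ ('p + 'q))" by (rule two_le_dim)
        qed (auto simp: orthogonal_def intro: that)
        have perp0: "x \<bullet> perp x w = 0" for w
          using inner_residual_family[of "\<lambda>_::unit. x" "()" w] xx by (simp add: orthonormal_family_def)
        have "AE w in unif_sphere. norm (perp x w) = 1"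
          using AE_residual[of "\<lambda>_::unit. x" y] y by auto
        then show ?case
        proof eventually_elim
          case (elim w)
          have pp: "perp x w \<bullet> perp x w = 1" using elim by (simp add: norm_eq_1)
          have "(\<tau> *\<^sub>R x + sqrt (1 - \<tau>\<^sup>2) *\<^sub>R perp x w) \<bullet> (\<tau> *\<^sub>R x + sqrt (1 - \<tau>\<^sup>2) *\<^sub>R perp x w) =
              \<tau> * \<tau> + sqrt (1 - \<tau>\<^sup>2) * sqrt (1 - \<tau>\<^sup>2)"
            by (simp add: inner_add_left inner_add_right xx pp perp0 inner_commute[of "perp x w" x])
          also have "\<dots> = 1" using \<tau> by (simp add: power2_eq_square)
          finally show ?case
            using xx by (simp add: Z_def norm_eq_1 inner_add_left perp0 inner_commute[of "perp x w" x])
        qed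
      qed
      then show "AE p in ?Q. ?Y p \<in> Z" by (intro Q.AE_pair_measure) measurable
    qed measurable
    fix p p' assume p: "p \<in> Z" "p' \<in> Z"
    obtain T where T: "orthogonal_transformation T" "T (fst p) = fst p'" "T (snd p) = snd p'"
      by (rule orthogonal_transformation_of_pair[of "fst p" "fst p'" "snd p" "snd p'"])
         (use p in \<open>auto simp: Z_def norm_eq_1\<close>)
    define U where "U = matrix T"
    have TU: "T = (*v) U" and U: "orthogonal_matrix U"
      using T(1) by (auto simp: U_def orthogonal_transformation_matrix matrix_vector_mul_linear)
    note T_inv = unif_sphere_invariant[OF T(1)]
    have T_meas[measurable]: "T \<in> borel_measurable borel"
      by (rule orthogonal_transformation_borel_measurable[OF T(1)])
    define T2 where "T2 p = (T (fst p), T (snd p))" for p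
    have T2[measurable]: "T2 \<in> borel_measurable borel"
    proof -
      have "T2 \<in> borel \<Otimes>\<^sub>M borel \<rightarrow>\<^sub>M borel" unfolding T2_def[abs_def] by measurable
      then show ?thesis by (simp add: borel_prod)
    qed
    have iso: "dist (T2 u) (T2 w) = dist u w" for u w
      by (simp add: T2_def dist_prod_def dist_orthogonal_transformation[OF T(1)])
    have invP: "distr (distr ?P borel ?X) borel T2 = distr ?P borel ?X"
    proof (rule distr_distr_equivariant[OF X T2])
      show "(\<lambda>(v, z). (U ** v, T z)) \<in> ?P \<rightarrow>\<^sub>M ?P"
        using left_mult_measurable[of U] T_inv(1) by measurable
      show "distr ?P ?P (\<lambda>(v, z). (U ** v, T z)) = ?P"
        by (rule distr_pair_invariant[OF sphere.sigma_finite_measure_axioms left_mult_measurable invariant[OF U] T_inv])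
      show "T2 (?X p) = ?X ((\<lambda>(v, z). (U ** v, T z)) p)" for p
        by (simp add: case_prod_beta T2_def TU frame_point_transform[OF U] column_matrix_mult)
    qed
    have invQ: "distr (distr ?Q borel ?Y) borel T2 = distr ?Q borel ?Y"
    proof (rule distr_distr_equivariant[OF Y T2])
      show "(\<lambda>(x, w). (T x, T w)) \<in> ?Q \<rightarrow>\<^sub>M ?Q"
        using T_inv(1) by measurable
      show "distr ?Q ?Q (\<lambda>(x, w). (T x, T w)) = ?Q"
        by (rule distr_pair_invariant[OF sphere.sigma_finite_measure_axioms T_inv T_inv])
      have lin: "linear T" using T(1) by (rule orthogonal_transformation_linear)
      show "T2 (?Y p) = ?Y ((\<lambda>(x, w). (T x, T w)) p)" for p
        by (simp add: case_prod_beta T2_def linear_add[OF lin] linear_scale[OF lin] residual_transform[OF T(1)])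
    qed
    have "T2 p = p'" using T by (simp add: T2_def)
    then show "\<exists>T. T \<in> borel_measurable borel \<and> (\<forall>u w. dist (T u) (T w) = dist u w) \<and> T p = p' \<and>
        distr (distr ?P borel ?X) borel T = distr ?P borel ?X \<and> distr (distr ?Q borel ?Y) borel T = distr ?Q borel ?Y"
      using T2 iso invP invQ by blast
  qed auto
qed

end

section \<open>The adjoint transform on powers of a column coordinate\<close>

context frame_measure
begin

text \<open>
The truncation in \<open>pw\<close> changes nothing on unit vectors; it makes the test function bounded, so that
all integrals converge for an arbitrary integrable \<open>f\<close>. For fixed \<open>\<zeta>\<close> the law of the pair
(column, point) reduces the left-hand side to the average of
\<open>(\<tau> s + sqrt (1 - \<tau>\<^sup>2) (perp x w \<bullet> y))\<^bsup>2 j\<^esup>\<close> over \<open>w\<close>, with \<open>s = x \<bullet> y\<close>; expanding this binomially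
leaves the even moments of \<open>perp x w\<close>.
\<close>

lemma adjoint_on_zonal_power:
  fixes f :: "real ^ ('p + 'q) \<Rightarrow> real" and c :: 'q and t :: real and j :: nat
  assumes f[measurable]: "f \<in> borel_measurable borel" and f_int: "integrable unif_sphere f"
    and y: "norm y = 1"
  defines "pw \<equiv> \<lambda>u::real. if \<bar>u\<bar> \<le> 1 then u ^ (2 * j) else 0"
  shows "(\<integral>v. pw (column c v \<bullet> y) * (\<integral>\<zeta>. (\<integral>z. f (frame_point t v \<zeta> z) \<partial>unif_sphere) \<partial>unif_sphere) \<partial>\<nu>) =
    (\<Sum>h\<le>j. real (2 * j choose (2 * h)) * perp_moment TYPE(real ^ ('p + 'q)) h *
       (\<integral>\<zeta>. (1 - (sin t * \<zeta> $ c)\<^sup>2) ^ h * (sin t * \<zeta> $ c) ^ (2 * (j - h)) \<partial>unif_sphere) *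
       (\<integral>x. f x * ((1 - (x \<bullet> y)\<^sup>2) ^ h * (x \<bullet> y) ^ (2 * (j - h))) \<partial>unif_sphere))"
proof -
  let ?S = "unif_sphere :: (real ^ ('p + 'q)) measure"
  let ?F = "unif_sphere :: (real ^ 'q) measure"
  let ?\<kappa> = "perp_moment TYPE(real ^ ('p + 'q))"
  let ?A = "?F \<Otimes>\<^sub>M \<nu>"
  let ?P = "?A \<Otimes>\<^sub>M ?S"
  interpret A: pair_prob_space ?F \<nu> by standard
  interpret B: pair_prob_space ?A ?S by standard
  interpret V: pair_prob_space \<nu> ?S by standard
  interpret Q: pair_prob_space ?S ?S by standard
  have pw[measurable]: "pw \<in> borel_measurable borel" unfolding pw_def by measurable
  have pw_bd: "\<bar>pw u\<bar> \<le> 1" for u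
  proof (cases "\<bar>u\<bar> \<le> 1")
    case True
    then have "\<bar>u\<bar> ^ (2 * j) \<le> 1" by (intro power_le_one) auto
    then show ?thesis unfolding pw_def if_P[OF True] power_abs .
  qed (simp add: pw_def)
  have pw_f: "norm (pw u * f x) \<le> norm (f x)" for u x
    using mult_right_mono[OF pw_bd[of u], of "\<bar>f x\<bar>"] by (simp add: abs_mult)
  define K where "K = (\<lambda>p. pw (column c (snd (fst p)) \<bullet> y) * f (frame_point t (snd (fst p)) (fst (fst p)) (snd p)))"
  define \<Phi> where "\<Phi> \<zeta> v = (\<integral>z. K ((\<zeta>, v), z) \<partial>?S)" for \<zeta> v
  have K[measurable]: "K \<in> borel_measurable ?P" unfolding K_def by measurable
  have "integrable (distr ?P borel (\<lambda>p. frame_point t (snd (fst p)) (fst (fst p)) (snd p))) f"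
    unfolding frame_point_law by (rule f_int)
  then have "integrable ?P (\<lambda>p. f (frame_point t (snd (fst p)) (fst (fst p)) (snd p)))"
    by (subst (asm) integrable_distr_eq) measurable
  then have K_int: "integrable ?P K"
    by (rule Bochner_Integration.integrable_bound[OF _ K]) (rule AE_I2, simp only: K_def pw_f)
  have \<Phi>_int: "integrable ?A (\<lambda>(\<zeta>, v). \<Phi> \<zeta> v)"
    using B.integrable_fst'[OF K_int] by (simp add: \<Phi>_def case_prod_unfold)
  have fst_int: "integrable (?S \<Otimes>\<^sub>M ?S) (\<lambda>p. f (fst p))"
    using f_int integrable_distr_eq[of fst "?S \<Otimes>\<^sub>M ?S" ?S f]
    by (simp add: sphere.distr_pair_fst borel_unif_sphere)
  define \<tau> where "\<tau> \<zeta> = sin t * \<zeta> $ c" for \<zeta> :: "real ^ 'q"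
  have \<tau>_meas[measurable]: "\<tau> \<in> borel_measurable borel"
    unfolding \<tau>_def by (intro borel_measurable_continuous_onI continuous_intros)
  define I where "I h = (\<integral>x. f x * ((1 - (x \<bullet> y)\<^sup>2) ^ h * (x \<bullet> y) ^ (2 * (j - h))) \<partial>?S)" for h
  define b where "b h s = real (2 * j choose (2 * h)) * ?\<kappa> h * ((1 - s\<^sup>2) ^ h * s ^ (2 * (j - h)))" for h s
  have g_int: "integrable ?S (\<lambda>x. f x * ((1 - (x \<bullet> y)\<^sup>2) ^ h * (x \<bullet> y) ^ (2 * (j - h))))" for h
  proof (rule Bochner_Integration.integrable_bound[OF f_int])
    show "AE x in ?S. norm (f x * ((1 - (x \<bullet> y)\<^sup>2) ^ h * (x \<bullet> y) ^ (2 * (j - h)))) \<le> norm (f x)"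
      using AE_unif_sphere
    proof eventually_elim
      case (elim x)
      then have s: "\<bar>x \<bullet> y\<bar> \<le> 1" using abs_inner_sphere_le[of x y] y by simp
      then have "(x \<bullet> y)\<^sup>2 \<le> 1" by (simp add: abs_square_le_1)
      then have "\<bar>(1 - (x \<bullet> y)\<^sup>2) ^ h * (x \<bullet> y) ^ (2 * (j - h))\<bar> \<le> 1"
        using s unfolding abs_mult power_abs by (intro mult_le_one power_le_one) auto
      then show ?case
        using mult_left_mono[of "\<bar>(1 - (x \<bullet> y)\<^sup>2) ^ h * (x \<bullet> y) ^ (2 * (j - h))\<bar>" 1 "\<bar>f x\<bar>"]
        by (simp add: abs_mult)
    qed
  qed measurable
  have inner_pw: "(\<integral>w. pw ((s *\<^sub>R x + sqrt (1 - s\<^sup>2) *\<^sub>R perp x w) \<bullet> y) \<partial>?S) =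
      (\<Sum>h\<le>j. b h s * ((1 - (x \<bullet> y)\<^sup>2) ^ h * (x \<bullet> y) ^ (2 * (j - h))))"
    if x: "norm x = 1" and s: "s\<^sup>2 \<le> 1" for x s
  proof -
    have xx: "x \<bullet> x = 1" using x by (simp add: norm_eq_1)
    have perp_meas[measurable]: "perp x \<in> borel_measurable borel"
      using residual_measurable[of "\<lambda>(_::unit) _. x" borel "\<lambda>w. w", OF measurable_const measurable_ident_sets] by simp
    have perp0: "x \<bullet> perp x w = 0" for w
      using inner_residual_family[of "\<lambda>_::unit. x" "()" w] xx by (simp add: orthonormal_family_def)
    have bd: "\<bar>(s *\<^sub>R x + sqrt (1 - s\<^sup>2) *\<^sub>R perp x w) \<bullet> y\<bar> \<le> 1" for w
    proof -
      have "perp x w \<bullet> perp x w \<le> 1"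
        using norm_residual_le[of "\<lambda>_::unit. x" w] by (simp add: power2_norm_eq_inner[symmetric] power_le_one)
      then have "(1 - s\<^sup>2) * (perp x w \<bullet> perp x w) \<le> (1 - s\<^sup>2) * 1"
        using s by (intro mult_left_mono) auto
      moreover have "(s *\<^sub>R x + sqrt (1 - s\<^sup>2) *\<^sub>R perp x w) \<bullet> (s *\<^sub>R x + sqrt (1 - s\<^sup>2) *\<^sub>R perp x w)
          = s\<^sup>2 + (1 - s\<^sup>2) * (perp x w \<bullet> perp x w)"
        using s xx perp0[of w]
        by (simp add: inner_add_left inner_add_right inner_commute[of "perp x w" x] power2_eq_square
            mult.assoc[symmetric])
      ultimately have "(norm (s *\<^sub>R x + sqrt (1 - s\<^sup>2) *\<^sub>R perp x w))\<^sup>2 \<le> 1\<^sup>2"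
        unfolding power2_norm_eq_inner by simp
      then have "norm (s *\<^sub>R x + sqrt (1 - s\<^sup>2) *\<^sub>R perp x w) \<le> 1"
        by (rule power2_le_imp_le) simp
      then show ?thesis
        using Cauchy_Schwarz_ineq2[of "s *\<^sub>R x + sqrt (1 - s\<^sup>2) *\<^sub>R perp x w" y] y by simp
    qed
    have p_int: "integrable ?S (\<lambda>w. (perp x w \<bullet> y) ^ i)" for i
    proof (rule integrable_unif_sphere)
      fix w
      have "\<bar>perp x w \<bullet> y\<bar> \<le> 1"
        using Cauchy_Schwarz_ineq2[of "perp x w" y] norm_residual_le[of "\<lambda>_::unit. x" w] y by simp
      then show "norm ((perp x w \<bullet> y) ^ i) \<le> 1" unfolding real_norm_def power_abs by (intro power_le_one) auto
    qed measurable
    define d where "d i = real (2 * j choose i) * sqrt (1 - s\<^sup>2) ^ i * (s * (x \<bullet> y)) ^ (2 * j - i)" for i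
    have "pw ((s *\<^sub>R x + sqrt (1 - s\<^sup>2) *\<^sub>R perp x w) \<bullet> y) = (\<Sum>i\<le>2*j. d i * (perp x w \<bullet> y) ^ i)" for w
    proof -
      have "pw ((s *\<^sub>R x + sqrt (1 - s\<^sup>2) *\<^sub>R perp x w) \<bullet> y) =
          (sqrt (1 - s\<^sup>2) * (perp x w \<bullet> y) + s * (x \<bullet> y)) ^ (2 * j)"
        using bd[of w] by (simp add: pw_def inner_add_left add.commute)
      then show ?thesis
        unfolding binomial_ring d_def by (simp add: power_mult_distrib mult_ac)
    qed
    then have "(\<integral>w. pw ((s *\<^sub>R x + sqrt (1 - s\<^sup>2) *\<^sub>R perp x w) \<bullet> y) \<partial>?S) =
        (\<Sum>i\<le>2*j. d i * (\<integral>w. (perp x w \<bullet> y) ^ i \<partial>?S))"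
      by (simp add: p_int)
    also have "\<dots> = (\<Sum>h\<le>j. d (2 * h) * (\<integral>w. (perp x w \<bullet> y) ^ (2 * h) \<partial>?S))"
      by (rule sum_even_only) (simp add: integral_perp_odd[OF two_le_dim x y])
    also have "\<dots> = (\<Sum>h\<le>j. b h s * ((1 - (x \<bullet> y)\<^sup>2) ^ h * (x \<bullet> y) ^ (2 * (j - h))))"
    proof (rule sum.cong[OF refl])
      fix h
      have "sqrt (1 - s\<^sup>2) ^ (2 * h) = (1 - s\<^sup>2) ^ h" using s by (simp add: power_mult)
      moreover have "2 * j - 2 * h = 2 * (j - h)" by simp
      ultimately show "d (2 * h) * (\<integral>w. (perp x w \<bullet> y) ^ (2 * h) \<partial>?S) =
          b h s * ((1 - (x \<bullet> y)\<^sup>2) ^ h * (x \<bullet> y) ^ (2 * (j - h)))"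
        unfolding integral_perp_even[OF two_le_dim x y] d_def b_def by (simp add: power_mult_distrib mult_ac)
    qed
    finally show ?thesis .
  qed
  have fibre_value: "(\<integral>v. \<Phi> \<zeta> v \<partial>\<nu>) = (\<Sum>h\<le>j. b h (\<tau> \<zeta>) * I h)" if \<zeta>: "norm \<zeta> = 1" for \<zeta>
  proof -
    let ?X = "\<lambda>(v, z). (column c v, frame_point t v \<zeta> z)"
    let ?Y = "\<lambda>(x, w). (\<tau> \<zeta> *\<^sub>R x + sqrt (1 - (\<tau> \<zeta>)\<^sup>2) *\<^sub>R perp x w, x)"
    let ?g = "\<lambda>p. pw (fst p \<bullet> y) * f (snd p)"
    have \<tau>1: "(\<tau> \<zeta>)\<^sup>2 \<le> 1"
    proof -
      have "\<bar>\<zeta> $ c\<bar> \<le> 1" using component_le_norm_cart[of \<zeta> c] \<zeta> by simp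
      then have "\<bar>\<tau> \<zeta>\<bar> \<le> 1" unfolding \<tau>_def abs_mult by (intro mult_le_one) auto
      then show ?thesis by (simp add: abs_square_le_1)
    qed
    have law: "distr (\<nu> \<Otimes>\<^sub>M ?S) borel ?X = distr (?S \<Otimes>\<^sub>M ?S) borel ?Y"
      unfolding \<tau>_def by (rule column_frame_point_law[OF \<zeta>])
    have [measurable]: "(\<lambda>p. perp (fst p) (snd p)) \<in> borel_measurable (?S \<Otimes>\<^sub>M ?S)"
      by (rule residual_measurable) measurable
    have X[measurable]: "?X \<in> borel_measurable (\<nu> \<Otimes>\<^sub>M ?S)" unfolding case_prod_beta by measurable
    have Y[measurable]: "?Y \<in> borel_measurable (?S \<Otimes>\<^sub>M ?S)" unfolding case_prod_beta by measurable
    have g: "?g \<in> borel_measurable borel"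
    proof -
      have "?g \<in> borel_measurable (borel \<Otimes>\<^sub>M borel)" by measurable
      then show ?thesis by (simp add: borel_prod)
    qed
    have Yg_int: "integrable (?S \<Otimes>\<^sub>M ?S) (\<lambda>p. ?g (?Y p))"
    proof (rule Bochner_Integration.integrable_bound[OF fst_int])
      show "(\<lambda>p. ?g (?Y p)) \<in> borel_measurable (?S \<Otimes>\<^sub>M ?S)"
        by (rule measurable_compose[OF Y g])
      show "AE p in ?S \<Otimes>\<^sub>M ?S. norm (?g (?Y p)) \<le> norm (f (fst p))"
        by (rule AE_I2) (simp add: case_prod_beta pw_f del: real_norm_def)
    qed
    then have Xg_int: "integrable (\<nu> \<Otimes>\<^sub>M ?S) (\<lambda>p. ?g (?X p))"
      using law integrable_distr_eq[OF X g] integrable_distr_eq[OF Y g] by simp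
    have "(\<integral>v. \<Phi> \<zeta> v \<partial>\<nu>) = (\<integral>v. (\<integral>z. ?g (?X (v, z)) \<partial>?S) \<partial>\<nu>)"
      by (simp add: \<Phi>_def K_def)
    also have "\<dots> = (\<integral>p. ?g (?X p) \<partial>(\<nu> \<Otimes>\<^sub>M ?S))" by (rule V.integral_fst'[OF Xg_int])
    also have "\<dots> = (\<integral>p. ?g p \<partial>(distr (\<nu> \<Otimes>\<^sub>M ?S) borel ?X))" by (rule integral_distr[OF X g, symmetric])
    also have "\<dots> = (\<integral>p. ?g (?Y p) \<partial>(?S \<Otimes>\<^sub>M ?S))" unfolding law by (rule integral_distr[OF Y g])
    also have "\<dots> = (\<integral>x. (\<integral>w. ?g (?Y (x, w)) \<partial>?S) \<partial>?S)" by (rule Q.integral_fst'[OF Yg_int, symmetric])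
    also have "\<dots> = (\<integral>x. (\<Sum>h\<le>j. b h (\<tau> \<zeta>) * (f x * ((1 - (x \<bullet> y)\<^sup>2) ^ h * (x \<bullet> y) ^ (2 * (j - h))))) \<partial>?S)"
    proof (rule integral_cong_AE)
      show "(\<lambda>x. \<integral>w. ?g (?Y (x, w)) \<partial>?S) \<in> borel_measurable ?S"
        using Q.integrable_fst'[OF Yg_int] by (rule borel_measurable_integrable)
      show "AE x in ?S. (\<integral>w. ?g (?Y (x, w)) \<partial>?S) =
          (\<Sum>h\<le>j. b h (\<tau> \<zeta>) * (f x * ((1 - (x \<bullet> y)\<^sup>2) ^ h * (x \<bullet> y) ^ (2 * (j - h)))))"
        using AE_unif_sphere
      proof eventually_elim
        case (elim x)
        then have "norm x = 1" by simp
        have "(\<integral>w. ?g (?Y (x, w)) \<partial>?S) = f x * (\<integral>w. pw ((\<tau> \<zeta> *\<^sub>R x + sqrt (1 - (\<tau> \<zeta>)\<^sup>2) *\<^sub>R perp x w) \<bullet> y) \<partial>?S)"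
          by (simp add: mult.commute)
        then show ?case
          unfolding inner_pw[OF \<open>norm x = 1\<close> \<tau>1] by (simp add: sum_distrib_left mult_ac)
      qed
    qed measurable
    also have "\<dots> = (\<Sum>h\<le>j. b h (\<tau> \<zeta>) * I h)"
      unfolding I_def by (subst Bochner_Integration.integral_sum) (use g_int in auto)
    finally show ?thesis .
  qed
  have b_int: "integrable ?F (\<lambda>\<zeta>. (1 - (\<tau> \<zeta>)\<^sup>2) ^ h * \<tau> \<zeta> ^ (2 * (j - h)))" for h
  proof (rule integrable_unif_sphere)
    fix \<zeta> :: "real ^ 'q" assume "norm \<zeta> = 1"
    then have "\<bar>\<zeta> $ c\<bar> \<le> 1" using component_le_norm_cart[of \<zeta> c] by simp
    then have s: "\<bar>\<tau> \<zeta>\<bar> \<le> 1" unfolding \<tau>_def abs_mult by (intro mult_le_one) auto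
    then have "(\<tau> \<zeta>)\<^sup>2 \<le> 1" by (simp add: abs_square_le_1)
    then show "norm ((1 - (\<tau> \<zeta>)\<^sup>2) ^ h * \<tau> \<zeta> ^ (2 * (j - h))) \<le> 1"
      using s unfolding real_norm_def abs_mult power_abs by (intro mult_le_one power_le_one) auto
  qed measurable
  have "(\<integral>v. pw (column c v \<bullet> y) * (\<integral>\<zeta>. (\<integral>z. f (frame_point t v \<zeta> z) \<partial>?S) \<partial>?F) \<partial>\<nu>) =
      (\<integral>v. (\<integral>\<zeta>. \<Phi> \<zeta> v \<partial>?F) \<partial>\<nu>)"
    by (simp add: \<Phi>_def K_def)
  also have "\<dots> = (\<integral>\<zeta>. (\<integral>v. \<Phi> \<zeta> v \<partial>\<nu>) \<partial>?F)"
    by (rule A.Fubini_integral[OF \<Phi>_int])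
  also have "\<dots> = (\<integral>\<zeta>. (\<Sum>h\<le>j. b h (\<tau> \<zeta>) * I h) \<partial>?F)"
  proof (rule integral_cong_AE)
    show "(\<lambda>\<zeta>. \<integral>v. \<Phi> \<zeta> v \<partial>\<nu>) \<in> borel_measurable ?F"
      using A.integrable_fst'[OF \<Phi>_int] by (auto dest: borel_measurable_integrable)
    show "AE \<zeta> in ?F. (\<integral>v. \<Phi> \<zeta> v \<partial>\<nu>) = (\<Sum>h\<le>j. b h (\<tau> \<zeta>) * I h)"
      using AE_unif_sphere by eventually_elim (use fibre_value in auto)
  qed (simp_all add: b_def borel_unif_sphere)
  also have "\<dots> = (\<Sum>h\<le>j. real (2 * j choose (2 * h)) * ?\<kappa> h *
       (\<integral>\<zeta>. (1 - (\<tau> \<zeta>)\<^sup>2) ^ h * \<tau> \<zeta> ^ (2 * (j - h)) \<partial>?F) * I h)"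
    unfolding b_def by (subst Bochner_Integration.integral_sum) (use b_int in auto)
  finally show ?thesis unfolding \<tau>_def I_def .
qed

end

section \<open>Injectivity outside a countable set\<close>

lemma frame_measure_of_invariant:
  fixes \<mu> :: "(real ^ 'q ^ ('p::finite + 'q::finite)) measure"
  assumes "invariant_prob_on_stiefel \<mu>"
  shows "frame_measure (distr \<mu> borel (\<lambda>v. v))" and "(\<lambda>v. v) \<in> \<mu> \<rightarrow>\<^sub>M borel"
    and "space \<mu> = stiefel"
proof -
  let ?\<nu> = "distr \<mu> borel (\<lambda>v. v)"
  have prob: "prob_space \<mu>" and sets: "sets \<mu> = sets (restrict_space borel stiefel)"
    and inv: "\<And>U. orthogonal_matrix U \<Longrightarrow> distr \<mu> \<mu> (\<lambda>v. U ** v) = \<mu>"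
    using assms by (auto simp: invariant_prob_on_stiefel_def)
  show space: "space \<mu> = stiefel"
    using sets_eq_imp_space_eq[OF sets] by (simp add: space_restrict_space)
  show id: "(\<lambda>v. v) \<in> \<mu> \<rightarrow>\<^sub>M borel"
    unfolding measurable_cong_sets[OF sets refl] by (rule measurable_restrict_space1) simp
  have prob_\<nu>: "prob_space ?\<nu>" by (rule prob_space.prob_space_distr[OF prob id])
  interpret prob_space ?\<nu> by (rule prob_\<nu>)
  show "frame_measure ?\<nu>"
  proof
    show "AE v in ?\<nu>. v \<in> stiefel"
      by (subst AE_distr_iff[OF id]) (auto simp: space intro: AE_I2)
    fix U :: "real ^ ('p + 'q) ^ ('p + 'q)" assume U: "orthogonal_matrix U"
    have U_meas: "(**) U \<in> borel_measurable (borel :: (real ^ 'q ^ ('p + 'q)) measure)"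
      by (rule matrix_mult_measurable)
    have "U ** v \<in> stiefel" if "v \<in> stiefel" for v :: "real ^ 'q ^ ('p + 'q)"
      using that orthogonal_matrix_transformation[OF U]
      by (simp add: stiefel_iff column_matrix_mult orthogonal_transformation_def)
    then have U_\<mu>: "(**) U \<in> \<mu> \<rightarrow>\<^sub>M \<mu>"
      unfolding measurable_cong_sets[OF sets sets]
      by (intro measurable_restrict_space2 measurable_restrict_space1 U_meas) (auto simp: space_restrict_space)
    have "distr ?\<nu> ?\<nu> ((**) U) = distr ?\<nu> borel ((**) U)" by (rule distr_cong) auto
    also have "\<dots> = distr \<mu> borel ((**) U)" using distr_distr[OF U_meas id] by (simp add: comp_def)
    also have "\<dots> = distr (distr \<mu> \<mu> ((**) U)) borel (\<lambda>v. v)" using distr_distr[OF id U_\<mu>] by (simp add: comp_def)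
    also have "\<dots> = ?\<nu>" using inv[OF U] by simp
    finally show "distr ?\<nu> ?\<nu> ((**) U) = ?\<nu>" .
  qed simp
qed

lemma norm_frame_rotation:
  fixes v :: "real ^ 'q ^ ('p::finite + 'q::finite)"
  assumes "v \<in> stiefel" "norm \<eta> = 1" "norm \<zeta> = 1"
  shows "norm (frame_rotation v *v (cos t *\<^sub>R emb_upper \<eta> + sin t *\<^sub>R emb_lower \<zeta>)) = 1"
proof -
  have "\<eta> \<bullet> \<eta> = 1" "\<zeta> \<bullet> \<zeta> = 1" using assms by (simp_all add: norm_eq_1)
  moreover have "upper (a + b) = upper a + upper b" "lower (a + b) = lower a + lower b"
    "upper (s *\<^sub>R a) = s *\<^sub>R upper a" "lower (s *\<^sub>R a) = s *\<^sub>R lower a" for a b :: "real ^ ('p + 'q)" and s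
    by (simp_all add: upper_def lower_def vec_eq_iff)
  ultimately have "norm (cos t *\<^sub>R emb_upper \<eta> + sin t *\<^sub>R emb_lower \<zeta> :: real ^ ('p + 'q)) = 1"
    by (simp add: norm_eq_1 inner_upper_lower)
  then show ?thesis
    using orthogonal_matrix_transformation[of "frame_rotation v"] frame_rotation[OF assms(1)]
    by (simp add: orthogonal_transformation_norm)
qed

lemma shifted_funk_radon_cong_sphere:
  fixes v :: "real ^ 'q ^ ('p::finite + 'q::finite)"
  assumes "v \<in> stiefel" and "\<And>x. norm x = 1 \<Longrightarrow> f x = g x"
  shows "shifted_funk_radon t f v = shifted_funk_radon t g v"
  unfolding shifted_funk_radon_def
  by (intro Bochner_Integration.integral_cong refl) (simp add: assms norm_frame_rotation)

lemma shifted_funk_radon_frame_point: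
  fixes v :: "real ^ 'q ^ ('p::finite + 'q::finite)"
  assumes v: "v \<in> stiefel" and f[measurable]: "f \<in> borel_measurable borel"
  shows "shifted_funk_radon t f v = (\<integral>\<zeta>. (\<integral>z. f (frame_point t v \<zeta> z) \<partial>unif_sphere) \<partial>unif_sphere)"
proof -
  let ?E = "\<lambda>\<eta> :: real^'p. frame_rotation v *v emb_upper \<eta>"
  let ?R = "residual (\<lambda>b. column b v)"
  interpret P: prob_space "unif_sphere :: (real ^ 'p) measure" by (rule prob_space_unif_sphere)
  have pt: "frame_rotation v *v (cos t *\<^sub>R emb_upper \<eta> + sin t *\<^sub>R emb_lower \<zeta>) =
      cos t *\<^sub>R ?E \<eta> + sin t *\<^sub>R (v *v \<zeta>)" for \<eta> \<zeta>
    by (simp add: matrix_vector_right_distrib matrix_vector_mult_scaleR frame_rotation_columns(2)[OF v])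
  have E[measurable]: "?E \<in> borel_measurable borel" by measurable
  have R[measurable]: "?R \<in> borel_measurable borel"
    using residual_measurable[of "\<lambda>b _. column b v" borel "\<lambda>z. z", OF measurable_const measurable_ident_sets] by simp
  have inner: "(\<integral>\<eta>. f (cos t *\<^sub>R ?E \<eta> + sin t *\<^sub>R (v *v \<zeta>)) \<partial>sphere_measure) =
      (\<integral>z. f (frame_point t v \<zeta> z) \<partial>unif_sphere)" for \<zeta>
  proof -
    have "(\<integral>\<eta>. f (cos t *\<^sub>R ?E \<eta> + sin t *\<^sub>R (v *v \<zeta>)) \<partial>sphere_measure) =
        (\<integral>\<eta>. f (cos t *\<^sub>R ?E \<eta> + sin t *\<^sub>R (v *v \<zeta>)) \<partial>unif_sphere)"
      by (rule integral_sphere_measure) measurable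
    also have "\<dots> = (\<integral>x. f (cos t *\<^sub>R x + sin t *\<^sub>R (v *v \<zeta>)) \<partial>(distr unif_sphere borel ?E))"
      by (subst integral_distr) (auto simp: borel_unif_sphere)
    also have "\<dots> = (\<integral>z. f (cos t *\<^sub>R ?R z + sin t *\<^sub>R (v *v \<zeta>)) \<partial>unif_sphere)"
      unfolding residual_law[OF v] by (subst integral_distr) (auto simp: borel_unif_sphere)
    finally show ?thesis by (simp add: frame_point_def)
  qed
  interpret S: prob_space "unif_sphere :: (real ^ ('p + 'q)) measure" by (rule prob_space_unif_sphere)
  have "(\<lambda>\<zeta>. \<integral>z. f (frame_point t v \<zeta> z) \<partial>unif_sphere) \<in> borel_measurable borel"
    by (rule S.borel_measurable_lebesgue_integral) measurable
  then show ?thesis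
    unfolding shifted_funk_radon_def pt inner by (rule integral_sphere_measure)
qed

text \<open>
With \<open>s = sin t\<close>, this is the coefficient of \<open>(x \<bullet> y)\<^bsup>2 j\<^esup>\<close> in the polynomial kernel of
\<open>adjoint_on_zonal_power\<close>: each factor \<open>(1 - (x \<bullet> y)\<^sup>2)\<^bsup>h\<^esup>\<close> contributes \<open>(- 1)\<^bsup>h\<^esup>\<close>.
\<close>

definition leading_coeff :: "'p::finite itself \<Rightarrow> 'q::finite \<Rightarrow> nat \<Rightarrow> real \<Rightarrow> real" where
  "leading_coeff _ c j s = (\<Sum>h\<le>j. real (2 * j choose (2 * h)) * perp_moment TYPE(real ^ ('p + 'q)) h *
     (\<integral>\<zeta>. (1 - (s * \<zeta> $ c)\<^sup>2) ^ h * (s * \<zeta> $ c) ^ (2 * (j - h)) \<partial>(unif_sphere :: (real ^ 'q) measure)) * (-1) ^ h)"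

lemma one_minus_square_power:
  "(1 - (s::real)\<^sup>2) ^ h = (\<Sum>l\<le>h. real (h choose l) * (-1) ^ l * s ^ (2 * l))"
  using binomial_ring[of "- (s\<^sup>2)" 1 h] by (simp add: power_minus[of "s\<^sup>2"] power_mult mult.assoc)

text \<open>
As a function of \<open>s\<close> this is a polynomial. At \<open>s = 0\<close> only the term \<open>h = j\<close> survives, which is a
non-zero moment.
\<close>

lemma finite_leading_coeff_zeros:
  fixes c :: "'q::finite"
  shows "finite {s. leading_coeff TYPE('p::finite) c j s = 0}"
proof -
  let ?m = "axial_moment TYPE(real ^ 'q)" and ?\<kappa> = "perp_moment TYPE(real ^ ('p + 'q))"
  define P where "P = (\<Sum>h\<le>j. \<Sum>l\<le>h. monom (real (2 * j choose (2 * h)) * ?\<kappa> h * (-1) ^ h *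
      (real (h choose l) * (-1) ^ l * ?m (2 * l + 2 * (j - h)))) (2 * l + 2 * (j - h)))"
  have m: "(\<integral>\<zeta>. (\<zeta> $ c) ^ i \<partial>(unif_sphere :: (real ^ 'q) measure)) = ?m i" for i
    using integral_inner_power[of "axis c 1 :: real ^ 'q" i] by (simp add: inner_axis)
  have m_int: "integrable (unif_sphere :: (real ^ 'q) measure) (\<lambda>\<zeta>. (\<zeta> $ c) ^ i)" for i
    using integrable_mixed[of "axis c 1 :: real ^ 'q" i 0 0] by (simp add: inner_axis)
  have "leading_coeff TYPE('p) c j s = poly P s" for s
  proof -
    have "(\<integral>\<zeta>. (1 - (s * \<zeta> $ c)\<^sup>2) ^ h * (s * \<zeta> $ c) ^ (2 * (j - h)) \<partial>(unif_sphere :: (real ^ 'q) measure)) =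
        (\<Sum>l\<le>h. real (h choose l) * (-1) ^ l * ?m (2 * l + 2 * (j - h)) * s ^ (2 * l + 2 * (j - h)))" for h
    proof -
      have ex: "(1 - (s * z)\<^sup>2) ^ h * (s * z) ^ (2 * (j - h)) =
          (\<Sum>l\<le>h. (real (h choose l) * (-1) ^ l * s ^ (2 * l + 2 * (j - h))) * z ^ (2 * l + 2 * (j - h)))" for z
        unfolding one_minus_square_power sum_distrib_right
        by (simp add: power_add power_mult_distrib mult_ac)
      show ?thesis
        unfolding ex
        by (subst Bochner_Integration.integral_sum)
           (simp add: m_int, simp only: integral_mult_right_zero m, simp only: mult_ac)
    qed
    then show ?thesis
      by (simp add: leading_coeff_def P_def poly_sum poly_monom sum_distrib_left sum_distrib_right mult_ac)
  qed
  then have P: "leading_coeff TYPE('p) c j = poly P" by (simp add: fun_eq_iff)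
  have "leading_coeff TYPE('p) c j 0 = (\<Sum>h\<le>j. if h = j then ?\<kappa> j * (-1) ^ j else 0)"
    unfolding leading_coeff_def
    by (intro sum.cong refl) (use prob_space.prob_space[OF prob_space_unif_sphere[where 'a="real ^ 'q"]] in auto)
  then have "leading_coeff TYPE('p) c j 0 \<noteq> 0" using perp_moment_nonzero[OF two_le_dim[where 'p='p and 'q='q], of j] by simp
  then have "P \<noteq> 0" unfolding P by auto
  then show ?thesis unfolding P by (rule poly_roots_finite)
qed

text \<open>
On the sphere \<open>dist x y = sqrt (2 - 2 (x \<bullet> y))\<close>, so the kernel of \<open>measure_eqI_uniform_kernel\<close> is a
continuous function of \<open>x \<bullet> y\<close> and by Weierstrass a uniform limit of polynomials in it. The positive and
the negative part of \<open>F\<close> are therefore densities of measures with equal kernel integrals.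
\<close>

lemma sphere_function_zero_of_zonal_moments:
  fixes F :: "'a::euclidean_space \<Rightarrow> real"
  assumes F[measurable]: "F \<in> borel_measurable borel" and F_int: "integrable unif_sphere F"
    and mom: "\<And>y i. norm y = 1 \<Longrightarrow> (\<integral>x. F x * (x \<bullet> y) ^ i \<partial>unif_sphere) = 0"
  shows "AE x in unif_sphere. F x = 0"
proof -
  let ?S = "unif_sphere :: 'a measure"
  interpret S: prob_space ?S by (rule prob_space_unif_sphere)
  let ?k = "\<lambda>e y x :: 'a. max 0 (e - dist x y)"
  have mul_int: "integrable ?S (\<lambda>x. G x * h x)"
    if "integrable ?S G" "h \<in> borel_measurable borel" "\<And>x. norm x = 1 \<Longrightarrow> \<bar>h x\<bar> \<le> B"
    for G h :: "'a \<Rightarrow> real" and B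
  proof (rule Bochner_Integration.integrable_bound)
    show "integrable ?S (\<lambda>x. \<bar>B\<bar> * G x)" using that(1) by simp
    show "(\<lambda>x. G x * h x) \<in> borel_measurable ?S"
      using borel_measurable_integrable[OF that(1)] that(2) by (simp add: borel_unif_sphere)
    show "AE x in ?S. norm (G x * h x) \<le> norm (\<bar>B\<bar> * G x)"
      using AE_unif_sphere
    proof eventually_elim
      case (elim x)
      then have "\<bar>h x\<bar> \<le> \<bar>B\<bar>" using that(3)[of x] by simp
      then show ?case
        unfolding real_norm_def abs_mult abs_abs mult.commute[of "\<bar>G x\<bar>"] by (intro mult_right_mono) auto
    qed
  qed
  have k_int: "integrable ?S (\<lambda>x. G x * ?k e y x)" if "integrable ?S G" "0 < e" for G :: "'a \<Rightarrow> real" and e y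
    by (rule mul_int[of _ _ e]) (use that in auto)
  have F_k: "(\<integral>x. F x * ?k e y x \<partial>?S) = 0" if y: "norm y = 1" and e: "0 < e" for y e
  proof (rule ccontr)
    define J where "J = (\<integral>x. F x * ?k e y x \<partial>?S)"
    assume "(\<integral>x. F x * ?k e y x \<partial>?S) \<noteq> 0"
    then have J: "\<bar>J\<bar> > 0" by (simp add: J_def)
    define A where "A = (\<integral>x. \<bar>F x\<bar> \<partial>?S)"
    have A: "0 \<le> A" unfolding A_def by simp
    define d where "d = \<bar>J\<bar> / (2 * (A + 1))"
    have d: "0 < d" using J A by (simp add: d_def)
    define g where "g s = max 0 (e - sqrt (2 - 2 * s))" for s
    have "continuous_on {-1..1} g" unfolding g_def by (intro continuous_intros)
    then obtain p where p: "real_polynomial_function p" "\<And>s. s \<in> {-1..1} \<Longrightarrow> \<bar>g s - p s\<bar> < d"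
      using Stone_Weierstrass_real_polynomial_function[of "{-1..1}" g d] d by auto
    obtain a n where a: "p = (\<lambda>s. \<Sum>i\<le>n. a i * s ^ i)"
      using p(1) unfolding real_polynomial_function_iff_sum by blast
    have pow_int: "integrable ?S (\<lambda>x. F x * (x \<bullet> y) ^ i)" for i
    proof (rule mul_int[OF F_int])
      fix x :: 'a assume "norm x = 1"
      then have "\<bar>x \<bullet> y\<bar> \<le> 1" using abs_inner_sphere_le[of x y] y by simp
      then show "\<bar>(x \<bullet> y) ^ i\<bar> \<le> 1" unfolding power_abs by (intro power_le_one) auto
    qed measurable
    have Fp: "F x * p (x \<bullet> y) = (\<Sum>i\<le>n. a i * (F x * (x \<bullet> y) ^ i))" for x
      by (simp add: a sum_distrib_left mult_ac)
    have Fp_int: "integrable ?S (\<lambda>x. F x * p (x \<bullet> y))"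
      unfolding Fp by (intro Bochner_Integration.integrable_sum integrable_mult_right pow_int)
    have "(\<integral>x. F x * p (x \<bullet> y) \<partial>?S) = 0"
      unfolding Fp by (subst Bochner_Integration.integral_sum) (use pow_int mom[OF y] in auto)
    then have "J = (\<integral>x. F x * ?k e y x - F x * p (x \<bullet> y) \<partial>?S)"
      unfolding J_def using k_int[OF F_int e] Fp_int by simp
    then have "\<bar>J\<bar> \<le> (\<integral>x. \<bar>F x * ?k e y x - F x * p (x \<bullet> y)\<bar> \<partial>?S)"
      using integral_norm_bound[of ?S "\<lambda>x. F x * ?k e y x - F x * p (x \<bullet> y)"] by simp
    also have "\<dots> \<le> (\<integral>x. \<bar>F x\<bar> * d \<partial>?S)"
    proof (rule integral_mono_AE)
      show "AE x in ?S. \<bar>F x * ?k e y x - F x * p (x \<bullet> y)\<bar> \<le> \<bar>F x\<bar> * d"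
        using AE_unif_sphere
      proof eventually_elim
        case (elim x)
        then have x: "norm x = 1" by simp
        have "x \<bullet> x = 1" "y \<bullet> y = 1" using x y by (simp_all add: norm_eq_1)
        then have "dist x y = sqrt (2 - 2 * (x \<bullet> y))"
          by (simp add: dist_norm norm_eq_sqrt_inner inner_diff_left inner_diff_right inner_commute)
        then have "?k e y x = g (x \<bullet> y)" by (simp add: g_def)
        moreover have "\<bar>x \<bullet> y\<bar> \<le> 1" using abs_inner_sphere_le[OF x, of y] y by simp
        ultimately have "\<bar>?k e y x - p (x \<bullet> y)\<bar> \<le> d" using p(2)[of "x \<bullet> y"] by force
        then show ?case
          by (simp add: right_diff_distrib[symmetric] abs_mult mult_left_mono)
      qed
    qed (use k_int[OF F_int e] Fp_int F_int in auto)
    also have "\<dots> = A * d" by (simp add: A_def)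
    also have "\<dots> \<le> (A + 1) * d" using d by (intro mult_right_mono) auto
    also have "\<dots> = \<bar>J\<bar> / 2" using A by (simp add: d_def field_simps)
    finally show False using J by simp
  qed
  obtain b :: 'a where b: "b \<in> Basis" using nonempty_Basis by blast
  define c where "c e = (\<integral>x. ?k e b x \<partial>?S)" for e
  have unif: "(\<integral>x. ?k e y x \<partial>?S) = c e" if "y \<in> sphere 0 1" for y e
  proof -
    have by1: "b \<bullet> b = y \<bullet> y" using b that by (simp add: norm_eq_1)
    obtain T where T: "orthogonal_transformation T" "T b = y"
      by (rule orthogonal_transformation_of_pair[OF by1 by1 by1])
    have "(\<integral>x. ?k e y x \<partial>?S) = (\<integral>x. ?k e y (T x) \<partial>?S)"
      by (rule integral_unif_sphere_transform[OF T(1), symmetric]) measurable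
    then show ?thesis
      unfolding c_def T(2)[symmetric] by (simp add: dist_orthogonal_transformation[OF T(1)])
  qed
  have pos: "0 < c e" if e: "0 < e" for e
  proof (rule ccontr)
    assume "\<not> 0 < c e"
    moreover have "0 \<le> c e" unfolding c_def by simp
    ultimately have "c e = 0" by simp
    then have "(\<integral>x. ?k e b x \<partial>?S) = 0" by (simp add: c_def)
    then have "AE x in ?S. ?k e b x = 0"
      using integral_nonneg_eq_0_iff_AE[of ?S "?k e b"] k_int[of "\<lambda>_. 1" e b] e by auto
    then have "AE x in ?S. x \<notin> ball b e"
      by eventually_elim (auto simp: dist_commute max_def split: if_splits)
    then have "emeasure ?S (ball b e) = 0"
      by (subst (asm) AE_iff_null_sets[symmetric]) auto
    then show False using unif_sphere_open_pos[of "ball b e" b] b e by simp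
  qed
  define dens where "dens G = density ?S (\<lambda>x. ennreal (max 0 (G x)))" for G :: "'a \<Rightarrow> real"
  have dens_fin: "finite_measure (dens G)" if "integrable ?S G" for G :: "'a \<Rightarrow> real"
  proof
    have "(\<integral>\<^sup>+x. ennreal (max 0 (G x)) \<partial>?S) < \<infinity>"
      using integrableD(2)[OF integrable_max[OF integrable_zero that]] by (simp add: less_top)
    then show "emeasure (dens G) (space (dens G)) \<noteq> \<infinity>"
      using borel_measurable_integrable[OF that] by (simp add: dens_def emeasure_density)
  qed
  have dens_k: "(\<integral>x. ?k e y x \<partial>dens G) = (\<integral>x. max 0 (G x) * ?k e y x \<partial>?S)"
    if "integrable ?S G" for G :: "'a \<Rightarrow> real" and e y
    unfolding dens_def using borel_measurable_integrable[OF that]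
    by (subst integral_density) (auto simp: borel_unif_sphere)
  have dens_Z: "AE x in dens G. x \<in> sphere 0 1" if "integrable ?S G" for G :: "'a \<Rightarrow> real"
    unfolding dens_def using borel_measurable_integrable[OF that] AE_unif_sphere
    by (subst AE_density) (auto elim!: eventually_mono)
  have "dens F = dens (\<lambda>x. - F x)"
  proof (rule measure_eqI_uniform_kernel[of ?S _ _ "sphere 0 1" c])
    show "finite_measure ?S" by (rule S.finite_measure_axioms)
    fix y :: 'a and e :: real assume "y \<in> sphere 0 1" and e: "0 < e"
    then have y: "norm y = 1" by simp
    have i: "integrable ?S (\<lambda>x. max 0 (F x) * ?k e y x)" "integrable ?S (\<lambda>x. max 0 (- F x) * ?k e y x)"
      using F_int by (auto intro!: k_int e)
    have "(\<integral>x. max 0 (F x) * ?k e y x \<partial>?S) - (\<integral>x. max 0 (- F x) * ?k e y x \<partial>?S) =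
        (\<integral>x. max 0 (F x) * ?k e y x - max 0 (- F x) * ?k e y x \<partial>?S)"
      using i by simp
    also have "\<dots> = (\<integral>x. F x * ?k e y x \<partial>?S)"
      by (intro Bochner_Integration.integral_cong refl) (simp add: left_diff_distrib[symmetric] max_def)
    also have "\<dots> = 0" by (rule F_k[OF y e])
    finally show "(\<integral>x. ?k e y x \<partial>dens F) = (\<integral>x. ?k e y x \<partial>dens (\<lambda>x. - F x))"
      using F_int by (simp add: dens_k)
  qed (use dens_fin dens_Z F_int unif pos AE_unif_sphere in \<open>simp_all add: dens_def del: mem_sphere mem_sphere_0\<close>)
  then have "AE x in ?S. ennreal (max 0 (F x)) = ennreal (max 0 (- F x))"
    unfolding dens_def
    by (subst (asm) S.density_unique_iff) (auto simp: borel_unif_sphere)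
  then show ?thesis
    by eventually_elim (auto simp: max_def split: if_splits)
qed

text \<open>
The adjoint formula is applied to \<open>f\<close> and \<open>g\<close> separately and the results are subtracted, since the
transform of \<open>f - g\<close> is the difference of the transforms only for almost every frame. Then induction on the
degree removes the lower terms of the kernel, and the leading coefficient can be cancelled.
\<close>

lemma injective_off_leading_zeros:
  fixes \<mu> :: "(real ^ 'q ^ ('p::finite + 'q::finite)) measure" and c :: 'q
  assumes \<mu>: "invariant_prob_on_stiefel \<mu>"
    and nz: "\<And>j. leading_coeff TYPE('p) c j (sin t) \<noteq> 0"
  shows "funk_radon_injective \<mu> t"
  unfolding funk_radon_injective_def
proof (intro ballI impI)
  fix f g :: "real ^ ('p + 'q) \<Rightarrow> real"
  assume fg: "f \<in> L1_even" "g \<in> L1_even"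
    and eq: "AE v in \<mu>. shifted_funk_radon t f v = shifted_funk_radon t g v"
  let ?S = "unif_sphere :: (real ^ ('p + 'q)) measure"
  define \<nu> where "\<nu> = distr \<mu> borel (\<lambda>v. v)"
  interpret frame_measure \<nu> unfolding \<nu>_def by (rule frame_measure_of_invariant(1)[OF \<mu>])
  note id_meas = frame_measure_of_invariant(2)[OF \<mu>] and space_\<mu> = frame_measure_of_invariant(3)[OF \<mu>]
  \<comment> \<open>The representatives are arbitrary off the sphere; extension by zero makes them Borel.\<close>
  define ext where "ext h x = indicator (sphere 0 1) x *\<^sub>R h x" for h :: "real ^ ('p + 'q) \<Rightarrow> real" and x
  have ext_eq: "ext h x = h x" if "norm x = 1" for h x using that by (simp add: ext_def)
  have ext: "ext h \<in> borel_measurable borel" "integrable ?S (ext h)" "AE x in ?S. ext h (- x) = ext h x"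
    if "h \<in> L1_even" for h
  proof -
    have h: "integrable sphere_measure h" "AE x in sphere_measure. h (- x) = h x"
      using that by (auto simp: L1_even_def)
    have "h \<in> borel_measurable (restrict_space borel (sphere 0 1))"
      using borel_measurable_integrable[OF h(1)] by (simp add: measurable_cong_sets[OF sets_sphere_measure refl])
    then show m: "ext h \<in> borel_measurable borel"
      unfolding ext_def[abs_def] by (subst (asm) borel_measurable_restrict_space_iff) (auto simp: borel_closed)
    have "integrable sphere_measure (ext h) \<longleftrightarrow> integrable sphere_measure h"
      by (rule Bochner_Integration.integrable_cong) (auto simp: ext_eq)
    then show "integrable ?S (ext h)" using h(1) by (simp add: integrable_sphere_measure_iff[OF m])
    note [measurable] = m
    have "AE x in sphere_measure. ext h (- x) = ext h x"
      using h(2) AE_space by eventually_elim (simp add: ext_eq)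
    then show "AE x in ?S. ext h (- x) = ext h x"
      by (subst (asm) AE_sphere_measure_iff) auto
  qed
  define F where "F x = ext f x - ext g x" for x
  have F[measurable]: "F \<in> borel_measurable borel"
    unfolding F_def using ext(1)[OF fg(1)] ext(1)[OF fg(2)] by measurable
  have F_int: "integrable ?S F"
    unfolding F_def using ext(2)[OF fg(1)] ext(2)[OF fg(2)] by simp
  have F_even: "AE x in ?S. F (- x) = F x"
    using ext(3)[OF fg(1)] ext(3)[OF fg(2)] by eventually_elim (simp add: F_def)
  define R where "R h v = (\<integral>\<zeta>. (\<integral>z. h (frame_point t v \<zeta> z) \<partial>?S) \<partial>(unif_sphere :: (real ^ 'q) measure))" for h :: "real ^ ('p + 'q) \<Rightarrow> real" and v
  have R_meas: "R h \<in> borel_measurable borel" if [measurable]: "h \<in> borel_measurable borel" for h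
    unfolding R_def
    by (intro fibre.borel_measurable_lebesgue_integral sphere.borel_measurable_lebesgue_integral) measurable
  note [measurable] = R_meas[OF ext(1)[OF fg(1)]] R_meas[OF ext(1)[OF fg(2)]]
  have R_eq: "AE v in \<nu>. R (ext f) v = R (ext g) v"
  proof -
    have "AE v in \<mu>. R (ext f) v = R (ext g) v"
      using eq AE_space
    proof eventually_elim
      case (elim v)
      then have v: "v \<in> stiefel" by (simp add: space_\<mu>)
      have "shifted_funk_radon t h v = R (ext h) v" if "h \<in> L1_even" for h
      proof -
        have "shifted_funk_radon t h v = shifted_funk_radon t (ext h) v"
          by (rule shifted_funk_radon_cong_sphere[OF v]) (simp add: ext_eq)
        then show ?thesis
          unfolding R_def using shifted_funk_radon_frame_point[OF v ext(1)[OF that]] by simp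
      qed
      then show ?case using elim fg by simp
    qed
    then show ?thesis unfolding \<nu>_def by (subst AE_distr_iff[OF id_meas]) auto
  qed
  have pow_int: "integrable ?S (\<lambda>x. G x * (x \<bullet> y) ^ i)"
    if "integrable ?S G" "norm y = 1" for G :: "real ^ ('p + 'q) \<Rightarrow> real" and y i
  proof (rule Bochner_Integration.integrable_bound[OF that(1)])
    show "(\<lambda>x. G x * (x \<bullet> y) ^ i) \<in> borel_measurable ?S"
      using borel_measurable_integrable[OF that(1)] by (simp add: borel_unif_sphere)
    show "AE x in ?S. norm (G x * (x \<bullet> y) ^ i) \<le> norm (G x)"
      using AE_unif_sphere
    proof eventually_elim
      case (elim x)
      then have "\<bar>x \<bullet> y\<bar> \<le> 1" using abs_inner_sphere_le[of x y] that(2) by simp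
      then have "\<bar>x \<bullet> y\<bar> ^ i \<le> 1" by (intro power_le_one) auto
      then show ?case
        using mult_left_mono[of "\<bar>x \<bullet> y\<bar> ^ i" 1 "\<bar>G x\<bar>"] by (simp add: abs_mult power_abs)
    qed
  qed
  have mom: "(\<integral>x. F x * (x \<bullet> y) ^ i \<partial>?S) = 0" if y: "norm y = 1" for y i
  proof (cases "even i")
    case False
    have "(\<integral>x. F x * (x \<bullet> y) ^ i \<partial>?S) = (\<integral>x. F (- x) * (- x \<bullet> y) ^ i \<partial>?S)"
      by (rule integral_unif_sphere_transform[OF orthogonal_transformation_uminus, symmetric]) measurable
    also have "\<dots> = (\<integral>x. - (F x * (x \<bullet> y) ^ i) \<partial>?S)"
    proof (rule integral_cong_AE)
      show "AE x in ?S. F (- x) * (- x \<bullet> y) ^ i = - (F x * (x \<bullet> y) ^ i)"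
        using F_even by eventually_elim (use False in simp)
    qed measurable
    finally show ?thesis by simp
  next
    case True
    define M where "M i = (\<integral>x. F x * (x \<bullet> y) ^ i \<partial>?S)" for i
    define I where "I j h G = (\<integral>x. G x * ((1 - (x \<bullet> y)\<^sup>2) ^ h * (x \<bullet> y) ^ (2 * (j - h))) \<partial>?S)"
      for j h and G :: "real ^ ('p + 'q) \<Rightarrow> real"
    have expand: "G x * ((1 - (x \<bullet> y)\<^sup>2) ^ h * (x \<bullet> y) ^ (2 * (j - h))) =
        (\<Sum>l\<le>h. real (h choose l) * (-1) ^ l * (G x * (x \<bullet> y) ^ (2 * (l + (j - h)))))"
      for G :: "real ^ ('p + 'q) \<Rightarrow> real" and x j h
      unfolding one_minus_square_power sum_distrib_right sum_distrib_left
      by (rule sum.cong[OF refl]) (simp add: distrib_left power_add mult_ac)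
    have I_int: "integrable ?S (\<lambda>x. G x * ((1 - (x \<bullet> y)\<^sup>2) ^ h * (x \<bullet> y) ^ (2 * (j - h))))"
      if "integrable ?S G" for G j h
      unfolding expand by (intro Bochner_Integration.integrable_sum integrable_mult_right pow_int that y)
    have I_M: "I j h F = (\<Sum>l\<le>h. real (h choose l) * (-1) ^ l * M (2 * (l + (j - h))))" for j h
      unfolding I_def M_def expand
      by (subst Bochner_Integration.integral_sum) (use pow_int[OF F_int y] in auto)
    have I_diff: "I j h F = I j h (ext f) - I j h (ext g)" for j h
      unfolding I_def F_def left_diff_distrib
      using I_int[OF ext(2)[OF fg(1)]] I_int[OF ext(2)[OF fg(2)]] by simp
    define B where "B j h = real (2 * j choose (2 * h)) * perp_moment TYPE(real ^ ('p + 'q)) h *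
       (\<integral>\<zeta>. (1 - (sin t * \<zeta> $ c)\<^sup>2) ^ h * (sin t * \<zeta> $ c) ^ (2 * (j - h)) \<partial>(unif_sphere :: (real ^ 'q) measure))" for j h
    have sum0: "(\<Sum>h\<le>j. B j h * I j h F) = 0" for j
    proof -
      define pw where "pw u = (if \<bar>u\<bar> \<le> 1 then u ^ (2 * j) else 0)" for u :: real
      have [measurable]: "pw \<in> borel_measurable borel" unfolding pw_def by measurable
      have adj: "(\<integral>v. pw (column c v \<bullet> y) * R (ext h) v \<partial>\<nu>) = (\<Sum>i\<le>j. B j i * I j i (ext h))"
        if "h \<in> L1_even" for h
        unfolding pw_def R_def B_def I_def
        by (rule adjoint_on_zonal_power[OF ext(1)[OF that] ext(2)[OF that] y])
      have "(\<integral>v. pw (column c v \<bullet> y) * R (ext f) v \<partial>\<nu>) = (\<integral>v. pw (column c v \<bullet> y) * R (ext g) v \<partial>\<nu>)"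
        by (rule integral_cong_AE) (use R_eq in \<open>auto elim!: eventually_mono\<close>)
      then show ?thesis
        unfolding adj[OF fg(1)] adj[OF fg(2)] I_diff by (simp add: right_diff_distrib sum_subtractf)
    qed
    have "M (2 * j) = 0" for j
    proof (induction j rule: less_induct)
      case (less j)
      have "I j h F = (-1) ^ h * M (2 * j)" if "h \<le> j" for h
      proof -
        have "I j h F = (\<Sum>l\<le>h. if l = h then (-1) ^ h * M (2 * j) else 0)"
          unfolding I_M
        proof (rule sum.cong[OF refl])
          fix l assume l: "l \<in> {..h}"
          show "real (h choose l) * (-1) ^ l * M (2 * (l + (j - h))) = (if l = h then (-1) ^ h * M (2 * j) else 0)"
          proof (cases "l = h")
            case False
            then have "l + (j - h) < j" using l that by auto
            then have "M (2 * (l + (j - h))) = 0" by (rule less.IH)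
            then show ?thesis using False by (simp del: distrib_left_numeral)
          qed (use that in simp)
        qed
        then show ?thesis by simp
      qed
      then have "0 = (\<Sum>h\<le>j. B j h * ((-1) ^ h * M (2 * j)))"
        using sum0[of j] by simp
      also have "\<dots> = leading_coeff TYPE('p) c j (sin t) * M (2 * j)"
        unfolding leading_coeff_def B_def sum_distrib_right by (simp only: mult.assoc)
      finally show ?case using nz[of j] by simp
    qed
    then have "M i = 0" using True by auto
    then show ?thesis by (simp only: M_def)
  qed
  have "AE x in ?S. F x = 0"
    by (rule sphere_function_zero_of_zonal_moments[OF F F_int mom])
  then have "AE x in sphere_measure. F x = 0"
    by (subst AE_sphere_measure_iff) auto
  then show "AE x in sphere_measure. f x = g x"
    using AE_space by eventually_elim (simp add: F_def ext_eq)
qed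

text \<open>
The complement of a countable set meets every non-empty open interval.
\<close>

lemma injective_dense:
  fixes \<mu> :: "(real ^ 'q ^ ('p::finite + 'q::finite)) measure"
  assumes \<mu>: "invariant_prob_on_stiefel \<mu>"
  shows "{0<..<pi / 2} \<subseteq> closure {t \<in> {0<..<pi / 2}. funk_radon_injective \<mu> t}"
proof -
  obtain c :: 'q where True by blast
  define bad where "bad = (\<Union>j. {t \<in> {0<..<pi / 2}. leading_coeff TYPE('p) c j (sin t) = 0})"
  have "finite {t \<in> {0<..<pi / 2}. leading_coeff TYPE('p) c j (sin t) = 0}" for j
  proof (rule inj_on_finite)
    show "inj_on sin {t \<in> {0<..<pi / 2}. leading_coeff TYPE('p) c j (sin t) = 0}"
      by (rule inj_onI) (auto intro!: sin_inj_pi)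
    show "sin ` {t \<in> {0<..<pi / 2}. leading_coeff TYPE('p) c j (sin t) = 0} \<subseteq>
        {s. leading_coeff TYPE('p) c j s = 0}" by auto
    show "finite {s. leading_coeff TYPE('p) c j s = 0}" by (rule finite_leading_coeff_zeros)
  qed
  then have countable: "countable bad"
    unfolding bad_def by (intro countable_UN[OF countableI_type] countable_finite)
  have good: "funk_radon_injective \<mu> t" if "t \<in> {0<..<pi / 2}" "t \<notin> bad" for t
    by (rule injective_off_leading_zeros[OF \<mu>, of c]) (use that in \<open>auto simp: bad_def\<close>)
  show ?thesis
  proof
    fix t0 :: real assume t0: "t0 \<in> {0<..<pi / 2}"
    show "t0 \<in> closure {t \<in> {0<..<pi / 2}. funk_radon_injective \<mu> t}"
      unfolding closure_approachable
    proof (intro allI impI)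
      fix e :: real assume e: "0 < e"
      define \<beta> where "\<beta> = min (t0 + e) (pi / 2)"
      have "t0 < \<beta>" using t0 e by (simp add: \<beta>_def)
      then have "uncountable {t0<..<\<beta>}" by (simp add: uncountable_open_interval)
      then have "\<not> {t0<..<\<beta>} \<subseteq> bad" using countable countable_subset by blast
      then obtain t where "t \<in> {t0<..<\<beta>}" "t \<notin> bad" by blast
      then show "\<exists>t\<in>{t \<in> {0<..<pi / 2}. funk_radon_injective \<mu> t}. dist t t0 < e"
        using t0 good by (intro bexI[of _ t]) (auto simp: \<beta>_def dist_real_def)
    qed
  qed
qed

theorem corollary1p2:
  fixes n k :: nat
    and \<mu> :: "(real ^ 'q ^ ('p::finite + 'q::finite)) measure"
  assumes "n \<ge> 2" and "1 \<le> k" and "k \<le> n - 1"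
    and "CARD('p) = k + 1" and "CARD('q) = n - k"
    and "invariant_prob_on_stiefel \<mu>"
  shows "{0<..<pi / 2} \<subseteq> closure {t \<in> {0<..<pi / 2}. \<not> funk_radon_injective \<mu> t} \<and>
         {0<..<pi / 2} \<subseteq> closure {t \<in> {0<..<pi / 2}. funk_radon_injective \<mu> t}"
  using noninjective_dense injective_dense assms(6) by blast

end
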